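(* Let $M\ge2$ be an integer constant and let $\tilde p(x|\theta)=\binom{M}{x}\theta^x(1-\theta)^{M-x}$, $x=0,1,\ldots,M$, be the binomial distribution $\mathrm{Bin}(M,\theta)$, $0<\theta<1$. Let $H\ge2$ be an integer and let $T_1,\ldots,T_{H-1}$ be constants with $0<T_i<1$ and $\sum_{i=1}^{H-1}T_i<1$. Consider the mixture model with $H$ parameters $(\theta_1,\ldots,\theta_H)$, $$p(x|\theta)=T_1\tilde p(x|\theta_1)+\cdots+T_{H-1}\tilde p(x|\theta_{H-1})+\left(1-\sum_{i=1}^{H-1}T_i\right)\tilde p(x|\theta_H),$$ and suppose the true distribution is $q(x)=\tilde p(x|\theta_* )$ with a constant $0<\theta_*<1$. Then the learning coefficient is $$\lambda=\frac{H+1}{4}.$$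
   Context: For a statistical model $p(x|\theta)$ with parameter $\theta\in\Theta\subset\mathbb{R}^d$ and true distribution $q$, let $X\sim q$, $K(\theta)=\mathbb{E}_X\left[\log\frac{q(X)}{p(X|\theta)}\right]$ (Kullback-Leibler divergence) and $\Theta_*=\{\theta\in\Theta: K(\theta)=0\}$ (the set of realization parameters, i.e. those with $p(\cdot|\theta)=q$). The prior density is assumed positive at all points of $\Theta_*$. Real log canonical threshold and learning coefficient. For $P\in\Theta_*$, take a resolution of singularities $g:U\to W$ of $K$ near $P$: $g$ is a proper analytic map from a real analytic manifold to a neighborhood $W$ of $P$, an isomorphism away from $U_0=g^{-1}(K^{-1}(0))$, such that at each $Q\in U_0$ there are local coordinates $u$ centered at $Q$ with $K(g(u))=a(u)u_1^{k_1}\cdots u_d^{k_d}$ and $|g'(u)|=|b(u)u_1^{h_1}\cdots u_d^{h_d}|$, with $k_i=k_i^{(Q)},h_i=h_i^{(Q)}\in\mathbb{Z}_{\ge0}$ and $a(0)\ne0\ne b(0)$. The real log canonical threshold at $P$ is $\lambda_P=\inf_{Q}\min_i\frac{h_i^{(Q)}+1}{k_i^{(Q)}}$ (with value $\infty$ for indices with $k_i=0$). The learning coefficient is $\lambda=\inf_{P\in\Theta_*}\lambda_P$. *)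

theory Defs
  imports "HOL-Analysis.Analysis" "HOL-Probability.Probability"
begin

section \<open>Real analytic functions of several variables\<close>

text \<open>The multi-indices are the functions \<open>'n \<Rightarrow> nat\<close>. For real series \<open>has_sum\<close> is absolute
  convergence, the usual notion for multiple power series.\<close>

definition real_analytic_at :: "(real ^ 'n \<Rightarrow> real) \<Rightarrow> real ^ 'n \<Rightarrow> bool" where
  "real_analytic_at f x \<longleftrightarrow>
     (\<exists>c :: ('n \<Rightarrow> nat) \<Rightarrow> real. \<exists>r > 0. \<forall>y \<in> ball x r.
        ((\<lambda>\<alpha>. c \<alpha> * (\<Prod>i\<in>UNIV. (y $ i - x $ i) ^ \<alpha> i)) has_sum f y) UNIV)"

text \<open>The following two predicates are only applied to open sets \<open>S\<close>.\<close>

definition real_analytic_on :: "(real ^ 'n \<Rightarrow> real) \<Rightarrow> (real ^ 'n) set \<Rightarrow> bool" where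
  "real_analytic_on f S \<longleftrightarrow> (\<forall>x\<in>S. real_analytic_at f x)"

definition analytic_map_on :: "(real ^ 'n \<Rightarrow> real ^ 'm) \<Rightarrow> (real ^ 'n) set \<Rightarrow> bool" where
  "analytic_map_on f S \<longleftrightarrow> (\<forall>j. real_analytic_on (\<lambda>x. f x $ j) S)"

section \<open>Real analytic manifolds\<close>

text \<open>A chart is a pair \<open>(V, \<phi>)\<close>; only the restriction of \<open>\<phi>\<close> to \<open>V\<close> matters. The dimension of
  the manifold is \<open>CARD('n)\<close>.\<close>

type_synonym ('u, 'n) chart = "'u set \<times> ('u \<Rightarrow> real ^ 'n)"

definition is_chart :: "'u topology \<Rightarrow> ('u, 'n::finite) chart \<Rightarrow> bool" where
  "is_chart X = (\<lambda>(V, \<phi>). openin X V \<and> open (\<phi> ` V) \<and>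
     homeomorphic_map (subtopology X V) (top_of_set (\<phi> ` V)) \<phi>)"

definition analytic_transition :: "('u, 'n::finite) chart \<Rightarrow> ('u, 'n) chart \<Rightarrow> bool" where
  "analytic_transition = (\<lambda>(V, \<phi>) (V', \<phi>').
     analytic_map_on (\<phi>' \<circ> inv_into V \<phi>) (\<phi> ` (V \<inter> V')))"

definition analytic_manifold :: "'u topology \<Rightarrow> ('u, 'n::finite) chart set \<Rightarrow> bool" where
  "analytic_manifold X A \<longleftrightarrow>
     Hausdorff_space X \<and> second_countable X \<and>
     (\<forall>C\<in>A. is_chart X C) \<and> (\<Union>C\<in>A. fst C) = topspace X \<and>
     (\<forall>C\<in>A. \<forall>C'\<in>A. analytic_transition C C')"

text \<open>Local coordinates centered at \<open>Q\<close> are any chart of the maximal atlas sending \<open>Q\<close> to \<open>0\<close>.\<close>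

definition local_coordinates ::
  "'u topology \<Rightarrow> ('u, 'n::finite) chart set \<Rightarrow> 'u \<Rightarrow> ('u, 'n) chart \<Rightarrow> bool" where
  "local_coordinates X A Q C \<longleftrightarrow>
     is_chart X C \<and> (\<forall>C'\<in>A. analytic_transition C C' \<and> analytic_transition C' C) \<and>
     Q \<in> fst C \<and> snd C Q = 0"

section \<open>Resolution of singularities\<close>

text \<open>\<open>normal_crossing\<close>: \<open>K(g(u)) = a(u) u\<^sup>k\<close> and \<open>\<bar>g'(u)\<bar> = \<bar>b(u) u\<^sup>h\<bar>\<close> in some local coordinates
  \<open>u\<close> centered at \<open>Q\<close>, where \<open>g'(u)\<close> is the Jacobian determinant.\<close>

definition normal_crossing ::
  "(real ^ 'n::finite \<Rightarrow> real) \<Rightarrow> 'u topology \<Rightarrow> ('u, 'n) chart set \<Rightarrow> ('u \<Rightarrow> real ^ 'n) \<Rightarrow>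
   'u \<Rightarrow> ('n \<Rightarrow> nat) \<Rightarrow> ('n \<Rightarrow> nat) \<Rightarrow> bool" where
  "normal_crossing K X A g Q k h \<longleftrightarrow>
     (\<exists>V \<phi> a b. local_coordinates X A Q (V, \<phi>) \<and>
        real_analytic_on a (\<phi> ` V) \<and> real_analytic_on b (\<phi> ` V) \<and> a 0 \<noteq> 0 \<and> b 0 \<noteq> 0 \<and>
        (\<forall>u \<in> \<phi> ` V.
           K (g (inv_into V \<phi> u)) = a u * (\<Prod>i\<in>UNIV. (u $ i) ^ k i) \<and>
           \<bar>det (jacobian (g \<circ> inv_into V \<phi>) (at u))\<bar> = \<bar>b u * (\<Prod>i\<in>UNIV. (u $ i) ^ h i)\<bar>))"

definition zero_fibre :: "(real ^ 'n \<Rightarrow> real) \<Rightarrow> 'u topology \<Rightarrow> ('u \<Rightarrow> real ^ 'n) \<Rightarrow> 'u set" where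
  "zero_fibre K X g = {Q \<in> topspace X. K (g Q) = 0}"

text \<open>\<open>g\<close> maps the manifold \<open>(X, A)\<close> to the open set \<open>W\<close>; the exponents \<open>k\<^sup>Q\<close>, \<open>h\<^sup>Q\<close> are
  \<open>k Q\<close>, \<open>h Q\<close>.\<close>

definition resolution ::
  "(real ^ 'n::finite \<Rightarrow> real) \<Rightarrow> (real ^ 'n) set \<Rightarrow> 'u topology \<Rightarrow> ('u, 'n) chart set \<Rightarrow>
   ('u \<Rightarrow> real ^ 'n) \<Rightarrow> ('u \<Rightarrow> 'n \<Rightarrow> nat) \<Rightarrow> ('u \<Rightarrow> 'n \<Rightarrow> nat) \<Rightarrow> bool" where
  "resolution K W X A g k h \<longleftrightarrow>
     analytic_manifold X A \<and>
     continuous_map X (top_of_set W) g \<and> proper_map X (top_of_set W) g \<and>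
     (\<forall>(V, \<phi>)\<in>A. analytic_map_on (g \<circ> inv_into V \<phi>) (\<phi> ` V)) \<and>
     (let U\<^sub>0 = zero_fibre K X g; U' = topspace X - U\<^sub>0 in
        bij_betw g U' {\<theta> \<in> W. K \<theta> \<noteq> 0} \<and>
        (\<forall>(V, \<phi>)\<in>A. analytic_map_on (\<phi> \<circ> inv_into U' g) (g ` (V - U\<^sub>0))) \<and>
        (\<forall>Q\<in>U\<^sub>0. normal_crossing K X A g Q (k Q) (h Q)))"

section \<open>Real log canonical threshold and learning coefficient\<close>

definition resolution_threshold ::
  "'u set \<Rightarrow> ('u \<Rightarrow> 'n::finite \<Rightarrow> nat) \<Rightarrow> ('u \<Rightarrow> 'n \<Rightarrow> nat) \<Rightarrow> ereal" where
  "resolution_threshold U\<^sub>0 k h =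
     (INF Q\<in>U\<^sub>0. INF i. if k Q i = 0 then \<infinity> else ereal ((real (h Q i) + 1) / real (k Q i)))"

text \<open>``Near \<open>P\<close>'' means over arbitrarily small open neighbourhoods \<open>W\<close> of \<open>P\<close> inside the
  parameter set \<open>\<Theta>\<close>: the infimum over all of \<open>g\<^sup>-\<^sup>1(K\<^sup>-\<^sup>1(0))\<close> could otherwise see zeros of \<open>K\<close>
  far from \<open>P\<close>. The points of the resolving manifold are taken from \<open>nat \<Rightarrow> real\<close> (with an
  arbitrary topology on an arbitrary subset); this loses nothing, since a second countable
  Hausdorff manifold has at most the cardinality of the continuum.\<close>

definition is_rlct ::
  "(real ^ 'n::finite) set \<Rightarrow> (real ^ 'n \<Rightarrow> real) \<Rightarrow> real ^ 'n \<Rightarrow> ereal \<Rightarrow> bool" where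
  "is_rlct \<Theta> K P l \<longleftrightarrow>
     (\<forall>N. open N \<and> P \<in> N \<longrightarrow>
        (\<exists>W (X :: (nat \<Rightarrow> real) topology) A g k h.
           open W \<and> P \<in> W \<and> W \<subseteq> N \<inter> \<Theta> \<and> resolution K W X A g k h \<and>
           l = resolution_threshold (zero_fibre K X g) k h))"

definition rlct :: "(real ^ 'n::finite) set \<Rightarrow> (real ^ 'n \<Rightarrow> real) \<Rightarrow> real ^ 'n \<Rightarrow> ereal" where
  "rlct \<Theta> K P = (THE l. is_rlct \<Theta> K P l)"

definition KL_fun :: "'x pmf \<Rightarrow> ('x \<Rightarrow> real ^ 'n \<Rightarrow> real) \<Rightarrow> real ^ 'n \<Rightarrow> real" where
  "KL_fun q p \<theta> = measure_pmf.expectation q (\<lambda>x. ln (pmf q x / p x \<theta>))"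

definition realization_params ::
  "'x pmf \<Rightarrow> ('x \<Rightarrow> real ^ 'n \<Rightarrow> real) \<Rightarrow> (real ^ 'n) set \<Rightarrow> (real ^ 'n) set" where
  "realization_params q p \<Theta> = {\<theta> \<in> \<Theta>. KL_fun q p \<theta> = 0}"

definition learning_coefficient ::
  "'x pmf \<Rightarrow> ('x \<Rightarrow> real ^ 'n::finite \<Rightarrow> real) \<Rightarrow> (real ^ 'n) set \<Rightarrow> ereal" where
  "learning_coefficient q p \<Theta> = (INF P \<in> realization_params q p \<Theta>. rlct \<Theta> (KL_fun q p) P)"

section \<open>Binomial mixtures with known mixing weights\<close>

text \<open>The components are indexed by \<open>'n\<close>; \<open>z\<close> is the last one, whose weight is determined by
  the others (the value \<open>T z\<close> is not used).\<close>

definition binomial_mixture ::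
  "nat \<Rightarrow> ('n::finite \<Rightarrow> real) \<Rightarrow> 'n \<Rightarrow> nat \<Rightarrow> real ^ 'n \<Rightarrow> real" where
  "binomial_mixture M T z x \<theta> =
     (\<Sum>i\<in>UNIV - {z}. T i * pmf (binomial_pmf M (\<theta> $ i)) x)
     + (1 - (\<Sum>i\<in>UNIV - {z}. T i)) * pmf (binomial_pmf M (\<theta> $ z)) x"

end

theory Submission
  imports Defs "HOL-Computational_Algebra.Fundamental_Theorem_Algebra"
begin

text \<open>Write \<open>b\<^sub>i = \<theta>\<^sub>i - \<theta>\<^sub>*\<close> and let \<open>m\<^sub>1\<close>, \<open>m\<^sub>2\<close> be the weighted sums of the \<open>b\<^sub>i\<close> and of the
  \<open>b\<^sub>i\<^sup>2\<close>. As \<open>M \<ge> 2\<close>, the model determines its first two moments, so \<open>K\<close> vanishes only at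
  \<open>b = 0\<close> and is comparable to \<open>(\<bar>m\<^sub>1\<bar> + m\<^sub>2)\<^sup>2\<close> there. In linear coordinates containing \<open>m\<^sub>1\<close> the
  set \<open>K \<le> t\<close> is therefore comparable to a box with one side \<open>t\<^bsup>1/2\<^esup>\<close> and \<open>H - 1\<close> sides \<open>t\<^bsup>1/4\<^esup>\<close>,
  of volume \<open>t\<^bsup>(H+1)/4\<^esup>\<close>.

  The threshold of every resolution equals this volume exponent: it is not smaller, because boxes
  close to a divisor \<open>u\<^sub>i = 0\<close> have images of volume \<open>\<delta>\<^bsup>h+1\<^esup>\<close> where \<open>K \<le> C \<delta>\<^bsup>k\<^esup>\<close>, and it is not larger,
  because finitely many charts cover the compact fibre and bound the volume of \<open>K \<le> t\<close> near the
  point by \<open>C t\<^sup>s\<close> for every \<open>s\<close> below the threshold. Hence the real log canonical threshold is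
  determined as soon as a resolution exists.

  A resolution is obtained by blowing up the point and then the ideal generated by \<open>m\<^sub>1\<close> and the
  \<open>b\<^sub>i\<^sup>2\<close>. In each chart \<open>p - q\<close> is a monomial \<open>E\<close> times functions without common zero on the
  fibre, and with \<open>r = (p - q)/q\<close> and \<open>G r = (r - ln (1 + r)) / r\<^sup>2 > 0\<close> one has
  \<open>K = (\<Sum>x. q r\<^sup>2 G r)\<close>, which is \<open>E\<^sup>2\<close> times an analytic unit.\<close>

section \<open>Real analytic functions\<close>

text \<open>Since \<open>rlct\<close> is a \<open>THE\<close> over all resolutions on all small
  neighbourhoods, a computation in one resolution cannot suffice. The volume exponent is defined
  without any resolution and so forces a common value; the explicit resolution then serves as the
  existence half.

  The ideal of the second center is that of no smooth subvariety in the original coordinates. After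
  the first blow-up, in a chart \<open>x_b = w\<close>, \<open>x_z = w v\<close> with
  \<open>b \<noteq> z\<close>, it becomes \<open>w\<close> times the ideal \<open>(v, w)\<close>, so
  that the center is the smooth set \<open>v = w = 0\<close>; in the chart of \<open>x_z\<close> it
  is already principal. Blowing up the product of both ideals does the two steps at once, inside a
  product with a single projective space. Every point is then a list of real numbers, as the type of
  the points in \<open>is_rlct\<close> demands.

  The hypothesis \<open>M \<ge> 2\<close> enters twice: to bound both moments by the divergence, and
  to make the first two Taylor coefficient vectors of the binomial probabilities linearly
  independent, which excludes a common zero after division by \<open>E\<close>.\<close>

definition mono_pow :: "('n::finite \<Rightarrow> nat) \<Rightarrow> real ^ 'n \<Rightarrow> real" where
  "mono_pow \<alpha> v = (\<Prod>i\<in>UNIV. (v $ i) ^ \<alpha> i)"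

lemma mono_pow_zero [simp]: "mono_pow (\<lambda>_. 0) v = 1"
  by (simp add: mono_pow_def)

lemma mono_pow_add: "mono_pow (\<lambda>i. \<alpha> i + \<beta> i) v = mono_pow \<alpha> v * mono_pow \<beta> v"
  by (simp add: mono_pow_def power_add prod.distrib)

lemma mono_pow_at_zero: "\<alpha> \<noteq> (\<lambda>_. 0) \<Longrightarrow> mono_pow \<alpha> 0 = 0"
  unfolding mono_pow_def by (auto simp: fun_eq_iff intro!: prod_zero)

lemma mono_pow_scale: "mono_pow \<alpha> (t *\<^sub>R v) = t ^ (\<Sum>i\<in>UNIV. \<alpha> i) * mono_pow \<alpha> v"
  by (simp add: mono_pow_def power_mult_distrib prod.distrib power_sum)

lemma abs_mono_pow_le:
  assumes "\<And>i. \<bar>v $ i\<bar> \<le> w $ i"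
  shows "\<bar>mono_pow \<alpha> v\<bar> \<le> mono_pow \<alpha> w"
  unfolding mono_pow_def abs_prod power_abs
  by (intro prod_mono conjI power_mono assms) auto

lemma real_analytic_at_iff:
  "real_analytic_at f x \<longleftrightarrow>
     (\<exists>c. \<exists>r>0. \<forall>v. norm v < r \<longrightarrow> ((\<lambda>\<alpha>. c \<alpha> * mono_pow \<alpha> v) has_sum f (x + v)) UNIV)"
    (is "_ \<longleftrightarrow> ?R")
proof
  assume "real_analytic_at f x"
  then obtain c r where "r > 0" and c: "\<And>y. y \<in> ball x r \<Longrightarrow>
     ((\<lambda>\<alpha>. c \<alpha> * (\<Prod>i\<in>UNIV. (y $ i - x $ i) ^ \<alpha> i)) has_sum f y) UNIV"
    unfolding real_analytic_at_def by blast
  have "((\<lambda>\<alpha>. c \<alpha> * mono_pow \<alpha> v) has_sum f (x + v)) UNIV" if "norm v < r" for v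
    using c[of "x + v"] that by (simp add: mono_pow_def dist_norm)
  then show ?R using \<open>r > 0\<close> by blast
next
  assume ?R
  then obtain c r where "r > 0" and c: "\<And>v. norm v < r \<Longrightarrow>
     ((\<lambda>\<alpha>. c \<alpha> * mono_pow \<alpha> v) has_sum f (x + v)) UNIV"
    by blast
  have "((\<lambda>\<alpha>. c \<alpha> * (\<Prod>i\<in>UNIV. (y $ i - x $ i) ^ \<alpha> i)) has_sum f y) UNIV"
    if "y \<in> ball x r" for y
    using c[of "y - x"] that by (simp add: mono_pow_def dist_norm norm_minus_commute)
  then show "real_analytic_at f x" unfolding real_analytic_at_def using \<open>r > 0\<close> by blast
qed

text \<open>Sums of monomials indexed by an arbitrary type become power series after collecting equal
  exponents; absolute convergence makes this legitimate.\<close>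

lemma real_analytic_at_regroup:
  fixes C :: "'j \<Rightarrow> real" and \<pi> :: "'j \<Rightarrow> 'n::finite \<Rightarrow> nat"
  assumes "r > 0"
    and sum: "\<And>v. norm v < r \<Longrightarrow> ((\<lambda>j. C j * mono_pow (\<pi> j) v) has_sum f (x + v)) UNIV"
  shows "real_analytic_at f x"
  unfolding real_analytic_at_iff
proof (intro exI conjI allI impI)
  show "r > 0" by fact
  fix v :: "real ^ 'n" assume v: "norm v < r"
  let ?F = "\<lambda>(\<gamma>, j). C j * mono_pow (\<pi> j) v"
  let ?B = "\<lambda>\<gamma>. {j. \<pi> j = \<gamma>}"
  have "(?F has_sum f (x + v)) (Sigma UNIV ?B)
        \<longleftrightarrow> ((\<lambda>j. C j * mono_pow (\<pi> j) v) has_sum f (x + v)) UNIV"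
    by (rule has_sum_reindex_bij_witness[of _ "\<lambda>j. (\<pi> j, j)" snd]) auto
  then have big: "(?F has_sum f (x + v)) (Sigma UNIV ?B)"
    using sum[OF v] by blast
  \<comment> \<open>The coefficient must not depend on \<open>v\<close>. If \<open>C\<close> is not
    summable over a fibre, \<open>infsum\<close> is 0, which is harmless: summability of the
    products then forces the monomial to vanish at \<open>v\<close>.\<close>
  show "((\<lambda>\<alpha>. infsum C {j. \<pi> j = \<alpha>} * mono_pow \<alpha> v) has_sum f (x + v)) UNIV"
  proof (rule has_sum_SigmaD[OF big])
    fix \<gamma>
    have "(\<lambda>j. C j * mono_pow (\<pi> j) v) summable_on ?B \<gamma>"
      using summable_on_subset_banach[OF has_sum_imp_summable[OF sum[OF v]]] by blast
    then have "((\<lambda>j. C j * mono_pow (\<pi> j) v) has_sum infsum (\<lambda>j. C j * mono_pow (\<pi> j) v) (?B \<gamma>)) (?B \<gamma>)"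
      by simp
    moreover have "infsum (\<lambda>j. C j * mono_pow (\<pi> j) v) (?B \<gamma>) = infsum (\<lambda>j. C j * mono_pow \<gamma> v) (?B \<gamma>)"
      by (rule infsum_cong) auto
    ultimately show "((\<lambda>j. ?F (\<gamma>, j)) has_sum infsum C (?B \<gamma>) * mono_pow \<gamma> v) (?B \<gamma>)"
      by (simp add: infsum_cmult_left')
  qed
qed

lemma real_analytic_at_transform:
  assumes "real_analytic_at f x" "open S" "x \<in> S" "\<And>y. y \<in> S \<Longrightarrow> f y = g y"
  shows "real_analytic_at g x"
proof -
  obtain c r where r: "r > 0" "\<And>y. y \<in> ball x r \<Longrightarrow>
     ((\<lambda>\<alpha>. c \<alpha> * (\<Prod>i\<in>UNIV. (y $ i - x $ i) ^ \<alpha> i)) has_sum f y) UNIV"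
    using assms(1) unfolding real_analytic_at_def by blast
  obtain e where e: "e > 0" "ball x e \<subseteq> S"
    using assms(2,3) open_contains_ball by blast
  have "\<forall>y\<in>ball x (min r e). ((\<lambda>\<alpha>. c \<alpha> * (\<Prod>i\<in>UNIV. (y $ i - x $ i) ^ \<alpha> i)) has_sum g y) UNIV"
  proof
    fix y assume y: "y \<in> ball x (min r e)"
    then have "f y = g y" using e assms(4) by auto
    then show "((\<lambda>\<alpha>. c \<alpha> * (\<Prod>i\<in>UNIV. (y $ i - x $ i) ^ \<alpha> i)) has_sum g y) UNIV"
      using r(2)[of y] y by simp
  qed
  then show ?thesis unfolding real_analytic_at_def using r(1) e(1)
    by (intro exI[of _ c] exI[of _ "min r e"]) auto
qed

lemma real_analytic_at_shift:
  "real_analytic_at f (x + c) \<Longrightarrow> real_analytic_at (\<lambda>u. f (u + c)) x"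
  unfolding real_analytic_at_iff by (simp add: add_ac)

lemma real_analytic_at_const: "real_analytic_at (\<lambda>_. a) x"
proof (rule real_analytic_at_regroup[of 1 "\<lambda>_::unit. a" "\<lambda>_ _. 0"])
  show "((\<lambda>j::unit. a * mono_pow (\<lambda>_. 0) v) has_sum a) UNIV" for v :: "real ^ 'n"
    using has_sum_finite[of "UNIV :: unit set" "\<lambda>_. a"] by (simp add: UNIV_unit)
qed simp

lemma real_analytic_at_component:
  fixes x :: "real ^ 'n::finite"
  shows "real_analytic_at (\<lambda>u. u $ i) x"
proof (rule real_analytic_at_regroup[of 1 "\<lambda>b. if b then x $ i else 1"
        "\<lambda>b. if b then (\<lambda>_. 0) else (\<lambda>j. if j = i then 1 else 0)"])
  fix v :: "real ^ 'n"
  have "mono_pow (\<lambda>j. if j = i then 1 else 0) v = v $ i"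
    unfolding mono_pow_def by (subst prod.remove[of _ i]) auto
  moreover have "((\<lambda>b. (if b then x $ i else 1) * mono_pow (if b then \<lambda>_. 0 else (\<lambda>j. if j = i then 1 else 0)) v)
     has_sum (\<Sum>b\<in>(UNIV::bool set). (if b then x $ i else 1) * mono_pow (if b then \<lambda>_. 0 else (\<lambda>j. if j = i then 1 else 0)) v)) UNIV"
    by (rule has_sum_finite) simp
  ultimately show "((\<lambda>b. (if b then x $ i else 1) * mono_pow (if b then \<lambda>_. 0 else (\<lambda>j. if j = i then 1 else 0)) v)
     has_sum (x + v) $ i) UNIV"
    by (simp add: UNIV_bool add.commute)
qed simp

lemma real_analytic_at_add:
  assumes "real_analytic_at f x" "real_analytic_at g x"
  shows "real_analytic_at (\<lambda>u. f u + g u) x"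
proof -
  obtain c r where c: "r > 0" "\<And>v. norm v < r \<Longrightarrow> ((\<lambda>\<alpha>. c \<alpha> * mono_pow \<alpha> v) has_sum f (x + v)) UNIV"
    using assms(1) unfolding real_analytic_at_iff by blast
  obtain d s where d: "s > 0" "\<And>v. norm v < s \<Longrightarrow> ((\<lambda>\<alpha>. d \<alpha> * mono_pow \<alpha> v) has_sum g (x + v)) UNIV"
    using assms(2) unfolding real_analytic_at_iff by blast
  show ?thesis unfolding real_analytic_at_iff
  proof (intro exI conjI allI impI)
    show "0 < min r s" using c(1) d(1) by simp
    fix v :: "real ^ 'a" assume "norm v < min r s"
    then show "((\<lambda>\<alpha>. (c \<alpha> + d \<alpha>) * mono_pow \<alpha> v) has_sum (f (x + v) + g (x + v))) UNIV"
      using has_sum_add[OF c(2)[of v] d(2)[of v]] by (simp add: distrib_right)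
  qed
qed

lemma summable_on_norm_real:
  fixes f :: "'a \<Rightarrow> real"
  shows "f summable_on A \<Longrightarrow> (\<lambda>a. norm (f a)) summable_on A"
  by (rule iffD1[OF summable_on_iff_abs_summable_on_real])

text \<open>Real summability is absolute, and the norms of the products factor, so the double family
  is summable over the rectangle; summing first over one factor gives the value.\<close>

lemma has_sum_product_real:
  fixes f :: "'a \<Rightarrow> real" and g :: "'b \<Rightarrow> real"
  assumes f: "(f has_sum s) A" and g: "(g has_sum t) B"
  shows "((\<lambda>(a, b). f a * g b) has_sum (s * t)) (A \<times> B)"
proof (rule has_sum_SigmaI)
  show "((\<lambda>b. case (a, b) of (a, b) \<Rightarrow> f a * g b) has_sum (f a * t)) B" for a
    unfolding prod.case by (rule has_sum_cmult_right[OF g])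
  show "((\<lambda>a. f a * t) has_sum s * t) A"
    by (rule has_sum_cmult_left[OF f])
  have fs: "(\<lambda>a. norm (f a)) summable_on A"
    by (rule summable_on_norm_real[OF has_sum_imp_summable[OF f]])
  have gs: "(\<lambda>b. norm (g b)) summable_on B"
    by (rule summable_on_norm_real[OF has_sum_imp_summable[OF g]])
  have "(\<lambda>p. norm (case p of (a, b) \<Rightarrow> f a * g b)) summable_on A \<times> B"
  proof (subst Infinite_Sum.abs_summable_on_Sigma_iff, intro conjI ballI)
    show "(\<lambda>b. norm (case (a, b) of (a, b) \<Rightarrow> f a * g b)) summable_on B" for a
      unfolding prod.case norm_mult by (rule summable_on_cmult_right[OF gs])
    have "infsum (\<lambda>b. norm (case (a, b) of (a, b) \<Rightarrow> f a * g b)) B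
        = norm (f a) * infsum (\<lambda>b. norm (g b)) B" for a
      unfolding prod.case norm_mult by (rule infsum_cmult_right')
    moreover have "infsum (\<lambda>b. norm (g b)) B \<ge> 0"
      by (rule infsum_nonneg) (rule norm_ge_zero)
    ultimately show "(\<lambda>a. norm (infsum (\<lambda>b. norm (case (a, b) of (a, b) \<Rightarrow> f a * g b)) B)) summable_on A"
      using summable_on_cmult_left[OF fs, of "infsum (\<lambda>b. norm (g b)) B"]
      by (simp add: abs_mult abs_of_nonneg)
  qed
  then show "(\<lambda>(a, b). f a * g b) summable_on A \<times> B"
    by (rule iffD2[OF summable_on_iff_abs_summable_on_real])
qed

lemma real_analytic_at_mult:
  assumes "real_analytic_at f x" "real_analytic_at g x"
  shows "real_analytic_at (\<lambda>u. f u * g u) x"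
proof -
  obtain c r where c: "r > 0" "\<And>v. norm v < r \<Longrightarrow> ((\<lambda>\<alpha>. c \<alpha> * mono_pow \<alpha> v) has_sum f (x + v)) UNIV"
    using assms(1) unfolding real_analytic_at_iff by blast
  obtain d s where d: "s > 0" "\<And>v. norm v < s \<Longrightarrow> ((\<lambda>\<alpha>. d \<alpha> * mono_pow \<alpha> v) has_sum g (x + v)) UNIV"
    using assms(2) unfolding real_analytic_at_iff by blast
  show ?thesis
  proof (rule real_analytic_at_regroup[of "min r s" "\<lambda>(\<alpha>, \<beta>). c \<alpha> * d \<beta>" "\<lambda>(\<alpha>, \<beta>) i. \<alpha> i + \<beta> i"])
    fix v :: "real ^ 'a" assume "norm v < min r s"
    then have "((\<lambda>(\<alpha>, \<beta>). (c \<alpha> * mono_pow \<alpha> v) * (d \<beta> * mono_pow \<beta> v)) has_sum f (x + v) * g (x + v)) (UNIV \<times> UNIV)"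
      by (intro has_sum_product_real c d) auto
    moreover have "(\<lambda>(\<alpha>, \<beta>). (c \<alpha> * mono_pow \<alpha> v) * (d \<beta> * mono_pow \<beta> v))
       = (\<lambda>j. (case j of (\<alpha>, \<beta>) \<Rightarrow> c \<alpha> * d \<beta>) * mono_pow ((\<lambda>(\<alpha>, \<beta>) i. \<alpha> i + \<beta> i) j) v)"
      by (auto simp: fun_eq_iff mono_pow_add)
    ultimately show "((\<lambda>j. (case j of (\<alpha>, \<beta>) \<Rightarrow> c \<alpha> * d \<beta>) * mono_pow ((\<lambda>(\<alpha>, \<beta>) i. \<alpha> i + \<beta> i) j) v)
        has_sum f (x + v) * g (x + v)) UNIV"
      by simp
  qed (use c d in auto)
qed

lemma real_analytic_at_minus:
  "real_analytic_at f x \<Longrightarrow> real_analytic_at (\<lambda>u. - f u) x"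
  using real_analytic_at_mult[OF real_analytic_at_const[of "-1"], of f x] by simp

lemma real_analytic_at_diff:
  "real_analytic_at f x \<Longrightarrow> real_analytic_at g x \<Longrightarrow> real_analytic_at (\<lambda>u. f u - g u) x"
  using real_analytic_at_add[OF _ real_analytic_at_minus, of f x g] by simp

lemma real_analytic_at_power:
  "real_analytic_at f x \<Longrightarrow> real_analytic_at (\<lambda>u. f u ^ n) x"
  by (induction n) (simp_all add: real_analytic_at_const real_analytic_at_mult)

lemma real_analytic_at_sum:
  "(\<And>i. i \<in> I \<Longrightarrow> real_analytic_at (f i) x) \<Longrightarrow> real_analytic_at (\<lambda>u. \<Sum>i\<in>I. f i u) x"
  by (induction I rule: infinite_finite_induct) (simp_all add: real_analytic_at_const real_analytic_at_add)

lemma real_analytic_at_prod: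
  "(\<And>i. i \<in> I \<Longrightarrow> real_analytic_at (f i) x) \<Longrightarrow> real_analytic_at (\<lambda>u. \<Prod>i\<in>I. f i u) x"
  by (induction I rule: infinite_finite_induct) (simp_all add: real_analytic_at_const real_analytic_at_mult)

lemma real_analytic_at_poly:
  "real_analytic_at f x \<Longrightarrow> real_analytic_at (\<lambda>u. poly p (f u)) x"
  by (induction p) (simp_all add: real_analytic_at_const real_analytic_at_add real_analytic_at_mult)

lemmas real_analytic_intros =
  real_analytic_at_const real_analytic_at_component real_analytic_at_add real_analytic_at_diff
  real_analytic_at_minus real_analytic_at_mult real_analytic_at_power real_analytic_at_sum
  real_analytic_at_prod real_analytic_at_poly

subsection \<open>Composition with power series in one variable\<close>

lemma analytic_coefficient_at_zero:
  assumes "((\<lambda>\<alpha>. c \<alpha> * mono_pow \<alpha> (0 :: real ^ 'n::finite)) has_sum s) UNIV"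
  shows "c (\<lambda>_. 0) = s"
proof -
  have "((\<lambda>\<alpha>. c \<alpha> * mono_pow \<alpha> (0 :: real ^ 'n::finite)) has_sum c (\<lambda>_. 0)) UNIV
     \<longleftrightarrow> ((\<lambda>\<alpha>. c \<alpha> * mono_pow \<alpha> (0 :: real ^ 'n::finite)) has_sum c (\<lambda>_. 0)) {\<lambda>_. 0}"
    by (rule has_sum_cong_neutral) (auto simp: mono_pow_at_zero)
  then have "((\<lambda>\<alpha>. c \<alpha> * mono_pow \<alpha> (0 :: real ^ 'n::finite)) has_sum c (\<lambda>_. 0)) UNIV"
    using has_sum_finite[of "{\<lambda>_. 0}" "\<lambda>\<alpha>. c \<alpha> * mono_pow \<alpha> (0 :: real ^ 'n)"] by simp
  then show ?thesis using assms has_sum_unique by blast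
qed

text \<open>Expanding over lists keeps each term a plain product, without multinomial coefficients;
  terms with equal exponents are merged only at the end, by
  \<open>real_analytic_at_regroup\<close>.\<close>

lemma has_sum_power_lists:
  fixes G :: "'a \<Rightarrow> real"
  assumes "(G has_sum s) UNIV"
  shows "((\<lambda>xs. prod_list (map G xs)) has_sum s ^ n) {xs. length xs = n}"
proof (induction n)
  case 0
  then show ?case using has_sum_finite[of "{[]}" "\<lambda>xs. prod_list (map G xs)"] by simp
next
  case (Suc n)
  have "((\<lambda>xs. prod_list (map G xs)) has_sum s ^ Suc n) {xs. length xs = Suc n} \<longleftrightarrow>
     ((\<lambda>(x, xs). G x * prod_list (map G xs)) has_sum s ^ Suc n) (UNIV \<times> {xs. length xs = n})"
    by (rule has_sum_reindex_bij_witness[of _ "\<lambda>(x, xs). x # xs" "\<lambda>xs. (hd xs, tl xs)"])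
       (auto simp: length_Suc_conv)
  then show ?case using has_sum_product_real[OF assms Suc.IH] by simp
qed

text \<open>The double family over lengths and lists is dominated by the one-variable series of
  absolute values at \<open>S\<close>, the sum of the norms of \<open>G\<close>. As
  \<open>S < r\<close>, that series converges and the order of summation is free.\<close>

lemma has_sum_powser_lists:
  fixes G :: "'a \<Rightarrow> real" and a :: "nat \<Rightarrow> real"
  assumes "(G has_sum s) UNIV" "infsum (\<lambda>x. norm (G x)) UNIV < r"
    and sums: "\<And>t. \<bar>t\<bar> < r \<Longrightarrow> (\<lambda>n. a n * t ^ n) sums F t"
  shows "((\<lambda>xs. a (length xs) * prod_list (map G xs)) has_sum F s) UNIV"
proof -
  define S where "S = infsum (\<lambda>x. norm (G x)) UNIV"
  have Gn: "((\<lambda>x. \<bar>G x\<bar>) has_sum S) UNIV"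
    using has_sum_imp_summable[OF assms(1)] unfolding S_def
    by (subst (asm) summable_on_iff_abs_summable_on_real) simp
  have "S \<ge> 0" unfolding S_def by (rule infsum_nonneg) auto
  have sS: "\<bar>s\<bar> \<le> S"
    using norm_infsum_le[OF assms(1) Gn] by simp
  \<comment> \<open>Convergence is given on the open disc only; \<open>powser_insidea\<close> turns
    convergence at a larger point into absolute convergence, hence a point strictly between
    \<open>S\<close> and \<open>r\<close>.\<close>
  obtain t where t: "S < t" "t < r" using assms(2) dense unfolding S_def by blast
  have "summable (\<lambda>n. a n * t ^ n)" using sums[of t] t \<open>S \<ge> 0\<close> by (simp add: sums_iff)
  then have absum: "summable (\<lambda>n. norm (a n * y ^ n))" if "\<bar>y\<bar> \<le> S" for y
    using powser_insidea[of a t y] t \<open>S \<ge> 0\<close> that by simp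
  let ?f = "\<lambda>(n, xs). a n * prod_list (map G xs)"
  let ?D = "Sigma UNIV (\<lambda>n. {xs. length xs = n})"
  have "(\<lambda>p. \<bar>?f p\<bar>) summable_on ?D"
  proof (rule summable_on_SigmaI)
    fix n
    have *: "\<bar>prod_list (map G xs)\<bar> = prod_list (map (\<lambda>x. \<bar>G x\<bar>) xs)" for xs
      by (induction xs) (auto simp: abs_mult)
    show "((\<lambda>xs. \<bar>?f (n, xs)\<bar>) has_sum \<bar>a n\<bar> * S ^ n) {xs. length xs = n}"
      using has_sum_cmult_right[OF has_sum_power_lists[OF Gn, of n], of "\<bar>a n\<bar>"]
      by (simp add: abs_mult *)
  next
    show "(\<lambda>n. \<bar>a n\<bar> * S ^ n) summable_on UNIV"
      using absum[of S] \<open>S \<ge> 0\<close> summable_on_UNIV_nonneg_real_iff[of "\<lambda>n. \<bar>a n\<bar> * S ^ n"]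
      by (simp add: abs_mult power_abs)
  qed auto
  then have "?f summable_on ?D"
    by (subst summable_on_iff_abs_summable_on_real) simp
  then have "(?f has_sum F s) ?D"
  proof (rule has_sum_SigmaI[rotated 2])
    show "((\<lambda>xs. ?f (n, xs)) has_sum a n * s ^ n) {xs. length xs = n}" for n
      using has_sum_cmult_right[OF has_sum_power_lists[OF assms(1)]] by simp
    show "((\<lambda>n. a n * s ^ n) has_sum F s) UNIV"
      using norm_summable_imp_has_sum[OF absum[OF sS] sums] sS t by simp
  qed
  moreover have "(?f has_sum F s) ?D \<longleftrightarrow>
      ((\<lambda>xs. a (length xs) * prod_list (map G xs)) has_sum F s) UNIV"
    by (rule has_sum_reindex_bij_witness[of _ "\<lambda>xs. (length xs, xs)" snd]) auto
  ultimately show ?thesis by blast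
qed

lemma mono_pow_sum_list:
  "mono_pow (\<lambda>i. sum_list (map (\<lambda>\<alpha>. \<alpha> i) xs)) v = prod_list (map (\<lambda>\<alpha>. mono_pow \<alpha> v) xs)"
  by (induction xs) (auto simp: mono_pow_add)

lemma sum_nat_pos: "\<alpha> \<noteq> (\<lambda>_. 0) \<Longrightarrow> 1 \<le> (\<Sum>i\<in>(UNIV :: 'n::finite set). (\<alpha> i :: nat))"
  by (rule ccontr) (auto simp: fun_eq_iff not_le)

text \<open>The corner of a cube: absolute convergence at this one point dominates the series on the
  whole cube, since monomials are monotone in the absolute values of the coordinates.\<close>

definition diag_vec :: "real \<Rightarrow> real ^ 'n" where
  "diag_vec \<rho> = (\<chi> i. \<rho>)"

lemma norm_diag_vec_less: "r > 0 \<Longrightarrow> \<exists>\<rho>>0. norm (diag_vec \<rho> :: real ^ 'n::finite) < r"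
proof -
  assume "r > 0"
  define N where "N = real CARD('n)"
  have "N > 0" unfolding N_def by simp
  have "norm (diag_vec \<rho> :: real ^ 'n) \<le> N * \<bar>\<rho>\<bar>" for \<rho>
    using norm_le_l1_cart[of "diag_vec \<rho> :: real ^ 'n"] by (simp add: diag_vec_def N_def)
  moreover have "N * \<bar>r / (2 * N)\<bar> < r" using \<open>r > 0\<close> \<open>N > 0\<close> by (simp add: field_simps)
  ultimately have "norm (diag_vec (r / (2 * N)) :: real ^ 'n) < r" by (rule le_less_trans)
  then show ?thesis using \<open>r > 0\<close> \<open>N > 0\<close>
    by (intro exI[of _ "r / (2 * N)"]) auto
qed

text \<open>Shrinking a point by \<open>\<tau>\<close> gains \<open>\<tau>\<close> to the degree of
  the monomial. Used with \<open>k = 1\<close> for composition, where the constant term is removed,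
  and with \<open>k = 2\<close> for the Taylor remainder.\<close>

lemma abs_mono_pow_le_diag:
  assumes "norm v \<le> \<tau> * \<rho>"  "\<rho> \<ge> 0" "0 \<le> \<tau>" "\<tau> \<le> 1" "k \<le> (\<Sum>i\<in>UNIV. \<alpha> i)"
  shows "\<bar>mono_pow \<alpha> v\<bar> \<le> \<tau> ^ k * mono_pow \<alpha> (diag_vec \<rho>)"
proof -
  have "\<bar>v $ i\<bar> \<le> (\<tau> *\<^sub>R diag_vec \<rho>) $ i" for i
    using component_le_norm_cart[of v i] assms by (simp add: diag_vec_def)
  then have "\<bar>mono_pow \<alpha> v\<bar> \<le> \<tau> ^ (\<Sum>i\<in>UNIV. \<alpha> i) * mono_pow \<alpha> (diag_vec \<rho>)"
    by (metis abs_mono_pow_le mono_pow_scale)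
  also have "\<dots> \<le> \<tau> ^ k * mono_pow \<alpha> (diag_vec \<rho>)"
    using assms by (intro mult_right_mono power_decreasing) (auto simp: mono_pow_def diag_vec_def intro!: prod_nonneg)
  finally show ?thesis .
qed

text \<open>Without its constant term, the series of \<open>f - f x\<close> has absolute sum at most
  \<open>\<tau> * S\<close> on the cube shrunk by \<open>\<tau>\<close>, where \<open>S\<close> is
  the sum at the corner. The choice of \<open>\<tau>\<close> brings this below \<open>r\<close>, so
  \<open>has_sum_powser_lists\<close> applies.\<close>

lemma real_analytic_at_powser_compose:
  assumes f: "real_analytic_at f x" and "r > 0"
    and sums: "\<And>t. \<bar>t\<bar> < r \<Longrightarrow> (\<lambda>n. a n * t ^ n) sums F (f x + t)"
  shows "real_analytic_at (\<lambda>u. F (f u)) x"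
proof -
  have "real_analytic_at (\<lambda>u. f u - f x) x" using f by (intro real_analytic_at_diff real_analytic_at_const)
  then obtain c R where c: "R > 0"
      "\<And>v. norm v < R \<Longrightarrow> ((\<lambda>\<alpha>. c \<alpha> * mono_pow \<alpha> v) has_sum (f (x + v) - f x)) UNIV"
    unfolding real_analytic_at_iff by blast
  have c0: "c (\<lambda>_. 0) = 0" using analytic_coefficient_at_zero[OF c(2)[of 0]] c(1) by simp
  obtain \<rho> where \<rho>: "\<rho> > 0" "norm (diag_vec \<rho> :: real ^ 'a) < R" using norm_diag_vec_less[OF c(1)] by blast
  define S where "S = infsum (\<lambda>\<alpha>. norm (c \<alpha> * mono_pow \<alpha> (diag_vec \<rho>))) UNIV"
  have "S \<ge> 0" unfolding S_def by (rule infsum_nonneg) auto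
  have Ssum: "((\<lambda>\<alpha>. norm (c \<alpha> * mono_pow \<alpha> (diag_vec \<rho>))) has_sum S) UNIV"
    using has_sum_imp_summable[OF c(2)[OF \<rho>(2)]] unfolding S_def
    by (subst (asm) summable_on_iff_abs_summable_on_real) simp
  define \<tau> where "\<tau> = min 1 (r / (2 * (S + 1)))"
  have \<tau>: "0 < \<tau>" "\<tau> \<le> 1" "\<tau> * S < r"
  proof -
    show "0 < \<tau>" "\<tau> \<le> 1" using \<open>S \<ge> 0\<close> \<open>r > 0\<close> by (auto simp: \<tau>_def)
    have "\<tau> * S \<le> r / (2 * (S + 1)) * S" using \<open>S \<ge> 0\<close> by (intro mult_right_mono) (auto simp: \<tau>_def)
    also have "\<dots> < r" using \<open>S \<ge> 0\<close> \<open>r > 0\<close> by (simp add: divide_simps)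
    finally show "\<tau> * S < r" .
  qed
  show ?thesis
  proof (rule real_analytic_at_regroup[of "min R (\<tau> * \<rho>)" "\<lambda>xs. a (length xs) * prod_list (map c xs)"
        "\<lambda>xs i. sum_list (map (\<lambda>\<alpha>. \<alpha> i) xs)"])
    show "0 < min R (\<tau> * \<rho>)" using c \<tau> \<rho> by simp
    fix v :: "real ^ 'a" assume v: "norm v < min R (\<tau> * \<rho>)"
    let ?G = "\<lambda>\<alpha>. c \<alpha> * mono_pow \<alpha> v"
    have G: "(?G has_sum (f (x + v) - f x)) UNIV" using c(2) v by simp
    have "infsum (\<lambda>\<alpha>. norm (?G \<alpha>)) UNIV \<le> \<tau> * S"
    proof (rule has_sum_mono)
      show "((\<lambda>\<alpha>. norm (?G \<alpha>)) has_sum infsum (\<lambda>\<alpha>. norm (?G \<alpha>)) UNIV) UNIV"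
        using has_sum_imp_summable[OF G] by (subst (asm) summable_on_iff_abs_summable_on_real) simp
      show "((\<lambda>\<alpha>. \<tau> * norm (c \<alpha> * mono_pow \<alpha> (diag_vec \<rho>))) has_sum \<tau> * S) UNIV"
        by (rule has_sum_cmult_right[OF Ssum])
      fix \<alpha> :: "'a \<Rightarrow> nat"
      show "norm (?G \<alpha>) \<le> \<tau> * norm (c \<alpha> * mono_pow \<alpha> (diag_vec \<rho>))"
      proof (cases "\<alpha> = (\<lambda>_. 0)")
        case False
        have "\<bar>mono_pow \<alpha> v\<bar> \<le> \<tau> ^ 1 * mono_pow \<alpha> (diag_vec \<rho>)"
          using v \<rho> \<tau> sum_nat_pos[OF False] by (intro abs_mono_pow_le_diag) auto
        then have "\<bar>c \<alpha>\<bar> * \<bar>mono_pow \<alpha> v\<bar> \<le> \<bar>c \<alpha>\<bar> * (\<tau> * \<bar>mono_pow \<alpha> (diag_vec \<rho>)\<bar>)"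
          by (intro mult_left_mono) (auto intro: order_trans mult_left_mono[OF abs_ge_self] simp: \<tau>(1) less_imp_le)
        then show ?thesis by (simp add: abs_mult mult.left_commute)
      qed (simp add: c0)
    qed
    then have less: "infsum (\<lambda>\<alpha>. norm (?G \<alpha>)) UNIV < r" using \<tau> by simp
    have "((\<lambda>xs. a (length xs) * prod_list (map ?G xs)) has_sum F (f x + (f (x + v) - f x))) UNIV"
      using has_sum_powser_lists[OF G less, of a "\<lambda>t. F (f x + t)"] sums by blast
    moreover have "prod_list (map ?G xs) = prod_list (map c xs) * prod_list (map (\<lambda>\<alpha>. mono_pow \<alpha> v) xs)" for xs
      by (induction xs) auto
    ultimately show "((\<lambda>xs. a (length xs) * prod_list (map c xs) * mono_pow (\<lambda>i. sum_list (map (\<lambda>\<alpha>. \<alpha> i) xs)) v)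
        has_sum F (f (x + v))) UNIV"
      by (simp add: mono_pow_sum_list mult.assoc)
  qed
qed

lemma real_analytic_at_inverse:
  assumes "real_analytic_at f x" "f x \<noteq> 0"
  shows "real_analytic_at (\<lambda>u. inverse (f u)) x"
proof (rule real_analytic_at_powser_compose[OF assms(1), of "\<bar>f x\<bar>" "\<lambda>n. (-1) ^ n / f x ^ Suc n"])
  fix t assume t: "\<bar>t\<bar> < \<bar>f x\<bar>"
  have "(\<lambda>n. (- t / f x) ^ n) sums (1 / (1 - (- t / f x)))"
    using t assms(2) by (intro geometric_sums) simp
  then have "(\<lambda>n. inverse (f x) * (- t / f x) ^ n) sums (inverse (f x) * (1 / (1 - (- t / f x))))"
    by (rule sums_mult)
  moreover have "inverse (f x) * (1 / (1 - (- t / f x))) = inverse (f x + t)"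
    using t assms(2) by (auto simp: field_simps)
  moreover have "inverse (f x) * (- t / f x) ^ n = (-1) ^ n / f x ^ Suc n * t ^ n" for n
  proof -
    have "(- t / f x) ^ n = (-1) ^ n * t ^ n / f x ^ n"
      by (subst power_divide, subst power_minus, rule refl)
    then show ?thesis by (simp add: divide_inverse)
  qed
  ultimately show "(\<lambda>n. (-1) ^ n / f x ^ Suc n * t ^ n) sums inverse (f x + t)" by simp
qed (use assms in auto)

lemma real_analytic_at_divide:
  assumes "real_analytic_at f x" "real_analytic_at g x" "g x \<noteq> 0"
  shows "real_analytic_at (\<lambda>u. f u / g u) x"
  using real_analytic_at_mult[OF assms(1) real_analytic_at_inverse[OF assms(2,3)]]
  by (simp add: divide_inverse)

subsection \<open>Differentiability\<close>

text \<open>Apart from the constant and linear terms every exponent has degree at least 2, so the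
  remainder is at most \<open>S / \<rho>\<^sup>2\<close> times the squared norm of
  \<open>v\<close>.\<close>

lemma real_analytic_at_differentiable:
  fixes f :: "real ^ 'n::finite \<Rightarrow> real"
  assumes "real_analytic_at f x"
  shows "f differentiable (at x)"
proof -
  obtain c R where c: "R > 0"
      "\<And>v. norm v < R \<Longrightarrow> ((\<lambda>\<alpha>. c \<alpha> * mono_pow \<alpha> v) has_sum (f (x + v))) UNIV"
    using assms unfolding real_analytic_at_iff by blast
  obtain \<rho> where \<rho>: "\<rho> > 0" "norm (diag_vec \<rho> :: real ^ 'n) < R" using norm_diag_vec_less[OF c(1)] by blast
  define S where "S = infsum (\<lambda>\<alpha>. norm (c \<alpha> * mono_pow \<alpha> (diag_vec \<rho>))) UNIV"
  have "S \<ge> 0" unfolding S_def by (rule infsum_nonneg) auto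
  have Ssum: "((\<lambda>\<alpha>. norm (c \<alpha> * mono_pow \<alpha> (diag_vec \<rho>))) has_sum S) UNIV"
    using has_sum_imp_summable[OF c(2)[OF \<rho>(2)]] unfolding S_def
    by (subst (asm) summable_on_iff_abs_summable_on_real) simp
  define e where "e i = (\<lambda>j::'n. if j = i then 1 else 0 :: nat)" for i
  have me: "mono_pow (e i) v = v $ i" for i v
    unfolding mono_pow_def e_def by (subst prod.remove[of _ i]) auto
  define A where "A = insert (\<lambda>_. 0) (range e)"
  have e_inj: "inj e" by (auto simp: inj_def e_def fun_eq_iff split: if_splits)
  have e_ne: "e i \<noteq> (\<lambda>_. 0)" for i by (auto simp: e_def fun_eq_iff)
  have big: "2 \<le> (\<Sum>i\<in>UNIV. \<alpha> i)" if "\<alpha> \<notin> A" for \<alpha> :: "'n \<Rightarrow> nat"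
  proof (rule ccontr)
    assume "\<not> 2 \<le> (\<Sum>i\<in>UNIV. \<alpha> i)"
    moreover have "\<alpha> \<noteq> (\<lambda>_. 0)" using that by (auto simp: A_def)
    ultimately have "(\<Sum>i\<in>UNIV. \<alpha> i) = 1" using sum_nat_pos[of \<alpha>] by linarith
    then obtain i where "\<alpha> i \<noteq> 0" by (metis sum.neutral zero_neq_one)
    moreover have "\<alpha> i + (\<Sum>j\<in>UNIV - {i}. \<alpha> j) = 1"
      using \<open>(\<Sum>i\<in>UNIV. \<alpha> i) = 1\<close> by (simp add: sum.remove[of UNIV i])
    ultimately have "\<alpha> i = 1" "(\<Sum>j\<in>UNIV - {i}. \<alpha> j) = 0" by linarith+
    then have i: "\<alpha> i = 1" "\<forall>j. j \<noteq> i \<longrightarrow> \<alpha> j = 0" by auto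
    then have "\<alpha> = e i" by (auto simp: e_def fun_eq_iff)
    then show False using that by (auto simp: A_def)
  qed
  define L where "L v = (\<Sum>i\<in>UNIV. c (e i) * v $ i)" for v :: "real ^ 'n"
  have rem: "\<bar>f (x + v) - f x - L v\<bar> \<le> (S / \<rho>\<^sup>2) * (norm v)\<^sup>2" if v: "norm v < min R \<rho>" for v
  proof -
    let ?G = "\<lambda>\<alpha>. c \<alpha> * mono_pow \<alpha> v"
    have "(?G has_sum f (x + v)) UNIV" using c(2) v by simp
    moreover have "(?G has_sum (f x + L v)) A"
    proof -
      have "f x = c (\<lambda>_. 0)" using analytic_coefficient_at_zero[OF c(2)[of 0]] c(1) by simp
      then have "sum ?G A = f x + L v"
        unfolding A_def L_def using e_ne[symmetric] by (subst sum.insert) (auto simp: sum.reindex[OF e_inj] me)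
      moreover have "finite A" by (simp add: A_def)
      ultimately show ?thesis using has_sum_finite[of A ?G] by simp
    qed
    ultimately have 1: "(?G has_sum (f (x + v) - (f x + L v))) (UNIV - A)"
      by (intro has_sum_Diff) auto
    let ?\<tau> = "norm v / \<rho>"
    have bnd: "norm (?G \<alpha>) \<le> ?\<tau>\<^sup>2 * norm (c \<alpha> * mono_pow \<alpha> (diag_vec \<rho>))" if "\<alpha> \<in> UNIV - A" for \<alpha>
    proof -
      have "\<bar>mono_pow \<alpha> v\<bar> \<le> ?\<tau>\<^sup>2 * mono_pow \<alpha> (diag_vec \<rho>)"
        using v \<rho> big that by (intro abs_mono_pow_le_diag) auto
      then have "\<bar>c \<alpha>\<bar> * \<bar>mono_pow \<alpha> v\<bar> \<le> \<bar>c \<alpha>\<bar> * (?\<tau>\<^sup>2 * \<bar>mono_pow \<alpha> (diag_vec \<rho>)\<bar>)"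
        by (intro mult_left_mono) (auto intro: order_trans[OF _ mult_left_mono[OF abs_ge_self]])
      then show ?thesis by (simp add: abs_mult mult.left_commute)
    qed
    have "(\<lambda>\<alpha>. norm (c \<alpha> * mono_pow \<alpha> (diag_vec \<rho>))) summable_on (UNIV - A)"
      using summable_on_subset_banach[OF has_sum_imp_summable[OF Ssum]] by blast
    then have 2: "((\<lambda>\<alpha>. norm (c \<alpha> * mono_pow \<alpha> (diag_vec \<rho>))) has_sum
        infsum (\<lambda>\<alpha>. norm (c \<alpha> * mono_pow \<alpha> (diag_vec \<rho>))) (UNIV - A)) (UNIV - A)"  (is "(_ has_sum ?S') _")
      by simp
    have "?S' \<le> S" using has_sum_mono'[OF 2 Ssum] by auto
    have "norm (f (x + v) - (f x + L v)) \<le> ?\<tau>\<^sup>2 * ?S'"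
      by (rule norm_infsum_le[OF 1 has_sum_cmult_right[OF 2] bnd])
    also have "\<dots> \<le> ?\<tau>\<^sup>2 * S" using \<open>?S' \<le> S\<close> by (intro mult_left_mono) auto
    finally show ?thesis by (simp add: power_divide field_simps)
  qed
  have "bounded_linear L"
    unfolding L_def by (intro bounded_linear_sum bounded_linear_const_mult bounded_linear_vec_nth)
  moreover have "(\<lambda>v. norm (f (x + v) - f x - L v) / norm v) \<midarrow>0\<rightarrow> 0"
  proof (rule Lim_null_comparison)
    have "\<forall>\<^sub>F v in at 0. norm v < min R \<rho>" 
      using c(1) \<rho>(1) by (auto simp: eventually_at dist_norm intro!: exI[of _ "min R \<rho>"])
    then show "\<forall>\<^sub>F v in at 0. norm (norm (f (x + v) - f x - L v) / norm v) \<le> (S / \<rho>\<^sup>2) * norm v"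
    proof eventually_elim
      case (elim v)
      show ?case using rem[OF elim] by (cases "v = 0") (auto simp: divide_simps power2_eq_square mult_ac)
    qed
    show "(\<lambda>v. (S / \<rho>\<^sup>2) * norm v) \<midarrow>0\<rightarrow> 0"
      by (intro tendsto_eq_intros | simp)+
  qed
  ultimately have "(f has_derivative L) (at x)"
    by (simp add: has_derivative_at)
  then show ?thesis unfolding differentiable_def by blast
qed

lemma analytic_map_on_differentiable:
  fixes f :: "real ^ 'n::finite \<Rightarrow> real ^ 'm::finite"
  assumes "analytic_map_on f S" "x \<in> S"
  shows "f differentiable (at x)"
  using assms real_analytic_at_differentiable
  unfolding analytic_map_on_def real_analytic_on_def
  by (subst differentiable_componentwise_within) (auto simp: Basis_vec_def inner_axis)

section \<open>Change of variables\<close>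

text \<open>A copy of the index type, ordered through the numbering \<open>to_nat\<close>, along
  which statements about well-ordered indices are transported.\<close>

typedef 'n ordered_index = "UNIV :: 'n set" by auto

lemma bij_Abs_ordered_index: "bij (Abs_ordered_index :: 'n \<Rightarrow> 'n ordered_index)"
  by (rule bij_betw_byWitness[of _ Rep_ordered_index])
     (auto simp: Rep_ordered_index_inverse Abs_ordered_index_inverse)

instance ordered_index :: (finite) finite
  by standard (metis bij_Abs_ordered_index bij_betw_finite finite_class.finite_UNIV)

instantiation ordered_index :: (finite) wellorder
begin

definition less_eq_ordered_index :: "'a ordered_index \<Rightarrow> 'a ordered_index \<Rightarrow> bool" where
  "x \<le> y \<longleftrightarrow> to_nat (Rep_ordered_index x) \<le> to_nat (Rep_ordered_index y)"

definition less_ordered_index :: "'a ordered_index \<Rightarrow> 'a ordered_index \<Rightarrow> bool" where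
  "x < y \<longleftrightarrow> to_nat (Rep_ordered_index x) < to_nat (Rep_ordered_index y)"

instance
proof
  fix P :: "'a ordered_index \<Rightarrow> bool" and a :: "'a ordered_index"
  assume step: "\<And>x. (\<And>y. y < x \<Longrightarrow> P y) \<Longrightarrow> P x"
  show "P a"
  proof (induction a rule: measure_induct_rule[of "\<lambda>x. to_nat (Rep_ordered_index x)"])
    case (less x)
    show ?case by (rule step) (rule less, simp only: less_ordered_index_def)
  qed
qed (auto simp: less_eq_ordered_index_def less_ordered_index_def Rep_ordered_index_inject)

end

definition to_ordered :: "real ^ 'n \<Rightarrow> real ^ 'n ordered_index" where
  "to_ordered v = (\<chi> j. v $ Rep_ordered_index j)"

definition of_ordered :: "real ^ 'n ordered_index \<Rightarrow> real ^ 'n" where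
  "of_ordered w = (\<chi> i. w $ Abs_ordered_index i)"

lemma of_to_ordered [simp]: "of_ordered (to_ordered v) = v"
  by (simp add: of_ordered_def to_ordered_def vec_eq_iff Abs_ordered_index_inverse)

lemma to_of_ordered [simp]: "to_ordered (of_ordered w) = w"
  by (simp add: of_ordered_def to_ordered_def vec_eq_iff Rep_ordered_index_inverse)

lemma linear_to_ordered: "linear to_ordered"
  by (auto simp: linear_iff to_ordered_def vec_eq_iff)

lemma linear_of_ordered: "linear of_ordered"
  by (auto simp: linear_iff of_ordered_def vec_eq_iff)

lemmas bounded_linear_to_ordered =
  linear_conv_bounded_linear[THEN iffD1, OF linear_to_ordered]
lemmas bounded_linear_of_ordered =
  linear_conv_bounded_linear[THEN iffD1, OF linear_of_ordered]

lemma prod_Basis_vec: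
  fixes f :: "real ^ 'n::finite \<Rightarrow> 'a::comm_monoid_mult"
  shows "(\<Prod>b\<in>Basis. f b) = (\<Prod>i\<in>UNIV. f (axis i 1))"
proof -
  have "(Basis :: (real ^ 'n) set) = range (\<lambda>i. axis i 1)"
    by (auto simp: Basis_vec_def)
  moreover have "inj (\<lambda>i::'n. axis i (1::real))"
    by (auto simp: inj_def axis_eq_axis)
  ultimately show ?thesis
    using prod.reindex[of "\<lambda>i::'n. axis i (1::real)" UNIV f] by (simp only: o_def)
qed

text \<open>Renaming coordinates carries boxes to boxes with the same side lengths, and Lebesgue
  measure is determined by its values on boxes.\<close>

lemma lborel_ordered_index:
  "lborel = distr lborel borel (to_ordered :: real ^ 'n::finite \<Rightarrow> _)"
proof (rule lborel_eqI)
  have meas [measurable]: "(to_ordered :: real ^ 'n \<Rightarrow> _) \<in> borel_measurable borel"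
    using borel_measurable_continuous_onI linear_continuous_on bounded_linear_to_ordered by blast
  fix l u :: "real ^ 'n ordered_index"
  assume lu: "\<And>b. b \<in> Basis \<Longrightarrow> l \<bullet> b \<le> u \<bullet> b"
  have *: "(to_ordered :: real ^ 'n \<Rightarrow> _) -` box l u = box (of_ordered l) (of_ordered u)"
  proof -
    have "(\<forall>j. l $ j < v $ Rep_ordered_index j \<and> v $ Rep_ordered_index j < u $ j) \<longleftrightarrow>
        (\<forall>i. l $ Abs_ordered_index i < v $ i \<and> v $ i < u $ Abs_ordered_index i)" for v :: "real ^ 'n"
      by (metis Abs_ordered_index_inverse Rep_ordered_index_inverse UNIV_I)
    then show ?thesis
      by (auto simp: mem_box_cart to_ordered_def of_ordered_def)
  qed
  have le: "of_ordered l \<bullet> b \<le> of_ordered u \<bullet> b" if b: "b \<in> Basis" for b :: "real ^ 'n"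
  proof -
    obtain i where "b = axis i 1" using b by (auto simp: Basis_vec_def)
    moreover have "l $ Abs_ordered_index i \<le> u $ Abs_ordered_index i"
      using lu[of "axis (Abs_ordered_index i) 1"] by (simp add: inner_axis)
    ultimately show ?thesis by (simp add: inner_axis of_ordered_def)
  qed
  have "emeasure (distr lborel borel (to_ordered :: real ^ 'n \<Rightarrow> _)) (box l u)
      = emeasure lborel (box (of_ordered l) (of_ordered u))"
    by (simp add: emeasure_distr *)
  also have "\<dots> = (\<Prod>b\<in>Basis. (of_ordered u - of_ordered l) \<bullet> b)"
    by (rule emeasure_lborel_box[OF le])
  also have "\<dots> = (\<Prod>i\<in>UNIV. (u - l) $ Abs_ordered_index i)"
    by (simp add: prod_Basis_vec inner_axis of_ordered_def)
  also have "\<dots> = (\<Prod>j\<in>UNIV. (u - l) $ j)"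
    by (subst prod.reindex_bij_betw[OF bij_Abs_ordered_index]) simp
  also have "\<dots> = (\<Prod>b\<in>Basis. (u - l) \<bullet> b)"
    by (simp add: prod_Basis_vec inner_axis)
  finally show "emeasure (distr lborel borel (to_ordered :: real ^ 'n \<Rightarrow> _)) (box l u)
      = (\<Prod>b\<in>Basis. (u - l) \<bullet> b)" .
qed simp

text \<open>In the Leibniz formula, conjugation by the renaming permutes the permutations, keeps
  their signs and only reindexes the products.\<close>

lemma det_ordered_index:
  fixes M :: "real ^ 'n::finite ^ 'n"
  shows "det (\<chi> i j. M $ Rep_ordered_index i $ Rep_ordered_index j) = det M"
proof -
  let ?A = "Abs_ordered_index :: 'n \<Rightarrow> _" and ?R = "Rep_ordered_index :: _ \<Rightarrow> 'n"
  have inv: "inv ?A = ?R"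
    by (rule inv_equality) (auto simp: Rep_ordered_index_inverse Abs_ordered_index_inverse)
  have mp: "map_permutation UNIV ?A p = ?A \<circ> p \<circ> ?R" for p
    by (simp add: map_permutation_def bij_is_surj[OF bij_Abs_ordered_index] inv restrict_id_def fun_eq_iff)
  have perm: "p permutes UNIV \<longleftrightarrow> bij p" for p :: "'c \<Rightarrow> 'c"
    using bij_imp_permutes permutes_bij by blast
  have bR: "bij ?R" using bij_Abs_ordered_index inv bij_imp_bij_inv by metis
  have "bij_betw (\<lambda>p. ?A \<circ> p \<circ> ?R) {p. p permutes UNIV} {p. p permutes UNIV}"
  proof (rule bij_betw_byWitness[where f' = "\<lambda>p. ?R \<circ> p \<circ> ?A"])
    show "(\<lambda>p. ?A \<circ> p \<circ> ?R) ` {p. p permutes UNIV} \<subseteq> {p. p permutes UNIV}"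
      using bR bij_Abs_ordered_index by (auto simp: perm intro!: bij_comp)
    show "(\<lambda>p. ?R \<circ> p \<circ> ?A) ` {p. p permutes UNIV} \<subseteq> {p. p permutes UNIV}"
      using bR bij_Abs_ordered_index by (auto simp: perm intro!: bij_comp)
  qed (auto simp: fun_eq_iff Rep_ordered_index_inverse Abs_ordered_index_inverse)
  note reindex = sum.reindex_bij_betw[OF this, symmetric]
  have "of_int (sign (?A \<circ> p \<circ> ?R)) * (\<Prod>i\<in>UNIV. M $ ?R i $ ?R ((?A \<circ> p \<circ> ?R) i))
      = of_int (sign p) * (\<Prod>i\<in>UNIV. M $ i $ p i)" if "p permutes UNIV" for p
  proof -
    have "sign (?A \<circ> p \<circ> ?R) = sign p"
      using sign_map_permutation[OF _ that, of ?A] bij_Abs_ordered_index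
      by (simp add: mp bij_is_inj[OF bij_Abs_ordered_index])
    moreover have "(\<Prod>i\<in>UNIV. M $ ?R i $ p (?R i)) = (\<Prod>i\<in>UNIV. M $ i $ p i)"
      by (rule prod.reindex_bij_betw[OF bR])
    ultimately show ?thesis by (simp add: Abs_ordered_index_inverse)
  qed
  then show ?thesis unfolding det_def by (subst reindex) simp
qed

lemma nn_integral_compact_finite:
  fixes w :: "'a::euclidean_space \<Rightarrow> real"
  assumes "compact S" "continuous_on S w" "\<And>x. x \<in> S \<Longrightarrow> 0 \<le> w x"
  shows "w integrable_on S" "(\<integral>\<^sup>+x\<in>S. ennreal (w x) \<partial>lborel) = ennreal (integral S w)"
proof -
  have int: "set_integrable lborel S w"
    using borel_integrable_compact[OF assms(1,2)] by (simp add: set_integrable_def)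
  show "w integrable_on S" by (rule set_borel_integral_eq_integral(1)[OF int])
  have "(\<integral>\<^sup>+x\<in>S. ennreal (w x) \<partial>lborel) = (\<integral>\<^sup>+x. ennreal (indicator S x *\<^sub>R w x) \<partial>lborel)"
    by (intro nn_integral_cong) (auto simp: indicator_def)
  also have "\<dots> = ennreal (LINT x:S|lborel. w x)"
    unfolding set_lebesgue_integral_def using int assms(3)
    by (intro nn_integral_eq_integral) (auto simp: set_integrable_def indicator_def)
  finally show "(\<integral>\<^sup>+x\<in>S. ennreal (w x) \<partial>lborel) = ennreal (integral S w)"
    by (simp add: set_borel_integral_eq_integral(2)[OF int])
qed

lemma emeasure_compact_image_wellorder:
  fixes f :: "real ^ 'n::{finite,wellorder} \<Rightarrow> real ^ 'n::_"
  assumes "compact S"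
    and der: "\<And>x. x \<in> S \<Longrightarrow> (f has_derivative f' x) (at x within S)"
    and w: "continuous_on S w" "\<And>x. x \<in> S \<Longrightarrow> \<bar>det (matrix (f' x))\<bar> = w x"
  shows "emeasure lborel (f ` S) \<le> (\<integral>\<^sup>+x\<in>S. ennreal (w x) \<partial>lborel)"
    and "inj_on f S \<Longrightarrow> emeasure lborel (f ` S) = (\<integral>\<^sup>+x\<in>S. ennreal (w x) \<partial>lborel)"
proof -
  have w0: "0 \<le> w x" if "x \<in> S" for x using w(2)[OF that] abs_ge_zero by metis
  have nn: "w integrable_on S" "(\<integral>\<^sup>+x\<in>S. ennreal (w x) \<partial>lborel) = ennreal (integral S w)"
    using nn_integral_compact_finite[OF assms(1) w(1)] w0 by blast+
  have Sm: "S \<in> sets lebesgue" using assms(1) by (simp add: compact_imp_closed borel_closed)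
  have int: "(\<lambda>x. \<bar>det (matrix (f' x))\<bar>) integrable_on S"
    by (rule integrable_eq[OF nn(1)]) (simp_all add: w)
  have integ: "integral S (\<lambda>x. \<bar>det (matrix (f' x))\<bar>) = integral S w"
    by (rule integral_cong) (simp add: w)
  have "continuous_on S f" using der has_derivative_continuous continuous_on_eq_continuous_within by blast
  then have comp: "compact (f ` S)" using assms(1) compact_continuous_image by blast
  have em: "emeasure lborel (f ` S) = ennreal (measure lebesgue (f ` S))"
    using emeasure_eq_ennreal_measure[of lborel "f ` S"] emeasure_compact_finite[OF comp] comp
    by (simp add: compact_imp_closed borel_closed)
  show "emeasure lborel (f ` S) \<le> (\<integral>\<^sup>+x\<in>S. ennreal (w x) \<partial>lborel)"
    using measure_differentiable_image[OF Sm der int] unfolding em nn(2) integ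
    by (rule ennreal_leI)
  show "emeasure lborel (f ` S) = (\<integral>\<^sup>+x\<in>S. ennreal (w x) \<partial>lborel)" if "inj_on f S"
    using measure_differentiable_image_eq[OF Sm der that int] unfolding em nn(2) integ by simp
qed

lemma borel_measurable_to_ordered [measurable]:
  "(to_ordered :: real ^ 'n::finite \<Rightarrow> _) \<in> borel_measurable borel"
  using borel_measurable_continuous_onI linear_continuous_on bounded_linear_to_ordered by blast

lemma emeasure_to_ordered_image:
  fixes A :: "(real ^ 'n::finite) set"
  assumes "compact A"
  shows "emeasure lborel (to_ordered ` A) = emeasure lborel A"
proof -
  have "compact (to_ordered ` A)"
    using assms compact_continuous_image linear_continuous_on bounded_linear_to_ordered by blast
  then have "to_ordered ` A \<in> sets borel" by (simp add: compact_imp_closed borel_closed)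
  then have "emeasure lborel (to_ordered ` A) = emeasure lborel (to_ordered -` to_ordered ` A)"
    by (subst lborel_ordered_index) (simp add: emeasure_distr)
  also have "to_ordered -` to_ordered ` A = A"
    by (auto simp: image_iff) (metis of_to_ordered)
  finally show ?thesis .
qed

text \<open>The change of variables theorems of the library need a well-ordered index type; any finite
  index type carries such an order, so they hold without one.\<close>

theorem emeasure_compact_image:
  fixes f :: "real ^ 'n::finite \<Rightarrow> real ^ 'n"
  assumes S: "compact S"
    and der: "\<And>x. x \<in> S \<Longrightarrow> (f has_derivative f' x) (at x within S)"
    and w: "continuous_on S w" "\<And>x. x \<in> S \<Longrightarrow> \<bar>det (matrix (f' x))\<bar> = w x"
  shows "emeasure lborel (f ` S) \<le> (\<integral>\<^sup>+x\<in>S. ennreal (w x) \<partial>lborel)"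
    and "inj_on f S \<Longrightarrow> emeasure lborel (f ` S) = (\<integral>\<^sup>+x\<in>S. ennreal (w x) \<partial>lborel)"
proof -
  let ?T = "to_ordered :: real ^ 'n \<Rightarrow> _" and ?T' = "of_ordered :: _ \<Rightarrow> real ^ 'n"
  let ?f = "?T \<circ> f \<circ> ?T'" and ?f' = "\<lambda>y. ?T \<circ> f' (?T' y) \<circ> ?T'" and ?w = "w \<circ> ?T'"
  have cT: "continuous_on A ?T" "continuous_on B ?T'" for A B
    using linear_continuous_on bounded_linear_to_ordered bounded_linear_of_ordered by blast+
  have cS: "compact (?T ` S)" by (rule compact_continuous_image[OF cT(1) S])
  have T'S: "?T' ` ?T ` S = S" by (auto simp: image_iff)
  have 1: "(?f has_derivative ?f' y) (at y within ?T ` S)" if "y \<in> ?T ` S" for y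
  proof -
    have d1: "(?T' has_derivative ?T') (at y within ?T ` S)"
      by (rule bounded_linear_imp_has_derivative[OF bounded_linear_of_ordered])
    have d2: "(f has_derivative f' (?T' y)) (at (?T' y) within ?T' ` ?T ` S)"
      unfolding T'S using that by (intro der) auto
    have d3: "(?T has_derivative ?T) (at (f (?T' y)) within f ` S)"
      by (rule bounded_linear_imp_has_derivative[OF bounded_linear_to_ordered])
    have d4: "((f \<circ> ?T') has_derivative (f' (?T' y) \<circ> ?T')) (at y within ?T ` S)"
      by (rule diff_chain_within[OF d1 d2])
    have "((?T \<circ> (f \<circ> ?T')) has_derivative (?T \<circ> (f' (?T' y) \<circ> ?T'))) (at y within ?T ` S)"
      by (rule diff_chain_within[OF d4])
         (rule bounded_linear_imp_has_derivative[OF bounded_linear_to_ordered])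
    then show ?thesis by (simp add: o_assoc)
  qed
  have 2: "continuous_on (?T ` S) ?w"
    using w(1) cT(2) by (intro continuous_on_compose) (simp_all add: T'S)
  have 3: "\<bar>det (matrix (?f' y))\<bar> = ?w y" if "y \<in> ?T ` S" for y
  proof -
    have ax: "?T' (axis j 1) = axis (Rep_ordered_index j) 1" for j
      by (auto simp: of_ordered_def axis_def vec_eq_iff Rep_ordered_index_inverse Abs_ordered_index_inverse)
    have "matrix (?f' y) = (\<chi> i j. matrix (f' (?T' y)) $ Rep_ordered_index i $ Rep_ordered_index j)"
      by (simp add: matrix_def to_ordered_def ax)
    moreover have "?T' y \<in> S" using that by auto
    ultimately show ?thesis using w(2) by (simp add: det_ordered_index)
  qed
  have im: "?f ` ?T ` S = ?T ` f ` S" by (auto simp: image_iff)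
  have "continuous_on S f" using der has_derivative_continuous continuous_on_eq_continuous_within by blast
  then have comp: "compact (f ` S)" using S compact_continuous_image by blast
  have "(\<lambda>y. ennreal (?w y) * indicator (?T ` S) y) \<in> borel_measurable borel"
  proof -
    have "(\<lambda>y. indicator (?T ` S) y *\<^sub>R ?w y) \<in> borel_measurable borel"
      using 2 cS by (intro borel_measurable_continuous_on_indicator) (auto simp: compact_imp_closed borel_closed)
    then have "(\<lambda>y. ennreal (indicator (?T ` S) y *\<^sub>R ?w y)) \<in> borel_measurable borel"
      by measurable
    then show ?thesis by (rule measurable_cong[THEN iffD1, rotated]) (auto simp: indicator_def)
  qed
  then have "(\<integral>\<^sup>+y\<in>?T ` S. ennreal (?w y) \<partial>lborel)
      = (\<integral>\<^sup>+x. ennreal (?w (?T x)) * indicator (?T ` S) (?T x) \<partial>lborel)"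
    by (subst lborel_ordered_index) (simp add: nn_integral_distr)
  also have "\<dots> = (\<integral>\<^sup>+x\<in>S. ennreal (w x) \<partial>lborel)"
    by (intro nn_integral_cong) (auto simp: indicator_def image_iff, metis of_to_ordered)
  finally have nn: "(\<integral>\<^sup>+y\<in>?T ` S. ennreal (?w y) \<partial>lborel) = (\<integral>\<^sup>+x\<in>S. ennreal (w x) \<partial>lborel)" .
  show "emeasure lborel (f ` S) \<le> (\<integral>\<^sup>+x\<in>S. ennreal (w x) \<partial>lborel)"
    using emeasure_compact_image_wellorder(1)[OF cS 1 2 3]
    unfolding im nn emeasure_to_ordered_image[OF comp] by blast
  show "emeasure lborel (f ` S) = (\<integral>\<^sup>+x\<in>S. ennreal (w x) \<partial>lborel)" if inj: "inj_on f S"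
  proof -
    have "inj_on ?f (?T ` S)"
    proof (rule inj_onI)
      fix a b assume ab: "a \<in> ?T ` S" "b \<in> ?T ` S" "?f a = ?f b"
      then have "f (?T' a) = f (?T' b)" by (metis comp_apply of_to_ordered)
      then have "?T' a = ?T' b" using ab inj by (auto dest: inj_onD)
      then show "a = b" by (metis to_of_ordered)
    qed
    then show ?thesis
      using emeasure_compact_image_wellorder(2)[OF cS 1 2 3]
      unfolding im nn emeasure_to_ordered_image[OF comp] by blast
  qed
qed

subsection \<open>Sublevel sets of monomials\<close>

lemma nn_integral_powr_interval_finite:
  fixes a e :: real
  assumes "a \<ge> 0" "e > -1"
  shows "(\<integral>\<^sup>+x. ennreal (indicator {-a..a} x * \<bar>x\<bar> powr e) \<partial>lborel) < \<infinity>"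
proof -
  let ?h = "\<lambda>x. ennreal (indicator {0..a} x * \<bar>x\<bar> powr e)"
  have meas: "?h \<in> borel_measurable borel" by measurable
  have "(\<lambda>x. x powr e) integrable_on {0..a}"
    using assms by (intro integrable_on_powr_from_0) auto
  then have "(\<lambda>x. \<bar>x\<bar> powr e) integrable_on {0..a}"
    by (rule integrable_eq) simp
  then have hi: "((\<lambda>x. \<bar>x\<bar> powr e) has_integral (integral {0..a} (\<lambda>x. \<bar>x\<bar> powr e))) {0..a}"
    by (rule integrable_integral)
  have half: "(\<integral>\<^sup>+x. ?h x \<partial>lborel) < \<infinity>"
    by (subst nn_integral_has_integral_lebesgue[OF _ hi]) auto
  have "(\<integral>\<^sup>+x. ?h (0 + (-1) * x) \<partial>lborel) = (\<integral>\<^sup>+x. ?h x \<partial>lborel)"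
    using nn_integral_real_affine[OF meas, of "-1" 0] by simp
  then have half': "(\<integral>\<^sup>+x. ?h (- x) \<partial>lborel) < \<infinity>" using half by simp
  have "(\<integral>\<^sup>+x. ennreal (indicator {-a..a} x * \<bar>x\<bar> powr e) \<partial>lborel) \<le> (\<integral>\<^sup>+x. ?h x + ?h (- x) \<partial>lborel)"
    by (intro nn_integral_mono) (auto simp: indicator_def)
  also have "\<dots> = (\<integral>\<^sup>+x. ?h x \<partial>lborel) + (\<integral>\<^sup>+x. ?h (- x) \<partial>lborel)"
    by (rule nn_integral_add) measurable
  also have "\<dots> < \<infinity>" using half half' by simp
  finally show ?thesis .
qed

lemma AE_component_neq:
  "AE u in lborel. \<forall>i. (u :: real ^ 'n::finite) $ i \<noteq> 0"
proof -
  have "AE u in lborel. (u :: real ^ 'n) $ i \<noteq> 0" for i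
    using AE_lborel_inner_neq[of "axis i 1 :: real ^ 'n" 0] by (simp add: inner_axis)
  then show ?thesis by (subst AE_all_countable) blast
qed

text \<open>On the sublevel set the integrand is at most \<open>u\<^sup>h (t / u\<^sup>k)\<^sup>s\<close>, which is integrable over the
  box as soon as all exponents \<open>h\<^sub>i - s k\<^sub>i\<close> exceed \<open>-1\<close>.\<close>

lemma monomial_sublevel_integral:
  fixes k h :: "'n::finite \<Rightarrow> nat" and a s :: real
  assumes "a \<ge> 0" "s \<ge> 0" and exp: "\<And>i. real (h i) - s * real (k i) > -1"
  shows "\<exists>C::real. C \<ge> 0 \<and> (\<forall>t>0. (\<integral>\<^sup>+u\<in>{u. (\<forall>i. \<bar>u $ i\<bar> \<le> a) \<and> \<bar>mono_pow k u\<bar> \<le> t}.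
            ennreal \<bar>mono_pow h u\<bar> \<partial>lborel) \<le> ennreal (C * t powr s))"
proof -
  define g where "g i x = indicator {-a..a} x * \<bar>x\<bar> powr (real (h i) - s * real (k i))" for i and x :: real
  define J where "J i = (\<integral>\<^sup>+x. ennreal (g i x) \<partial>lborel)" for i
  have J: "J i < \<infinity>" for i
    unfolding J_def g_def by (rule nn_integral_powr_interval_finite[OF assms(1) exp])
  then have prodJ: "(\<Prod>i\<in>UNIV. J i) < \<infinity>" by (simp add: ennreal_prod_eq_top less_top[symmetric])
  then obtain C where C: "C \<ge> 0" "(\<Prod>i\<in>UNIV. J i) = ennreal C"
    by (metis ennreal_cases infinity_ennreal_def less_irrefl)
  \<comment> \<open>The product formula for \<open>lborel\<close> wants one-variable factors indexed
    by basis vectors; \<open>THE\<close> recovers the coordinate from its basis vector.\<close>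
  define G where "G b x = ennreal (g (THE i. b = axis i 1) x)" for b :: "real ^ 'n" and x
  have G_axis: "G (axis i 1) = (\<lambda>x. ennreal (g i x))" for i
    by (simp add: G_def axis_eq_axis fun_eq_iff)
  have "(\<integral>\<^sup>+u. (\<Prod>b\<in>Basis. G b (u \<bullet> b)) \<partial>lborel) = (\<Prod>b\<in>Basis. (\<integral>\<^sup>+x. G b x \<partial>lborel))"
    by (rule nn_integral_lborel_prod) (auto simp: G_def g_def)
  then have box: "(\<integral>\<^sup>+u. (\<Prod>i\<in>UNIV. ennreal (g i ((u :: real ^ 'n) $ i))) \<partial>lborel) = ennreal C"
    by (simp add: prod_Basis_vec G_axis inner_axis C(2)[symmetric] J_def)
  have g0: "g i x \<ge> 0" for i x by (simp add: g_def)
  have main: "(\<integral>\<^sup>+u\<in>{u. (\<forall>i. \<bar>u $ i\<bar> \<le> a) \<and> \<bar>mono_pow k u\<bar> \<le> t}. ennreal \<bar>mono_pow h u\<bar> \<partial>lborel)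
      \<le> ennreal (C * t powr s)" if t: "t > 0" for t
  proof -
    \<comment> \<open>The bound may fail on the coordinate hyperplanes, where
      \<open>0 powr e = 0\<close> makes the majorant vanish; they form a null set.\<close>
    have pw: "ennreal \<bar>mono_pow h u\<bar> * indicator {u. (\<forall>i. \<bar>u $ i\<bar> \<le> a) \<and> \<bar>mono_pow k u\<bar> \<le> t} u
        \<le> ennreal (t powr s) * (\<Prod>i\<in>UNIV. ennreal (g i (u $ i)))"
      if u: "\<forall>i. u $ i \<noteq> 0" for u :: "real ^ 'n"
    proof (cases "(\<forall>i. \<bar>u $ i\<bar> \<le> a) \<and> \<bar>mono_pow k u\<bar> \<le> t")
      case True
      have kpos: "\<bar>mono_pow k u\<bar> > 0" using u by (simp add: mono_pow_def)
      have "(\<Prod>i\<in>UNIV. g i (u $ i)) = (\<Prod>i\<in>UNIV. \<bar>u $ i\<bar> ^ h i / (\<bar>u $ i\<bar> ^ k i) powr s)"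
      proof (rule prod.cong[OF refl])
        fix i
        have p: "\<bar>u $ i\<bar> > 0" using u by simp
        have "\<bar>u $ i\<bar> powr (real (h i) - s * real (k i)) = \<bar>u $ i\<bar> ^ h i / (\<bar>u $ i\<bar> ^ k i) powr s"
          using p by (simp add: powr_diff powr_realpow[symmetric] powr_powr mult.commute)
        then show "g i (u $ i) = \<bar>u $ i\<bar> ^ h i / (\<bar>u $ i\<bar> ^ k i) powr s"
          using True by (auto simp: g_def indicator_def abs_le_iff minus_le_iff)
      qed
      also have "\<dots> = \<bar>mono_pow h u\<bar> / \<bar>mono_pow k u\<bar> powr s"
        by (simp add: mono_pow_def abs_prod power_abs prod_dividef prod_powr_distrib)
      finally have eq: "(\<Prod>i\<in>UNIV. g i (u $ i)) = \<bar>mono_pow h u\<bar> / \<bar>mono_pow k u\<bar> powr s" .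
      have "\<bar>mono_pow k u\<bar> powr s \<le> t powr s"
        using True assms(2) by (intro powr_mono2) auto
      then have "\<bar>mono_pow h u\<bar> \<le> t powr s * (\<bar>mono_pow h u\<bar> / \<bar>mono_pow k u\<bar> powr s)"
        using kpos mult_right_mono[of "\<bar>mono_pow k u\<bar> powr s" "t powr s" "\<bar>mono_pow h u\<bar>"]
        by (simp add: field_simps)
      then have "ennreal \<bar>mono_pow h u\<bar> \<le> ennreal (t powr s * (\<Prod>i\<in>UNIV. g i (u $ i)))"
        unfolding eq by (rule ennreal_leI)
      also have "\<dots> = ennreal (t powr s) * (\<Prod>i\<in>UNIV. ennreal (g i (u $ i)))"
        by (simp add: ennreal_mult' prod_ennreal g0)
      finally show ?thesis using True by simp
    qed auto
    have "(\<integral>\<^sup>+u\<in>{u. (\<forall>i. \<bar>u $ i\<bar> \<le> a) \<and> \<bar>mono_pow k u\<bar> \<le> t}. ennreal \<bar>mono_pow h u\<bar> \<partial>lborel)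
        \<le> (\<integral>\<^sup>+u. ennreal (t powr s) * (\<Prod>i\<in>UNIV. ennreal (g i ((u :: real ^ 'n) $ i))) \<partial>lborel)"
      by (intro nn_integral_mono_AE eventually_mono[OF AE_component_neq]) (rule pw)
    also have "\<dots> = ennreal (t powr s) * (\<integral>\<^sup>+u. (\<Prod>i\<in>UNIV. ennreal (g i ((u :: real ^ 'n) $ i))) \<partial>lborel)"
      unfolding g_def by (rule nn_integral_cmult) measurable
    also have "\<dots> = ennreal (C * t powr s)"
      unfolding box using C(1) by (simp add: ennreal_mult' mult.commute)
    finally show ?thesis .
  qed
  show ?thesis using C(1) main by blast
qed

section \<open>The threshold of a resolution as a volume exponent\<close>

lemma is_chartD:
  fixes X :: "'u topology" and \<phi> :: "'u \<Rightarrow> real ^ 'n::finite"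
  assumes "is_chart X (V, \<phi>)"
  shows "openin X V" "V \<subseteq> topspace X" "open (\<phi> ` V)" "inj_on \<phi> V"
    and "\<And>U. openin X U \<Longrightarrow> open (\<phi> ` (V \<inter> U))"
    and "\<And>B. open B \<Longrightarrow> openin X {v \<in> V. \<phi> v \<in> B}"
proof -
  show V: "openin X V" and O: "open (\<phi> ` V)" using assms by (auto simp: is_chart_def)
  show VX: "V \<subseteq> topspace X" using V openin_subset by blast
  have hom: "homeomorphic_map (subtopology X V) (top_of_set (\<phi> ` V)) \<phi>"
    using assms by (auto simp: is_chart_def)
  have top: "topspace (subtopology X V) = V" using VX by (simp add: topspace_subtopology inf.absorb2)
  show "inj_on \<phi> V" using homeomorphic_imp_injective_map[OF hom] unfolding top .
  show "open (\<phi> ` (V \<inter> U))" if "openin X U" for U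
  proof -
    have "openin (subtopology X V) (V \<inter> U)" using that by (auto simp: openin_subtopology)
    then have "openin (top_of_set (\<phi> ` V)) (\<phi> ` (V \<inter> U))"
      using homeomorphic_imp_open_map[OF hom] by (simp add: open_map_def)
    then show ?thesis using O openin_open_eq by blast
  qed
  show "openin X {v \<in> V. \<phi> v \<in> B}" if "open B" for B
  proof -
    have "openin (subtopology X V) {v \<in> topspace (subtopology X V). \<phi> v \<in> \<phi> ` V \<inter> B}"
      using homeomorphic_imp_continuous_map[OF hom] \<open>open B\<close>
      by (intro openin_continuous_map_preimage) (auto simp: openin_open)
    moreover have "{v \<in> topspace (subtopology X V). \<phi> v \<in> \<phi> ` V \<inter> B} = {v \<in> V. \<phi> v \<in> B}"
      unfolding top by auto
    ultimately show ?thesis using V openin_trans_full by fastforce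
  qed
qed

text \<open>\<open>g\<close> is known to be analytic only in charts of the atlas, whereas normal
  crossings live in compatible local coordinates. So \<open>g\<close> is factored near
  \<open>u\<close> through an atlas chart and the transition map.\<close>

lemma resolution_in_coordinates_differentiable:
  fixes g :: "'u \<Rightarrow> real ^ 'n::finite"
  assumes res: "resolution K W X A g k h" and loc: "local_coordinates X A Q (V, \<phi>)"
    and u: "u \<in> \<phi> ` V"
  shows "(g \<circ> inv_into V \<phi>) differentiable (at u)"
proof -
  have chart: "is_chart X (V, \<phi>)" using loc by (simp add: local_coordinates_def)
  have "inv_into V \<phi> u \<in> V" using u by (rule inv_into_into)
  then have "inv_into V \<phi> u \<in> (\<Union>C\<in>A. fst C)"
    using is_chartD(2)[OF chart] res by (auto simp: resolution_def analytic_manifold_def)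
  then obtain V' \<phi>' where A: "(V', \<phi>') \<in> A" "inv_into V \<phi> u \<in> V'" by auto
  have chart': "is_chart X (V', \<phi>')"
    using A res by (auto simp: resolution_def analytic_manifold_def)
  let ?N = "\<phi> ` (V \<inter> V')"
  have uN: "u \<in> ?N" using A(2) f_inv_into_f[OF u] inv_into_into[OF u] by (metis IntI image_eqI)
  have N: "open ?N" using is_chartD(5)[OF chart is_chartD(1)[OF chart']] .
  have inN: "inv_into V \<phi> y \<in> V \<inter> V'" if "y \<in> ?N" for y
    using that is_chartD(4)[OF chart] by auto
  have "analytic_transition (V, \<phi>) (V', \<phi>')"
    using loc A(1) by (auto simp: local_coordinates_def)
  then have d1: "(\<phi>' \<circ> inv_into V \<phi>) differentiable (at u)"
    using uN by (auto simp: analytic_transition_def intro: analytic_map_on_differentiable)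
  have "analytic_map_on (g \<circ> inv_into V' \<phi>') (\<phi>' ` V')"
    using res A(1) by (auto simp: resolution_def)
  then have d2: "(g \<circ> inv_into V' \<phi>') differentiable (at ((\<phi>' \<circ> inv_into V \<phi>) u))"
    using A(2) by (intro analytic_map_on_differentiable) auto
  have "((g \<circ> inv_into V' \<phi>') \<circ> (\<phi>' \<circ> inv_into V \<phi>)) differentiable (at u)"
    by (rule differentiable_chain_at[OF d1 d2])
  then obtain D where D: "(((g \<circ> inv_into V' \<phi>') \<circ> (\<phi>' \<circ> inv_into V \<phi>)) has_derivative D) (at u)"
    unfolding differentiable_def by blast
  have "((g \<circ> inv_into V \<phi>) has_derivative D) (at u)"
    by (rule has_derivative_transform_within_open[OF D N uN])
       (use inN is_chartD(4)[OF chart'] in \<open>auto simp: inv_into_f_f\<close>)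
  then show ?thesis unfolding differentiable_def by blast
qed

lemma abs_le_box_norm:
  assumes "r > 0"
  shows "\<exists>\<epsilon>>0. \<epsilon> \<le> 1 \<and> (\<forall>u::real ^ 'n::finite. (\<forall>i. \<bar>u $ i\<bar> \<le> \<epsilon>) \<longrightarrow> norm u < r)"
proof -
  define N where "N = real CARD('n)"
  have "N > 0" unfolding N_def by simp
  define \<epsilon> where "\<epsilon> = min 1 (r / (2 * N))"
  have "norm u < r" if "\<forall>i. \<bar>u $ i\<bar> \<le> \<epsilon>" for u :: "real ^ 'n"
  proof -
    have "norm u \<le> (\<Sum>i\<in>UNIV. \<bar>u $ i\<bar>)" by (rule norm_le_l1_cart)
    also have "\<dots> \<le> (\<Sum>i\<in>(UNIV::'n set). \<epsilon>)" using that by (intro sum_mono) auto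
    also have "\<dots> = N * \<epsilon>" by (simp add: N_def)
    also have "\<dots> \<le> N * (r / (2 * N))" using \<open>N > 0\<close> by (intro mult_left_mono) (auto simp: \<epsilon>_def)
    also have "\<dots> < r" using \<open>N > 0\<close> \<open>r > 0\<close> by simp
    finally show ?thesis .
  qed
  moreover have "\<epsilon> > 0" "\<epsilon> \<le> 1" using \<open>N > 0\<close> \<open>r > 0\<close> by (auto simp: \<epsilon>_def)
  ultimately show ?thesis by blast
qed

lemma continuous_on_mono_pow: "continuous_on S (mono_pow \<alpha>)"
  unfolding mono_pow_def[abs_def] by (intro continuous_intros)

lemma real_analytic_on_continuous_on:
  fixes f :: "real ^ 'n::finite \<Rightarrow> real"
  assumes "real_analytic_on f S"
  shows "continuous_on S f"
  using assms unfolding real_analytic_on_def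
  by (intro continuous_at_imp_continuous_on ballI differentiable_imp_continuous_within)
     (auto intro: real_analytic_at_differentiable)

lemma continuous_nonzero_bounds:
  fixes a :: "real ^ 'n::finite \<Rightarrow> real"
  assumes "open O'" "0 \<in> O'" "continuous_on O' a" "a 0 \<noteq> 0"
  shows "\<exists>r>0. \<forall>u. norm u < r \<longrightarrow> u \<in> O' \<and> \<bar>a 0\<bar> / 2 \<le> \<bar>a u\<bar> \<and> \<bar>a u\<bar> \<le> 2 * \<bar>a 0\<bar>"
proof -
  have "isCont a 0" using assms continuous_on_eq_continuous_at by blast
  then obtain d where d: "d > 0" "\<And>u. dist u 0 < d \<Longrightarrow> dist (a u) (a 0) < \<bar>a 0\<bar> / 2"
    using assms(4) unfolding continuous_at_eps_delta by (metis half_gt_zero zero_less_abs_iff)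
  obtain e where e: "e > 0" "ball 0 e \<subseteq> O'" using assms(1,2) open_contains_ball by blast
  show ?thesis
  proof (intro exI[of _ "min d e"] conjI allI impI)
    fix u :: "real ^ 'n" assume u: "norm u < min d e"
    show "u \<in> O'" using u e by (auto simp: dist_norm)
    have "dist (a u) (a 0) < \<bar>a 0\<bar> / 2" using d(2) u by simp
    then show "\<bar>a 0\<bar> / 2 \<le> \<bar>a u\<bar>" "\<bar>a u\<bar> \<le> 2 * \<bar>a 0\<bar>"
      by (auto simp: dist_real_def abs_if split: if_splits)
  qed (use d e in auto)
qed

text \<open>All that is used of a resolution at a point \<open>Q\<close> of the zero fibre: \<open>f\<close> is \<open>g\<close> in the
  coordinates of the normal crossing.\<close>

lemma normal_crossing_box:
  fixes g :: "'u \<Rightarrow> real ^ 'n::finite"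
  assumes res: "resolution K W X A g k h" and Q: "Q \<in> zero_fibre K X g"
  obtains f V \<phi> a b \<epsilon> \<alpha> \<beta> where
    "\<epsilon> > 0" "\<epsilon> \<le> 1" "\<alpha> > 0" "\<beta> > 0" "f 0 = g Q"
    "openin X V" "Q \<in> V" "\<And>v. v \<in> V \<Longrightarrow> (\<forall>i. \<bar>\<phi> v $ i\<bar> \<le> \<epsilon>) \<and> f (\<phi> v) = g v"
    "continuous_on {u. \<forall>i. \<bar>u $ i\<bar> \<le> \<epsilon>} a" "continuous_on {u. \<forall>i. \<bar>u $ i\<bar> \<le> \<epsilon>} b"
    "\<And>u. (\<forall>i. \<bar>u $ i\<bar> \<le> \<epsilon>) \<Longrightarrow> \<alpha> / 2 \<le> \<bar>a u\<bar> \<and> \<bar>a u\<bar> \<le> 2 * \<alpha> \<and> \<beta> / 2 \<le> \<bar>b u\<bar> \<and> \<bar>b u\<bar> \<le> 2 * \<beta>"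
    "\<And>u. (\<forall>i. \<bar>u $ i\<bar> \<le> \<epsilon>) \<Longrightarrow> f u \<in> W \<and> K (f u) = a u * mono_pow (k Q) u"
    "\<And>u. (\<forall>i. \<bar>u $ i\<bar> \<le> \<epsilon>) \<Longrightarrow> (f has_derivative frechet_derivative f (at u)) (at u)"
    "\<And>u. (\<forall>i. \<bar>u $ i\<bar> \<le> \<epsilon>) \<Longrightarrow> \<bar>det (matrix (frechet_derivative f (at u)))\<bar> = \<bar>b u * mono_pow (h Q) u\<bar>"
    "\<And>u u'. (\<forall>i. \<bar>u $ i\<bar> \<le> \<epsilon>) \<Longrightarrow> (\<forall>i. \<bar>u' $ i\<bar> \<le> \<epsilon>) \<Longrightarrow> K (f u) \<noteq> 0 \<Longrightarrow> f u = f u' \<Longrightarrow> u = u'"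
proof -
  have "normal_crossing K X A g Q (k Q) (h Q)"
    using res Q by (simp add: resolution_def Let_def)
  then obtain V \<phi> a b where loc: "local_coordinates X A Q (V, \<phi>)"
    and an: "real_analytic_on a (\<phi> ` V)" "real_analytic_on b (\<phi> ` V)" and ab: "a 0 \<noteq> 0" "b 0 \<noteq> 0"
    and nc: "\<And>u. u \<in> \<phi> ` V \<Longrightarrow> K (g (inv_into V \<phi> u)) = a u * mono_pow (k Q) u"
      "\<And>u. u \<in> \<phi> ` V \<Longrightarrow> \<bar>det (jacobian (g \<circ> inv_into V \<phi>) (at u))\<bar> = \<bar>b u * mono_pow (h Q) u\<bar>"
    unfolding normal_crossing_def mono_pow_def by blast
  have chart: "is_chart X (V, \<phi>)" and QV: "Q \<in> V" "\<phi> Q = 0"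
    using loc by (simp_all add: local_coordinates_def)
  note ch = is_chartD[OF chart]
  have 0: "0 \<in> \<phi> ` V" using QV by force
  note con = real_analytic_on_continuous_on[OF an(1)] real_analytic_on_continuous_on[OF an(2)]
  obtain r1 where r1: "r1 > 0" "\<And>u. norm u < r1 \<Longrightarrow> u \<in> \<phi> ` V \<and> \<bar>a 0\<bar> / 2 \<le> \<bar>a u\<bar> \<and> \<bar>a u\<bar> \<le> 2 * \<bar>a 0\<bar>"
    using continuous_nonzero_bounds[OF ch(3) 0 con(1) ab(1)] by blast
  obtain r2 where r2: "r2 > 0" "\<And>u. norm u < r2 \<Longrightarrow> u \<in> \<phi> ` V \<and> \<bar>b 0\<bar> / 2 \<le> \<bar>b u\<bar> \<and> \<bar>b u\<bar> \<le> 2 * \<bar>b 0\<bar>"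
    using continuous_nonzero_bounds[OF ch(3) 0 con(2) ab(2)] by blast
  obtain \<epsilon> where eps: "\<epsilon> > 0" "\<epsilon> \<le> 1" "\<And>u::real^'n. (\<forall>i. \<bar>u $ i\<bar> \<le> \<epsilon>) \<Longrightarrow> norm u < min r1 r2"
    using abs_le_box_norm[of "min r1 r2"] r1(1) r2(1) by (metis min_less_iff_conj)
  have box: "u \<in> \<phi> ` V" "\<bar>a 0\<bar> / 2 \<le> \<bar>a u\<bar> \<and> \<bar>a u\<bar> \<le> 2 * \<bar>a 0\<bar> \<and> \<bar>b 0\<bar> / 2 \<le> \<bar>b u\<bar> \<and> \<bar>b u\<bar> \<le> 2 * \<bar>b 0\<bar>"
    if "\<forall>i. \<bar>u $ i\<bar> \<le> \<epsilon>" for u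
    using r1(2)[of u] r2(2)[of u] eps(3)[OF that] by auto
  let ?f = "g \<circ> inv_into V \<phi>"
  have gW: "g v \<in> W" if "v \<in> topspace X" for v
    using res that by (auto simp: resolution_def continuous_map_def Pi_iff)
  have bij: "bij_betw g (topspace X - zero_fibre K X g) {\<theta> \<in> W. K \<theta> \<noteq> 0}"
    using res by (simp add: resolution_def Let_def)
  \<comment> \<open>The neighbourhood of \<open>Q\<close> comes from the open box and is thus open
    in the manifold, while the bounds hold on the closed box, whose compactness
    \<open>resolution_local_volume\<close> uses.\<close>
  let ?B = "{x::real^'n. \<forall>i. \<bar>x $ i\<bar> < \<epsilon>}"
  have "?B = box (\<chi> i. - \<epsilon>) (\<chi> i. \<epsilon>)" by (auto simp: mem_box_cart abs_less_iff minus_less_iff)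
  then have "open ?B" by (simp add: open_box)
  have inV: "inv_into V \<phi> u \<in> V" if "u \<in> \<phi> ` V" for u using that by (rule inv_into_into)
  show thesis
  proof (rule that[of \<epsilon> "\<bar>a 0\<bar>" "\<bar>b 0\<bar>" ?f "{v \<in> V. \<phi> v \<in> ?B}" \<phi> a b])
    show "?f 0 = g Q" using QV ch(4) by (metis comp_apply inv_into_f_f)
    show "openin X {v \<in> V. \<phi> v \<in> ?B}" by (rule ch(6)[OF \<open>open ?B\<close>])
    show "Q \<in> {v \<in> V. \<phi> v \<in> ?B}" using QV eps(1) by simp
    show "(\<forall>i. \<bar>\<phi> v $ i\<bar> \<le> \<epsilon>) \<and> ?f (\<phi> v) = g v" if "v \<in> {v \<in> V. \<phi> v \<in> ?B}" for v
      using that ch(4) by (auto simp: less_imp_le)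
    show "continuous_on {u. \<forall>i. \<bar>u $ i\<bar> \<le> \<epsilon>} a" "continuous_on {u. \<forall>i. \<bar>u $ i\<bar> \<le> \<epsilon>} b"
      using con box(1) by (auto intro: continuous_on_subset)
    fix u :: "real ^ 'n" assume u: "\<forall>i. \<bar>u $ i\<bar> \<le> \<epsilon>"
    show "\<bar>a 0\<bar> / 2 \<le> \<bar>a u\<bar> \<and> \<bar>a u\<bar> \<le> 2 * \<bar>a 0\<bar> \<and> \<bar>b 0\<bar> / 2 \<le> \<bar>b u\<bar> \<and> \<bar>b u\<bar> \<le> 2 * \<bar>b 0\<bar>"
      by (rule box(2)[OF u])
    show "?f u \<in> W \<and> K (?f u) = a u * mono_pow (k Q) u"
      using nc(1)[OF box(1)[OF u]] gW inV[OF box(1)[OF u]] ch(2) by auto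
    show "(?f has_derivative frechet_derivative ?f (at u)) (at u)"
      using resolution_in_coordinates_differentiable[OF res loc box(1)[OF u]]
      by (simp add: frechet_derivative_works)
    show "\<bar>det (matrix (frechet_derivative ?f (at u)))\<bar> = \<bar>b u * mono_pow (h Q) u\<bar>"
      using nc(2)[OF box(1)[OF u]] by (simp add: jacobian_def)
    fix u' :: "real ^ 'n" assume u': "\<forall>i. \<bar>u' $ i\<bar> \<le> \<epsilon>" and K: "K (?f u) \<noteq> 0" and eq: "?f u = ?f u'"
    have "inv_into V \<phi> u \<in> topspace X - zero_fibre K X g" "inv_into V \<phi> u' \<in> topspace X - zero_fibre K X g"
      using inV[OF box(1)[OF u]] inV[OF box(1)[OF u']] ch(2) K eq by (auto simp: zero_fibre_def)
    then have "inv_into V \<phi> u = inv_into V \<phi> u'"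
      using bij eq by (auto simp: bij_betw_def dest: inj_onD)
    then show "u = u'" using box(1)[OF u] box(1)[OF u'] by (metis f_inv_into_f)
  qed (use eps ab in auto)
qed

lemma powr_eventually_small:
  fixes C p c \<epsilon> :: real
  assumes "p > 0" "c > 0" "\<epsilon> > 0"
  shows "\<exists>\<delta>. 0 < \<delta> \<and> \<delta> < \<epsilon> \<and> C * \<delta> powr p < c"
proof -
  have "((\<lambda>\<delta>. C * \<delta> powr p) \<longlongrightarrow> C * 0) (at_right 0)"
  proof (rule tendsto_mult[OF tendsto_const tendsto_zero_powrI])
    show "\<forall>\<^sub>F x in at_right 0. 0 \<le> (x :: real)"
      using eventually_at_right_less by (rule eventually_mono) simp
  qed (use assms(1) in \<open>auto intro: tendsto_ident_at\<close>)
  then have "\<forall>\<^sub>F \<delta> in at_right 0. C * \<delta> powr p < c"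
    using assms(2) by (intro order_tendstoD) auto
  moreover have "\<forall>\<^sub>F \<delta> in at_right (0::real). \<delta> \<in> {0<..<\<epsilon>}"
    using assms(3) by (rule eventually_at_right_real)
  ultimately have "\<forall>\<^sub>F \<delta> in at_right 0. 0 < \<delta> \<and> \<delta> < \<epsilon> \<and> C * \<delta> powr p < c"
    by eventually_elim auto
  then show ?thesis using eventually_happens' trivial_limit_at_right_real by blast
qed


lemma emeasure_lborel_cbox_cart:
  fixes l u :: "real ^ 'n::finite"
  assumes "\<And>i. l $ i \<le> u $ i"
  shows "emeasure lborel (cbox l u) = ennreal (\<Prod>i\<in>UNIV. u $ i - l $ i)"
proof -
  have "emeasure lborel (cbox l u) = (\<Prod>b\<in>Basis. (u - l) \<bullet> b)"
    using assms by (intro emeasure_lborel_cbox) (auto simp: Basis_vec_def inner_axis)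
  then show ?thesis by (simp add: prod_Basis_vec inner_axis)
qed

text \<open>A box at distance about \<open>\<delta>\<close> from the divisor \<open>u\<^sub>i = 0\<close> has an image of volume at least
  \<open>c \<delta>\<^bsup>h+1\<^esup>\<close> inside the sublevel set \<open>K \<le> C \<delta>\<^bsup>k\<^esup>\<close>.\<close>

lemma resolution_exponent_ge:
  fixes g :: "'u \<Rightarrow> real ^ 'n::finite" and l C :: real
  assumes res: "resolution K W X A g k h" and "W \<subseteq> \<Theta>" and Q: "Q \<in> zero_fibre K X g"
    and upper: "\<And>t. t > 0 \<Longrightarrow> \<exists>B\<in>sets borel. {\<theta>\<in>\<Theta>. K \<theta> \<le> t} \<subseteq> B \<and> emeasure lborel B \<le> ennreal (C * t powr l)"
    and "l > 0"
  shows "l * real (k Q i) \<le> real (h Q i) + 1"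
proof (rule ccontr)
  assume neg: "\<not> l * real (k Q i) \<le> real (h Q i) + 1"
  obtain f V \<phi> a b \<epsilon> \<alpha> \<beta> where eps: "\<epsilon> > 0" "\<epsilon> \<le> 1" and pos: "\<alpha> > 0" "\<beta> > 0" and f0: "f 0 = g Q" and
    V: "openin X V" "Q \<in> V" and fV: "\<And>v. v \<in> V \<Longrightarrow> (\<forall>i. \<bar>\<phi> v $ i\<bar> \<le> \<epsilon>) \<and> f (\<phi> v) = g v" and
    con: "continuous_on {u. \<forall>i. \<bar>u $ i\<bar> \<le> \<epsilon>} a" "continuous_on {u. \<forall>i. \<bar>u $ i\<bar> \<le> \<epsilon>} b" and
    bnd: "\<And>u. (\<forall>i. \<bar>u $ i\<bar> \<le> \<epsilon>) \<Longrightarrow> \<alpha> / 2 \<le> \<bar>a u\<bar> \<and> \<bar>a u\<bar> \<le> 2 * \<alpha> \<and> \<beta> / 2 \<le> \<bar>b u\<bar> \<and> \<bar>b u\<bar> \<le> 2 * \<beta>" and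
    Kf: "\<And>u. (\<forall>i. \<bar>u $ i\<bar> \<le> \<epsilon>) \<Longrightarrow> f u \<in> W \<and> K (f u) = a u * mono_pow (k Q) u" and
    der: "\<And>u. (\<forall>i. \<bar>u $ i\<bar> \<le> \<epsilon>) \<Longrightarrow> (f has_derivative frechet_derivative f (at u)) (at u)" and
    det: "\<And>u. (\<forall>i. \<bar>u $ i\<bar> \<le> \<epsilon>) \<Longrightarrow> \<bar>det (matrix (frechet_derivative f (at u)))\<bar> = \<bar>b u * mono_pow (h Q) u\<bar>" and
    inj: "\<And>u u'. (\<forall>i. \<bar>u $ i\<bar> \<le> \<epsilon>) \<Longrightarrow> (\<forall>i. \<bar>u' $ i\<bar> \<le> \<epsilon>) \<Longrightarrow> K (f u) \<noteq> 0 \<Longrightarrow> f u = f u' \<Longrightarrow> u = u'"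
    by (rule normal_crossing_box[OF res Q]; rule that; assumption)
  define kk hh where "kk = k Q i" and "hh = h Q i"
  \<comment> \<open>The factors are lower bounds for the unit \<open>b\<close> and for the monomial
    of the Jacobian, and the volume of the box, with all powers of \<open>\<delta>\<close> taken
    out.\<close>
  define c where "c = \<beta> / 2 * ((1/2) ^ hh * (\<Prod>j\<in>UNIV - {i}. (\<epsilon>/2) ^ h Q j)) * (1/2 * (\<epsilon>/2) ^ (CARD('n) - 1))"
  have "c > 0" unfolding c_def using eps pos by (intro mult_pos_pos prod_pos) auto
  have est: "c \<le> (C * (2 * \<alpha>) powr l) * \<delta> powr (l * real kk - (real hh + 1))" if \<delta>: "0 < \<delta>" "\<delta> < \<epsilon>" for \<delta>
  proof -
    \<comment> \<open>Only coordinate \<open>i\<close> approaches its divisor; the others stay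
      between \<open>\<epsilon>/2\<close> and \<open>\<epsilon>\<close>. Hence \<open>K\<close> does
      not vanish on the box, the map is injective there, and the volume of the image equals the
      integral.\<close>
    define lo hi where "lo = (\<chi> j. if j = i then \<delta>/2 else \<epsilon>/2)" and "hi = (\<chi> j. if j = i then \<delta> else \<epsilon>)"
    define S where "S = cbox lo hi"
    have inS: "\<delta>/2 \<le> u $ i \<and> u $ i \<le> \<delta>" "\<And>j. j \<noteq> i \<Longrightarrow> \<epsilon>/2 \<le> u $ j \<and> u $ j \<le> \<epsilon>" if "u \<in> S" for u
      using that unfolding S_def mem_box_cart lo_def hi_def by (force split: if_splits)+
    have posS: "0 < u $ j" and boxS: "\<bar>u $ j\<bar> \<le> \<epsilon>" if "u \<in> S" for u j
      using inS[OF that] \<delta> eps by (cases "j = i"; force)+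
    have compS: "compact S" unfolding S_def by (rule compact_cbox)
    let ?w = "\<lambda>u. \<bar>b u * mono_pow (h Q) u\<bar>"
    have w: "continuous_on S ?w"
      by (intro continuous_intros continuous_on_mono_pow continuous_on_subset[OF con(2)]) (use boxS in blast)
    have mk: "0 < mono_pow (k Q) u" if "u \<in> S" for u
      using posS[OF that] by (simp add: mono_pow_def prod_pos)
    have Knz: "K (f u) \<noteq> 0" if "u \<in> S" for u
    proof -
      have "a u \<noteq> 0" using bnd[of u] boxS[OF that] pos by auto
      then show ?thesis using Kf[of u] boxS[OF that] mk[OF that] by simp
    qed
    have "inj_on f S"
      using inj boxS Knz by (intro inj_onI) blast
    then have em: "emeasure lborel (f ` S) = (\<integral>\<^sup>+u\<in>S. ennreal (?w u) \<partial>lborel)"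
      using emeasure_compact_image(2)[OF compS _ w, of f "\<lambda>u. frechet_derivative f (at u)"] der det boxS
      by (meson has_derivative_at_withinI)
    have wge: "\<beta> / 2 * ((\<delta>/2) ^ hh * (\<Prod>j\<in>UNIV - {i}. (\<epsilon>/2) ^ h Q j)) \<le> ?w u" if u: "u \<in> S" for u
    proof -
      have "(\<delta>/2) ^ hh * (\<Prod>j\<in>UNIV - {i}. (\<epsilon>/2) ^ h Q j) \<le> (u $ i) ^ hh * (\<Prod>j\<in>UNIV - {i}. (u $ j) ^ h Q j)"
        using inS[OF u] \<delta> eps by (intro mult_mono power_mono prod_mono conjI prod_nonneg) auto
      also have "\<dots> = mono_pow (h Q) u"
        unfolding mono_pow_def hh_def by (subst (2) prod.remove[of _ i]) auto
      finally have "(\<delta>/2) ^ hh * (\<Prod>j\<in>UNIV - {i}. (\<epsilon>/2) ^ h Q j) \<le> \<bar>mono_pow (h Q) u\<bar>" by simp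
      moreover have "\<beta> / 2 \<le> \<bar>b u\<bar>" using bnd[of u] boxS[OF u] by blast
      ultimately show ?thesis unfolding abs_mult using pos \<delta> eps
        by (intro mult_mono) (auto intro!: mult_nonneg_nonneg prod_nonneg)
    qed
    have Kle: "K (f u) \<le> 2 * \<alpha> * \<delta> ^ kk" if u: "u \<in> S" for u
    proof -
      have "mono_pow (k Q) u = (u $ i) ^ kk * (\<Prod>j\<in>UNIV - {i}. (u $ j) ^ k Q j)"
        unfolding mono_pow_def kk_def by (subst prod.remove[of _ i]) auto
      also have "\<dots> \<le> \<delta> ^ kk * 1"
        using inS[OF u] \<delta> eps posS[OF u]
        by (intro mult_mono power_mono prod_le_1 prod_nonneg conjI power_le_one)
           (auto simp: less_imp_le intro: order_trans)
      finally have m: "mono_pow (k Q) u \<le> \<delta> ^ kk" by simp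
      have "K (f u) \<le> \<bar>a u\<bar> * mono_pow (k Q) u"
        using Kf[of u] boxS[OF u] mk[OF u] by (simp add: mult_right_mono)
      also have "\<dots> \<le> 2 * \<alpha> * \<delta> ^ kk"
        using bnd[of u] boxS[OF u] m mk[OF u] pos by (intro mult_mono) auto
      finally show ?thesis .
    qed
    have "2 * \<alpha> * \<delta> ^ kk > 0" using pos \<delta> by simp
    from upper[OF this] obtain B where B: "B \<in> sets borel" "{\<theta>\<in>\<Theta>. K \<theta> \<le> 2 * \<alpha> * \<delta> ^ kk} \<subseteq> B"
      "emeasure lborel B \<le> ennreal (C * (2 * \<alpha> * \<delta> ^ kk) powr l)" by blast
    have "f ` S \<subseteq> B" using Kle Kf boxS B(2) \<open>W \<subseteq> \<Theta>\<close> by blast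
    define c1 where "c1 = \<beta> / 2 * ((\<delta>/2) ^ hh * (\<Prod>j\<in>UNIV - {i}. (\<epsilon>/2) ^ h Q j))"
    have "c1 \<ge> 0" unfolding c1_def using pos \<delta> eps by (intro mult_nonneg_nonneg prod_nonneg) auto
    have volS: "emeasure lborel S = ennreal (\<delta>/2 * (\<epsilon>/2) ^ (CARD('n) - 1))"
    proof -
      have "(\<Prod>j\<in>UNIV. hi $ j - lo $ j) = (hi $ i - lo $ i) * (\<Prod>j\<in>UNIV - {i}. hi $ j - lo $ j)"
        by (subst prod.remove[of _ i]) auto
      also have "(\<Prod>j\<in>UNIV - {i}. hi $ j - lo $ j) = (\<Prod>j\<in>UNIV - {i}. \<epsilon>/2)"
        by (intro prod.cong) (auto simp: hi_def lo_def)
      finally have "(\<Prod>j\<in>UNIV. hi $ j - lo $ j) = \<delta>/2 * (\<epsilon>/2) ^ (CARD('n) - 1)"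
        by (simp add: hi_def lo_def)
      moreover have "emeasure lborel S = ennreal (\<Prod>j\<in>UNIV. hi $ j - lo $ j)"
        unfolding S_def using \<delta> eps by (intro emeasure_lborel_cbox_cart) (auto simp: hi_def lo_def)
      ultimately show ?thesis by (simp only:)
    qed
    have "ennreal (c1 * (\<delta>/2 * (\<epsilon>/2) ^ (CARD('n) - 1))) = ennreal c1 * emeasure lborel S"
      unfolding volS by (rule ennreal_mult'[OF \<open>c1 \<ge> 0\<close>])
    also have "\<dots> = (\<integral>\<^sup>+u\<in>S. ennreal c1 \<partial>lborel)"
      unfolding S_def by (simp add: nn_integral_cmult_indicator)
    also have "\<dots> \<le> (\<integral>\<^sup>+u\<in>S. ennreal (?w u) \<partial>lborel)"
      using wge unfolding c1_def by (intro nn_integral_mono) (auto simp: indicator_def intro!: ennreal_leI)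
    also have "\<dots> \<le> emeasure lborel B"
      unfolding em[symmetric] using \<open>f ` S \<subseteq> B\<close> B(1) by (intro emeasure_mono) auto
    also have "\<dots> \<le> ennreal (C * (2 * \<alpha> * \<delta> ^ kk) powr l)" by (rule B(3))
    finally have "ennreal (c1 * (\<delta>/2 * (\<epsilon>/2) ^ (CARD('n) - 1))) \<le> ennreal (C * (2 * \<alpha> * \<delta> ^ kk) powr l)" .
    moreover have "c1 * (\<delta>/2 * (\<epsilon>/2) ^ (CARD('n) - 1)) = c * \<delta> ^ (hh + 1)"
      unfolding c1_def c_def by (simp add: power_divide field_simps)
    moreover have cd: "c * \<delta> ^ (hh + 1) > 0" using \<open>c > 0\<close> \<delta> by simp
    ultimately have "c * \<delta> ^ (hh + 1) \<le> C * (2 * \<alpha> * \<delta> ^ kk) powr l"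
      by (metis ennreal_le_iff2 less_eq_real_def not_less)
    also have "(2 * \<alpha> * \<delta> ^ kk) powr l = (2 * \<alpha>) powr l * \<delta> powr (l * real kk)"
      using pos \<delta> by (simp add: powr_mult powr_realpow[symmetric] powr_powr mult.commute)
    finally have "c * \<delta> powr (real hh + 1) \<le> C * ((2 * \<alpha>) powr l * \<delta> powr (l * real kk))"
      using \<delta> by (simp add: powr_add powr_realpow mult_ac)
    then have "c \<le> C * ((2 * \<alpha>) powr l * \<delta> powr (l * real kk)) / \<delta> powr (real hh + 1)"
      using \<delta> by (simp add: pos_le_divide_eq)
    then show ?thesis by (simp add: powr_diff)
  qed
  \<comment> \<open>If \<open>l k > h + 1\<close>, the right-hand side of \<open>est\<close> tends
    to 0 with \<open>\<delta>\<close> while \<open>c\<close> is fixed.\<close>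
  obtain \<delta> where "0 < \<delta>" "\<delta> < \<epsilon>" "(C * (2 * \<alpha>) powr l) * \<delta> powr (l * real kk - (real hh + 1)) < c"
    using powr_eventually_small[of "l * real kk - (real hh + 1)" c \<epsilon> "C * (2 * \<alpha>) powr l"] neg \<open>c > 0\<close> eps(1)
    by (auto simp: kk_def hh_def)
  then show False using est by fastforce
qed

text \<open>Change of variables enters as an upper bound, because \<open>f\<close> may collapse the
  divisor. The bounds on the units \<open>a\<close> and \<open>b\<close> pull the set
  \<open>K \<le> t\<close> back into the monomial sublevel set at level
  \<open>(2 / \<alpha>) * t\<close>, where \<open>monomial_sublevel_integral\<close>
  applies.\<close>

lemma resolution_local_volume:
  fixes g :: "'u \<Rightarrow> real ^ 'n::finite" and s :: real
  assumes res: "resolution K W X A g k h" and Q: "Q \<in> zero_fibre K X g"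
    and Knn: "\<And>\<theta>. \<theta> \<in> W \<Longrightarrow> 0 \<le> K \<theta>"
    and "s \<ge> 0" and exp: "\<And>i. real (h Q i) - s * real (k Q i) > -1"
  shows "\<exists>V C. openin X V \<and> Q \<in> V \<and> C \<ge> 0 \<and> (\<forall>t>0. \<exists>Z\<in>sets borel.
           {g v |v. v \<in> V \<and> K (g v) \<le> t} \<subseteq> Z \<and> emeasure lborel Z \<le> ennreal (C * t powr s))"
proof -
  obtain f V \<phi> a b \<epsilon> \<alpha> \<beta> where eps: "\<epsilon> > 0" "\<epsilon> \<le> 1" and pos: "\<alpha> > 0" "\<beta> > 0" and f0: "f 0 = g Q" and
    V: "openin X V" "Q \<in> V" and fV: "\<And>v. v \<in> V \<Longrightarrow> (\<forall>i. \<bar>\<phi> v $ i\<bar> \<le> \<epsilon>) \<and> f (\<phi> v) = g v" and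
    con: "continuous_on {u. \<forall>i. \<bar>u $ i\<bar> \<le> \<epsilon>} a" "continuous_on {u. \<forall>i. \<bar>u $ i\<bar> \<le> \<epsilon>} b" and
    bnd: "\<And>u. (\<forall>i. \<bar>u $ i\<bar> \<le> \<epsilon>) \<Longrightarrow> \<alpha> / 2 \<le> \<bar>a u\<bar> \<and> \<bar>a u\<bar> \<le> 2 * \<alpha> \<and> \<beta> / 2 \<le> \<bar>b u\<bar> \<and> \<bar>b u\<bar> \<le> 2 * \<beta>" and
    Kf: "\<And>u. (\<forall>i. \<bar>u $ i\<bar> \<le> \<epsilon>) \<Longrightarrow> f u \<in> W \<and> K (f u) = a u * mono_pow (k Q) u" and
    der: "\<And>u. (\<forall>i. \<bar>u $ i\<bar> \<le> \<epsilon>) \<Longrightarrow> (f has_derivative frechet_derivative f (at u)) (at u)" and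
    det: "\<And>u. (\<forall>i. \<bar>u $ i\<bar> \<le> \<epsilon>) \<Longrightarrow> \<bar>det (matrix (frechet_derivative f (at u)))\<bar> = \<bar>b u * mono_pow (h Q) u\<bar>" and
    inj: "\<And>u u'. (\<forall>i. \<bar>u $ i\<bar> \<le> \<epsilon>) \<Longrightarrow> (\<forall>i. \<bar>u' $ i\<bar> \<le> \<epsilon>) \<Longrightarrow> K (f u) \<noteq> 0 \<Longrightarrow> f u = f u' \<Longrightarrow> u = u'"
    by (rule normal_crossing_box[OF res Q]; rule that; assumption)
  obtain C where C: "C \<ge> 0" "\<And>t. t > 0 \<Longrightarrow>
      (\<integral>\<^sup>+u\<in>{u. (\<forall>i. \<bar>u $ i\<bar> \<le> \<epsilon>) \<and> \<bar>mono_pow (k Q) u\<bar> \<le> t}. ennreal \<bar>mono_pow (h Q) u\<bar> \<partial>lborel) \<le> ennreal (C * t powr s)"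
    using monomial_sublevel_integral[of \<epsilon> s "h Q" "k Q"] eps(1) \<open>s \<ge> 0\<close> exp by (auto simp: less_imp_le)
  let ?box = "{u :: real ^ 'n. \<forall>i. \<bar>u $ i\<bar> \<le> \<epsilon>}"
  have "?box = cbox (\<chi> i. - \<epsilon>) (\<chi> i. \<epsilon>)" by (auto simp: mem_box_cart abs_le_iff minus_le_iff)
  then have cbox: "compact ?box" by (metis compact_cbox)
  have main: "\<exists>Z\<in>sets borel. {g v |v. v \<in> V \<and> K (g v) \<le> t} \<subseteq> Z \<and>
      emeasure lborel Z \<le> ennreal ((2 * \<beta> * C * (2 / \<alpha>) powr s) * t powr s)" if t: "t > 0" for t
  proof -
    define S where "S = {u \<in> ?box. \<bar>a u * mono_pow (k Q) u\<bar> \<in> {..t}}"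
    have "continuous_on ?box (\<lambda>u. \<bar>a u * mono_pow (k Q) u\<bar>)"
      by (intro continuous_intros continuous_on_mono_pow con)
    then have "closed S" unfolding S_def
      using cbox by (intro continuous_closed_preimage[unfolded vimage_def Int_def, simplified] continuous_on_closed_Collect_le)
        (auto simp: compact_imp_closed closed_Collect_le)
    then have compS: "compact S"
      using cbox compact_Int_closed[of ?box S] by (simp add: S_def Int_absorb1 subset_iff Collect_conj_eq inf.absorb2)
    let ?w = "\<lambda>u. \<bar>b u * mono_pow (h Q) u\<bar>"
    have w: "continuous_on S ?w"
      by (intro continuous_intros continuous_on_mono_pow continuous_on_subset[OF con(2)]) (auto simp: S_def)
    have "continuous_on S f"
      by (intro continuous_at_imp_continuous_on ballI has_derivative_continuous[OF der]) (simp add: S_def)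
    then have "compact (f ` S)" using compS compact_continuous_image by blast
    then have Zb: "f ` S \<in> sets borel" by (simp add: compact_imp_closed borel_closed)
    have "emeasure lborel (f ` S) \<le> (\<integral>\<^sup>+u\<in>S. ennreal (?w u) \<partial>lborel)"
      by (rule emeasure_compact_image(1)[OF compS has_derivative_at_withinI[OF der] w det]) (auto simp: S_def)
    also have "\<dots> \<le> (\<integral>\<^sup>+u. ennreal (2 * \<beta>) * (ennreal \<bar>mono_pow (h Q) u\<bar> *
        indicator {u. (\<forall>i. \<bar>u $ i\<bar> \<le> \<epsilon>) \<and> \<bar>mono_pow (k Q) u\<bar> \<le> (2 / \<alpha>) * t} u) \<partial>lborel)"
    proof (rule nn_integral_mono)
      fix u :: "real ^ 'n"
      show "ennreal (?w u) * indicator S u \<le> ennreal (2 * \<beta>) * (ennreal \<bar>mono_pow (h Q) u\<bar> *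
        indicator {u. (\<forall>i. \<bar>u $ i\<bar> \<le> \<epsilon>) \<and> \<bar>mono_pow (k Q) u\<bar> \<le> (2 / \<alpha>) * t} u)"
      proof (cases "u \<in> S")
        case True
        then have u: "\<forall>i. \<bar>u $ i\<bar> \<le> \<epsilon>" and at: "\<bar>a u\<bar> * \<bar>mono_pow (k Q) u\<bar> \<le> t"
          by (auto simp: S_def abs_mult)
        have "\<alpha> / 2 * \<bar>mono_pow (k Q) u\<bar> \<le> \<bar>a u\<bar> * \<bar>mono_pow (k Q) u\<bar>"
          using bnd[OF u] by (intro mult_right_mono) auto
        then have "\<bar>mono_pow (k Q) u\<bar> \<le> (2 / \<alpha>) * t" using at pos by (simp add: field_simps)
        moreover have "?w u \<le> 2 * \<beta> * \<bar>mono_pow (h Q) u\<bar>"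
          unfolding abs_mult using bnd[OF u] by (intro mult_right_mono) auto
        ultimately show ?thesis using True u pos
          by (simp add: ennreal_mult'[symmetric] ennreal_leI)
      qed simp
    qed
    also have "\<dots> = ennreal (2 * \<beta>) * (\<integral>\<^sup>+u\<in>{u. (\<forall>i. \<bar>u $ i\<bar> \<le> \<epsilon>) \<and> \<bar>mono_pow (k Q) u\<bar> \<le> (2 / \<alpha>) * t}.
        ennreal \<bar>mono_pow (h Q) u\<bar> \<partial>lborel)"
    proof (rule nn_integral_cmult)
      have m: "mono_pow \<gamma> \<in> borel_measurable borel" for \<gamma> :: "'n \<Rightarrow> nat"
        using continuous_on_mono_pow borel_measurable_continuous_onI by blast
      have "closed {u :: real ^ 'n. (\<forall>i. \<bar>u $ i\<bar> \<le> \<epsilon>) \<and> \<bar>mono_pow (k Q) u\<bar> \<le> (2 / \<alpha>) * t}"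
        by (intro closed_Collect_conj closed_Collect_all closed_Collect_le continuous_intros continuous_on_mono_pow)
      then have [measurable]: "{u :: real ^ 'n. (\<forall>i. \<bar>u $ i\<bar> \<le> \<epsilon>) \<and> \<bar>mono_pow (k Q) u\<bar> \<le> (2 / \<alpha>) * t} \<in> sets borel"
        by (rule borel_closed)
      note m[measurable]
      show "(\<lambda>u. ennreal \<bar>mono_pow (h Q) u\<bar> *
        indicator {u. (\<forall>i. \<bar>u $ i\<bar> \<le> \<epsilon>) \<and> \<bar>mono_pow (k Q) u\<bar> \<le> (2 / \<alpha>) * t} u) \<in> borel_measurable lborel"
        by measurable
    qed
    also have "\<dots> \<le> ennreal (2 * \<beta>) * ennreal (C * ((2 / \<alpha>) * t) powr s)"
      using t pos by (intro mult_left_mono C(2)) auto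
    also have "\<dots> = ennreal ((2 * \<beta> * C * (2 / \<alpha>) powr s) * t powr s)"
    proof -
      have pm: "((2 / \<alpha>) * t) powr s = (2 / \<alpha>) powr s * t powr s"
        by (rule powr_mult)
      have "2 * \<beta> \<ge> 0" using pos by simp
      then show ?thesis unfolding pm by (simp only: ennreal_mult'[symmetric] mult_ac)
    qed
    finally have le: "emeasure lborel (f ` S) \<le> ennreal ((2 * \<beta> * C * (2 / \<alpha>) powr s) * t powr s)" .
    have "{g v |v. v \<in> V \<and> K (g v) \<le> t} \<subseteq> f ` S"
    proof safe
      fix v assume v: "v \<in> V" "K (g v) \<le> t"
      have "0 \<le> K (f (\<phi> v))" using Kf[of "\<phi> v"] fV[OF v(1)] Knn by blast
      then have "\<phi> v \<in> S" using fV[OF v(1)] v(2) Kf[of "\<phi> v"] by (auto simp: S_def)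
      then show "g v \<in> f ` S" using fV[OF v(1)] by (metis image_eqI)
    qed
    then show ?thesis using Zb le by blast
  qed
  have "2 * \<beta> * C * (2 / \<alpha>) powr s \<ge> 0" using pos C(1) by simp
  then show ?thesis using V main by blast
qed

theorem resolution_threshold_eq:
  fixes K :: "real ^ 'n::finite \<Rightarrow> real" and l :: real
  assumes res: "resolution K W X A g k h" and W: "open W" "P \<in> W" "W \<subseteq> \<Theta>"
    and Knn: "\<And>\<theta>. \<theta> \<in> \<Theta> \<Longrightarrow> 0 \<le> K \<theta>" and Kz: "\<And>\<theta>. \<theta> \<in> \<Theta> \<Longrightarrow> K \<theta> = 0 \<longleftrightarrow> \<theta> = P"
    and "l > 0"
    and upper: "\<And>t. t > 0 \<Longrightarrow> \<exists>B\<in>sets borel. {\<theta>\<in>\<Theta>. K \<theta> \<le> t} \<subseteq> B \<and> emeasure lborel B \<le> ennreal (C * t powr l)"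
    and lower: "\<And>r. r > 0 \<Longrightarrow> \<exists>c>0. \<exists>t\<^sub>0>0. \<forall>t. 0 < t \<and> t < t\<^sub>0 \<longrightarrow>
       (\<exists>B\<in>sets borel. B \<subseteq> {\<theta>\<in>ball P r. K \<theta> \<le> t} \<and> ennreal (c * t powr l) \<le> emeasure lborel B)"
  shows "resolution_threshold (zero_fibre K X g) k h = ereal l"
proof (rule antisym)
  let ?U = "zero_fibre K X g"
  let ?q = "\<lambda>Q i. if k Q i = 0 then \<infinity> else ereal ((real (h Q i) + 1) / real (k Q i))"
  show "ereal l \<le> resolution_threshold ?U k h"
    unfolding resolution_threshold_def
  proof (intro INF_greatest)
    fix Q i assume "Q \<in> ?U"
    from resolution_exponent_ge[OF res W(3) this upper \<open>l > 0\<close>, of i]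
    show "ereal l \<le> ?q Q i" by (auto simp: field_simps)
  qed
  show "resolution_threshold ?U k h \<le> ereal l"
  proof (rule ccontr)
    assume "\<not> ?thesis"
    then obtain s where s: "ereal l < ereal s" "ereal s < resolution_threshold ?U k h"
      using ereal_dense2 by (metis not_le)
    have "s > 0" using s(1) \<open>l > 0\<close> by simp
    have exp: "real (h Q i) - s * real (k Q i) > -1" if "Q \<in> ?U" for Q i
    proof (cases "k Q i = 0")
      case False
      have "resolution_threshold ?U k h \<le> ?q Q i"
        unfolding resolution_threshold_def by (meson INF_lower INF_lower2 UNIV_I that)
      with s(2) have "ereal s < ?q Q i" by (rule less_le_trans)
      then have "s < (real (h Q i) + 1) / real (k Q i)" using False by simp
      then show ?thesis using False by (simp add: field_simps)
    qed simp
    have gW: "g v \<in> W" if "v \<in> topspace X" for v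
      using res that by (auto simp: resolution_def continuous_map_def Pi_iff)
    \<comment> \<open>As \<open>P\<close> is the only zero of \<open>K\<close>, the zero fibre is
      the preimage of one point, so properness makes it compact.\<close>
    have fibre: "?U = {v \<in> topspace X. g v = P}"
      using gW W(3) Kz unfolding zero_fibre_def by blast
    have proper: "proper_map X (top_of_set W) g" using res by (simp add: resolution_def)
    have comp: "compactin X ?U"
      unfolding fibre using proper W(2) by (simp add: proper_map_def)
    define good where "good Q V C \<longleftrightarrow> openin X V \<and> Q \<in> V \<and> C \<ge> 0 \<and> (\<forall>t>0. \<exists>Z\<in>sets borel.
           {g v |v. v \<in> V \<and> K (g v) \<le> t} \<subseteq> Z \<and> emeasure lborel Z \<le> ennreal (C * t powr s))" for Q V C
    have "\<forall>Q\<in>?U. \<exists>V C. good Q V C"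
      unfolding good_def
      using \<open>s > 0\<close> W(3) by (intro ballI resolution_local_volume[OF res] exp Knn) auto
    then have ex: "\<forall>Q\<in>?U. \<exists>p. good Q (fst p) (snd p)" by (simp only: split_paired_Ex fst_conv snd_conv)
    define p where "p Q = (SOME p. good Q (fst p) (snd p))" for Q
    define V D where "V Q = fst (p Q)" and "D Q = snd (p Q)" for Q
    have VD: "openin X (V Q) \<and> Q \<in> V Q \<and> D Q \<ge> 0 \<and> (\<forall>t>0. \<exists>Z\<in>sets borel.
           {g v |v. v \<in> V Q \<and> K (g v) \<le> t} \<subseteq> Z \<and> emeasure lborel Z \<le> ennreal (D Q * t powr s))"
      if "Q \<in> ?U" for Q
    proof -
      have "good Q (V Q) (D Q)"
        unfolding V_def D_def p_def by (rule someI_ex[OF bspec[OF ex that]])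
      then show ?thesis unfolding good_def .
    qed
    have "\<exists>F. finite F \<and> F \<subseteq> V ` ?U \<and> ?U \<subseteq> \<Union>F"
      proof -
      have "\<forall>\<U>. Ball \<U> (openin X) \<and> ?U \<subseteq> \<Union>\<U> \<longrightarrow> (\<exists>F. finite F \<and> F \<subseteq> \<U> \<and> ?U \<subseteq> \<Union>F)"
        using comp by (simp add: compactin_def)
      moreover have "Ball (V ` ?U) (openin X)" "?U \<subseteq> \<Union>(V ` ?U)" using VD by blast+
      ultimately show ?thesis by blast
    qed
    then obtain G where G: "finite G" "G \<subseteq> V ` ?U" "?U \<subseteq> \<Union>G" by (elim exE conjE)
    obtain F where F: "finite F" "F \<subseteq> ?U" "G = V ` F"
      using finite_subset_image[OF G(1,2)] by blast
    note F = F(1,2) G(3)[unfolded F(3)]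
    \<comment> \<open>A proper map is closed, so the image of the complement of this cover is closed
      in \<open>W\<close>. It misses \<open>P\<close>; hence a whole ball around \<open>P\<close>
      has all its preimages inside the cover.\<close>
    let ?O = "\<Union>Q\<in>F. V Q"
    have "openin X ?O" using F(2) VD by (intro openin_clauses(3)) auto
    then have "closedin X (topspace X - ?O)" by (simp add: closedin_diff)
    then have "closedin (top_of_set W) (g ` (topspace X - ?O))"
      using proper by (simp add: proper_map_def closed_map_def)
    then have "openin (top_of_set W) (W - g ` (topspace X - ?O))"
      using openin_diff[OF openin_topspace, of "top_of_set W"] by simp
    then have op: "open (W - g ` (topspace X - ?O))" using W(1) openin_open_eq by blast
    have "P \<in> W - g ` (topspace X - ?O)" using W(2) F(3) unfolding fibre by auto
    then obtain r where r: "r > 0" "ball P r \<subseteq> W - g ` (topspace X - ?O)"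
      using op open_contains_ball by blast
    have bij: "bij_betw g (topspace X - ?U) {\<theta> \<in> W. K \<theta> \<noteq> 0}"
      using res by (simp add: resolution_def Let_def)
    obtain c t\<^sub>0 where c: "c > 0" "t\<^sub>0 > 0" "\<And>t. 0 < t \<Longrightarrow> t < t\<^sub>0 \<Longrightarrow>
       (\<exists>B\<in>sets borel. B \<subseteq> {\<theta>\<in>ball P r. K \<theta> \<le> t} \<and> ennreal (c * t powr l) \<le> emeasure lborel B)"
      using lower[OF r(1)] by blast
    have est: "c \<le> (\<Sum>Q\<in>F. D Q) * t powr (s - l)" if t: "0 < t" "t < t\<^sub>0" for t
    proof -
      obtain B where B: "B \<in> sets borel" "B \<subseteq> {\<theta>\<in>ball P r. K \<theta> \<le> t}" "ennreal (c * t powr l) \<le> emeasure lborel B"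
        using c(3)[OF t] by blast
      have "\<forall>Q\<in>F. \<exists>Z. Z \<in> sets borel \<and> {g v |v. v \<in> V Q \<and> K (g v) \<le> t} \<subseteq> Z \<and> emeasure lborel Z \<le> ennreal (D Q * t powr s)"
      proof
        fix Q assume "Q \<in> F"
        with F(2) have "Q \<in> ?U" by (rule subsetD)
        then have "\<forall>t>0. \<exists>Z\<in>sets borel. {g v |v. v \<in> V Q \<and> K (g v) \<le> t} \<subseteq> Z \<and> emeasure lborel Z \<le> ennreal (D Q * t powr s)"
          by (rule VD[THEN conjunct2, THEN conjunct2, THEN conjunct2])
        from this[rule_format, OF t(1)] show "\<exists>Z. Z \<in> sets borel \<and> {g v |v. v \<in> V Q \<and> K (g v) \<le> t} \<subseteq> Z
            \<and> emeasure lborel Z \<le> ennreal (D Q * t powr s)"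
          unfolding Bex_def .
      qed
      from bchoice[OF this] obtain Z where Z0: "\<forall>Q\<in>F. Z Q \<in> sets borel \<and> {g v |v. v \<in> V Q \<and> K (g v) \<le> t} \<subseteq> Z Q
          \<and> emeasure lborel (Z Q) \<le> ennreal (D Q * t powr s)"
        ..
      note Z = bspec[OF Z0]
      \<comment> \<open>Off the fibre \<open>g\<close> is onto, so every point of \<open>B\<close>
        other than \<open>P\<close> is the image of a point, which must lie in the cover;
        \<open>P\<close> itself has measure 0.\<close>
      have "B \<subseteq> {P} \<union> (\<Union>Q\<in>F. Z Q)"
      proof
        fix \<theta> assume "\<theta> \<in> B"
        then have \<theta>: "\<theta> \<in> W" "\<theta> \<notin> g ` (topspace X - ?O)" "K \<theta> \<le> t" using B(2) r(2) by blast+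
        show "\<theta> \<in> {P} \<union> (\<Union>Q\<in>F. Z Q)"
        proof (cases "\<theta> = P")
          case False
          then have "\<theta> \<in> {\<theta> \<in> W. K \<theta> \<noteq> 0}" using \<theta>(1) Kz W(3) by auto
          then obtain v where v: "v \<in> topspace X" "\<theta> = g v" using bij by (auto simp: bij_betw_def)
          then obtain Q where "Q \<in> F" "v \<in> V Q" using \<theta>(2) by auto
          then show ?thesis using Z[of Q] \<theta>(3) v(2) by blast
        qed simp
      qed
      moreover have Zm: "(\<Union>Q\<in>F. Z Q) \<in> sets borel"
        using Z by (intro sets.finite_UN F(1)) auto
      ultimately have "emeasure lborel B \<le> emeasure lborel ({P} \<union> (\<Union>Q\<in>F. Z Q))"
        by (intro emeasure_mono) (simp_all only: sets_lborel sets.Un borel_singleton[OF sets.empty_sets] simp_thms)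
      also have "\<dots> \<le> emeasure lborel {P} + emeasure lborel (\<Union>Q\<in>F. Z Q)"
        using Zm by (intro emeasure_subadditive) auto
      also have "\<dots> = emeasure lborel (\<Union>Q\<in>F. Z Q)" by simp
      also have "\<dots> \<le> (\<Sum>Q\<in>F. emeasure lborel (Z Q))"
        using Z F(1) by (intro emeasure_subadditive_finite) auto
      also have "\<dots> \<le> (\<Sum>Q\<in>F. ennreal (D Q * t powr s))"
        using Z by (intro sum_mono) auto
      also have "\<dots> = ennreal ((\<Sum>Q\<in>F. D Q) * t powr s)"
        using VD F(2) by (subst sum_ennreal) (auto simp: sum_distrib_right)
      finally have "ennreal (c * t powr l) \<le> ennreal ((\<Sum>Q\<in>F. D Q) * t powr s)"
        using B(3) by (rule order_trans[rotated])
      moreover have "0 < c * t powr l" using c(1) t by simp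
      ultimately have "c * t powr l \<le> (\<Sum>Q\<in>F. D Q) * t powr s"
        by (metis ennreal_le_iff2 not_less)
      then have "c \<le> (\<Sum>Q\<in>F. D Q) * t powr s / t powr l"
        using t by (simp add: pos_le_divide_eq)
      then show ?thesis by (simp add: powr_diff)
    qed
    \<comment> \<open>As \<open>s > l\<close>, the upper bound in \<open>est\<close> tends to 0 with
      \<open>t\<close>, against the fixed \<open>c\<close>.\<close>
    obtain t where "0 < t" "t < t\<^sub>0" "(\<Sum>Q\<in>F. D Q) * t powr (s - l) < c"
      using powr_eventually_small[of "s - l" c t\<^sub>0 "\<Sum>Q\<in>F. D Q"] s(1) c(1,2) by auto
    then show False using est by fastforce
  qed
qed

section \<open>The Kullback-Leibler divergence of a binomial mixture\<close>

locale mixture_model =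
  fixes M :: nat and T :: "'n::finite \<Rightarrow> real" and z :: 'n and \<theta>\<^sub>0 :: real
  assumes M2: "M \<ge> 2" and Tpos: "\<And>i. i \<noteq> z \<Longrightarrow> 0 < T i"
    and Tsum: "(\<Sum>i\<in>UNIV - {z}. T i) < 1" and th: "0 < \<theta>\<^sub>0" "\<theta>\<^sub>0 < 1"
begin

definition wt :: "'n \<Rightarrow> real" where
  "wt i = (if i = z then 1 - (\<Sum>i\<in>UNIV - {z}. T i) else T i)"

lemma wt_pos: "0 < wt i"
  using Tpos Tsum by (simp add: wt_def)

lemma sum_wt: "(\<Sum>i\<in>UNIV. wt i) = 1"
  by (subst sum.remove[of _ z]) (simp_all add: wt_def)

lemma wt_le_1: "wt i \<le> 1"
  using member_le_sum[of i UNIV wt] wt_pos sum_wt by (simp add: less_imp_le)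

definition params :: "(real ^ 'n) set" where
  "params = {\<theta>. \<forall>i. 0 < \<theta> $ i \<and> \<theta> $ i < 1}"

definition base :: "real ^ 'n" where "base = (\<chi> i. \<theta>\<^sub>0)"

text \<open>Bernstein polynomials continue the binomial probabilities to all real parameters, so
  that algebraic identities hold without range conditions.\<close>

definition mix :: "nat \<Rightarrow> real ^ 'n \<Rightarrow> real" where
  "mix x \<theta> = (\<Sum>i\<in>UNIV. wt i * Bernstein M x (\<theta> $ i))"

definition tru :: "nat \<Rightarrow> real" where "tru x = Bernstein M x \<theta>\<^sub>0"

definition KL :: "real ^ 'n \<Rightarrow> real" where
  "KL \<theta> = (\<Sum>x\<le>M. tru x * ln (tru x / mix x \<theta>))"

lemma KL_fun_eq:
  assumes "\<theta> \<in> params"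
  shows "KL_fun (binomial_pmf M \<theta>\<^sub>0) (binomial_mixture M T z) \<theta> = KL \<theta>"
proof -
  have p: "binomial_mixture M T z x \<theta> = mix x \<theta>" for x
    unfolding binomial_mixture_def mix_def using assms
    by (subst (2) sum.remove[of _ z]) (auto simp: params_def wt_def Bernstein_def less_imp_le intro!: sum.cong)
  have q: "pmf (binomial_pmf M \<theta>\<^sub>0) x = tru x" for x
    using th by (simp add: tru_def Bernstein_def)
  have "KL_fun (binomial_pmf M \<theta>\<^sub>0) (binomial_mixture M T z) \<theta>
      = (\<Sum>x\<in>{..M}. ln (pmf (binomial_pmf M \<theta>\<^sub>0) x / binomial_mixture M T z x \<theta>) * pmf (binomial_pmf M \<theta>\<^sub>0) x)"
    unfolding KL_fun_def
  proof (rule integral_measure_pmf_real)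
    show "x \<in> {..M}" if "x \<in> set_pmf (binomial_pmf M \<theta>\<^sub>0)" for x
      using that th by (auto simp: set_pmf_binomial_eq split: if_splits)
  qed simp
  then show ?thesis by (simp add: KL_def p q mult.commute)
qed

lemma tru_pos: "x \<le> M \<Longrightarrow> 0 < tru x"
  unfolding tru_def using th by (rule Bernstein_pos)

lemma mix_pos: "\<theta> \<in> params \<Longrightarrow> x \<le> M \<Longrightarrow> 0 < mix x \<theta>"
  unfolding mix_def using wt_pos by (intro sum_pos) (auto simp: params_def intro!: mult_pos_pos Bernstein_pos)

lemma sum_tru: "(\<Sum>x\<le>M. tru x) = 1"
  by (simp add: tru_def sum_Bernstein)

lemma sum_mix_general: "(\<Sum>x\<le>M. c x * mix x \<theta>) = (\<Sum>i\<in>UNIV. wt i * (\<Sum>x\<le>M. c x * Bernstein M x (\<theta> $ i)))"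
  unfolding mix_def sum_distrib_left by (subst sum.swap) (simp add: mult_ac)

lemma sum_mix: "(\<Sum>x\<le>M. mix x \<theta>) = 1"
  using sum_mix_general[of "\<lambda>_. 1"] by (simp add: sum_Bernstein sum_wt)

section \<open>The first two moments and lower bounds for the divergence\<close>

definition m1 :: "real ^ 'n \<Rightarrow> real" where "m1 \<theta> = (\<Sum>i\<in>UNIV. wt i * (\<theta> $ i - \<theta>\<^sub>0))"
definition m2 :: "real ^ 'n \<Rightarrow> real" where "m2 \<theta> = (\<Sum>i\<in>UNIV. wt i * (\<theta> $ i - \<theta>\<^sub>0)\<^sup>2)"

lemma m2_nonneg: "0 \<le> m2 \<theta>"
  unfolding m2_def using wt_pos by (intro sum_nonneg) (simp add: less_imp_le)

lemma m2_ge: "wt i * (\<theta> $ i - \<theta>\<^sub>0)\<^sup>2 \<le> m2 \<theta>"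
  unfolding m2_def using wt_pos by (intro member_le_sum) (auto simp: less_imp_le)

lemma sum_diff_general:
  "(\<Sum>x\<le>M. c x * (mix x \<theta> - tru x))
     = (\<Sum>i\<in>UNIV. wt i * (\<Sum>x\<le>M. c x * Bernstein M x (\<theta> $ i))) - (\<Sum>i\<in>UNIV. wt i) * (\<Sum>x\<le>M. c x * Bernstein M x \<theta>\<^sub>0)"
  unfolding sum_mix_general[symmetric] sum_wt by (simp add: right_diff_distrib sum_subtractf tru_def)

lemma first_moment: "(\<Sum>x\<le>M. real x * (mix x \<theta> - tru x)) = real M * m1 \<theta>"
  unfolding sum_diff_general sum_k_Bernstein m1_def sum_distrib_left sum_distrib_right sum_subtractf[symmetric]
  by (intro sum.cong refl) (simp add: algebra_simps)

text \<open>The second factorial moment of a binomial law with parameter \<open>t\<close> is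
  \<open>M (M - 1) t\<^sup>2\<close>, and \<open>t\<^sup>2 - \<theta>\<^sub>0\<^sup>2\<close> is the
  squared displacement plus \<open>2 * \<theta>\<^sub>0\<close> times the displacement.\<close>

lemma second_moment:
  "(\<Sum>x\<le>M. real x * (real x - 1) * (mix x \<theta> - tru x)) = real M * (real M - 1) * (m2 \<theta> + 2 * \<theta>\<^sub>0 * m1 \<theta>)"
  unfolding sum_diff_general sum_kk_Bernstein m1_def m2_def sum_distrib_left sum_distrib_right
    sum.distrib[symmetric] sum_subtractf[symmetric]
  by (intro sum.cong refl) (simp add: power2_eq_square algebra_simps)

text \<open>Hellinger: \<open>-ln s \<ge> 2 (1 - \<surd>s)\<close> for \<open>s = p/q\<close>, summed against \<open>q\<close>.\<close>

lemma KL_lower: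
  assumes \<theta>: "\<theta> \<in> params"
  shows "(\<Sum>x\<le>M. (mix x \<theta> - tru x)\<^sup>2) \<le> 4 * KL \<theta>"
proof -
  have le1: "mix x \<theta> \<le> 1" "tru x \<le> 1" if "x \<le> M" for x
    using member_le_sum[of x "{..M}" "\<lambda>x. mix x \<theta>"] member_le_sum[of x "{..M}" tru] that
      sum_mix sum_tru mix_pos[OF \<theta>] tru_pos by (auto simp: less_imp_le)
  \<comment> \<open>The difference factors into difference and sum of the square roots, and the sum
    is at most 2.\<close>
  have t: "(mix x \<theta> - tru x)\<^sup>2 \<le> 4 * (sqrt (mix x \<theta>) - sqrt (tru x))\<^sup>2" if x: "x \<le> M" for x
  proof -
    have "sqrt (mix x \<theta>) \<le> 1" "sqrt (tru x) \<le> 1" "0 \<le> sqrt (mix x \<theta>)" "0 \<le> sqrt (tru x)"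
      using le1[OF x] mix_pos[OF \<theta> x] tru_pos[OF x] by (simp_all add: less_imp_le)
    then have "(sqrt (mix x \<theta>) + sqrt (tru x))\<^sup>2 \<le> 2\<^sup>2"
      by (intro power_mono) linarith+
    then have "(sqrt (mix x \<theta>) - sqrt (tru x))\<^sup>2 * (sqrt (mix x \<theta>) + sqrt (tru x))\<^sup>2
        \<le> (sqrt (mix x \<theta>) - sqrt (tru x))\<^sup>2 * 4" by (intro mult_left_mono) auto
    moreover have "(sqrt (mix x \<theta>) - sqrt (tru x)) * (sqrt (mix x \<theta>) + sqrt (tru x)) = mix x \<theta> - tru x"
      using mix_pos[OF \<theta> x] tru_pos[OF x] by (simp add: algebra_simps)
    ultimately show ?thesis by (metis mult.commute power_mult_distrib)
  qed
  have s: "2 * (tru x - sqrt (mix x \<theta>) * sqrt (tru x)) \<le> tru x * ln (tru x / mix x \<theta>)" if x: "x \<le> M" for x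
  proof -
    let ?p = "sqrt (mix x \<theta>)" and ?q = "sqrt (tru x)"
    have pos: "?p > 0" "?q > 0" using mix_pos[OF \<theta> x] tru_pos[OF x] by auto
    have "ln (?p / ?q) \<le> ?p / ?q - 1" using pos by (intro ln_le_minus_one) simp
    then have "2 * (1 - ?p / ?q) \<le> 2 * ln (?q / ?p)" using pos by (simp add: ln_div)
    also have "\<dots> = ln (tru x / mix x \<theta>)"
      using mix_pos[OF \<theta> x] tru_pos[OF x] by (simp add: ln_div ln_sqrt)
    finally have "tru x * (2 * (1 - ?p / ?q)) \<le> tru x * ln (tru x / mix x \<theta>)"
      using tru_pos[OF x] by (intro mult_left_mono) auto
    moreover have "tru x * (?p / ?q) = ?p * ?q"
      using tru_pos[OF x] pos by (simp add: field_simps) 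
    ultimately show ?thesis by (simp add: algebra_simps)
  qed
  have "(\<Sum>x\<le>M. (mix x \<theta> - tru x)\<^sup>2) \<le> (\<Sum>x\<le>M. 4 * (sqrt (mix x \<theta>) - sqrt (tru x))\<^sup>2)"
    using t by (intro sum_mono) auto
  also have "\<dots> = (\<Sum>x\<le>M. 4 * (mix x \<theta> + tru x - 2 * (sqrt (mix x \<theta>) * sqrt (tru x))))"
    using mix_pos[OF \<theta>] tru_pos by (intro sum.cong refl) (simp add: power2_diff less_imp_le)
  \<comment> \<open>Both families sum to 1, so \<open>mix x \<theta>\<close> may be exchanged for
    \<open>tru x\<close> under the sum, though not term by term.\<close>
  also have "\<dots> = (\<Sum>x\<le>M. 4 * (2 * (tru x - sqrt (mix x \<theta>) * sqrt (tru x))))"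
    using sum_mix[of \<theta>] sum_tru
    by (simp add: sum_distrib_left[symmetric] sum.distrib sum_subtractf)
  also have "\<dots> \<le> (\<Sum>x\<le>M. 4 * (tru x * ln (tru x / mix x \<theta>)))"
    using s by (intro sum_mono mult_left_mono) auto
  finally show ?thesis by (simp add: KL_def sum_distrib_left)
qed

lemma KL_nonneg: "\<theta> \<in> params \<Longrightarrow> 0 \<le> KL \<theta>"
  using KL_lower[of \<theta>] sum_nonneg[of "{..M}" "\<lambda>x. (mix x \<theta> - tru x)\<^sup>2"] by simp

lemma mix_tru_diff_le:
  assumes "\<theta> \<in> params" "x \<le> M"
  shows "\<bar>mix x \<theta> - tru x\<bar> \<le> 2 * sqrt (KL \<theta>)"
proof -
  have "(mix x \<theta> - tru x)\<^sup>2 \<le> (\<Sum>x\<le>M. (mix x \<theta> - tru x)\<^sup>2)"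
    using assms(2) by (intro member_le_sum) auto
  also have "\<dots> \<le> 4 * KL \<theta>" by (rule KL_lower[OF assms(1)])
  finally have "sqrt ((mix x \<theta> - tru x)\<^sup>2) \<le> sqrt (4 * KL \<theta>)" by (rule real_sqrt_le_mono)
  then show ?thesis by (simp add: real_sqrt_mult)
qed

text \<open>The first moment is bounded with \<open>2 (M + 1)\<close>. The second comes from
  \<open>m2 + 2 * \<theta>\<^sub>0 * m1\<close> by removing a term of size at most
  \<open>4 (M + 1)\<close>, since \<open>\<theta>\<^sub>0 < 1\<close>; in total 6.\<close>

definition c0 :: real where "c0 = 6 * (real M + 1)"

lemma c0_pos: "c0 > 0" by (simp add: c0_def)

text \<open>Up to factors nonzero for \<open>M \<ge> 2\<close>, both \<open>m1\<close> and
  \<open>m2 + 2 * \<theta>\<^sub>0 * m1\<close> are linear functionals of \<open>p - q\<close>, each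
  of whose entries is at most twice the root of the divergence.\<close>

lemma moments_le:
  assumes \<theta>: "\<theta> \<in> params"
  shows "\<bar>m1 \<theta>\<bar> \<le> c0 * sqrt (KL \<theta>)" "m2 \<theta> \<le> c0 * sqrt (KL \<theta>)"
proof -
  let ?s = "sqrt (KL \<theta>)"
  have s0: "?s \<ge> 0" using KL_nonneg[OF \<theta>] by simp
  have gen: "\<bar>\<Sum>x\<le>M. c x * (mix x \<theta> - tru x)\<bar> \<le> (real M + 1) * (B * (2 * ?s))"
    if "\<And>x. x \<le> M \<Longrightarrow> \<bar>c x\<bar> \<le> B" for c B
  proof -
    have "\<bar>\<Sum>x\<le>M. c x * (mix x \<theta> - tru x)\<bar> \<le> (\<Sum>x\<le>M. \<bar>c x * (mix x \<theta> - tru x)\<bar>)" by (rule sum_abs)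
    also have "\<dots> \<le> (\<Sum>x\<le>M. B * (2 * ?s))"
      unfolding abs_mult using mix_tru_diff_le[OF \<theta>] that
      by (intro sum_mono mult_mono) (auto intro: order_trans[OF abs_ge_zero])
    finally show ?thesis by (simp add: add.commute)
  qed
  have Mp: "real M > 0" "real M - 1 > 0" using M2 by auto
  have "\<bar>real M * m1 \<theta>\<bar> \<le> (real M + 1) * (real M * (2 * ?s))"
    using gen[of "\<lambda>x. real x" "real M"] by (simp add: first_moment)
  then have "real M * \<bar>m1 \<theta>\<bar> \<le> real M * (2 * (real M + 1) * ?s)" by (simp only: abs_mult abs_of_nat mult_ac)
  then have a: "\<bar>m1 \<theta>\<bar> \<le> 2 * (real M + 1) * ?s" using Mp by (simp only: mult_le_cancel_left_pos)
  have s1: "(real M + 1) * ?s \<ge> 0" using s0 by simp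
  show "\<bar>m1 \<theta>\<bar> \<le> c0 * ?s"
    using a s1 unfolding c0_def by (simp only: mult.assoc)
  have "\<bar>real x * (real x - 1)\<bar> \<le> real M * (real M - 1)" if "x \<le> M" for x
  proof (cases x)
    case (Suc y)
    then show ?thesis using that by (auto simp: abs_mult intro!: mult_mono)
  qed (use Mp in auto)
  then have "\<bar>real M * (real M - 1) * (m2 \<theta> + 2 * \<theta>\<^sub>0 * m1 \<theta>)\<bar> \<le> (real M + 1) * (real M * (real M - 1) * (2 * ?s))"
    using gen[of "\<lambda>x. real x * (real x - 1)" "real M * (real M - 1)"] by (simp only: second_moment)
  then have "(real M * (real M - 1)) * \<bar>m2 \<theta> + 2 * \<theta>\<^sub>0 * m1 \<theta>\<bar> \<le> (real M * (real M - 1)) * (2 * ((real M + 1) * ?s))"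
    using Mp by (simp add: abs_mult mult_ac)
  then have b: "\<bar>m2 \<theta> + 2 * \<theta>\<^sub>0 * m1 \<theta>\<bar> \<le> 2 * ((real M + 1) * ?s)"
    using Mp by (simp only: mult_le_cancel_left_pos mult_pos_pos)
  have "\<bar>2 * \<theta>\<^sub>0 * m1 \<theta>\<bar> \<le> 2 * 1 * (2 * (real M + 1) * ?s)"
    unfolding abs_mult using th a by (intro mult_mono) auto
  then show "m2 \<theta> \<le> c0 * ?s"
    using b s1 unfolding c0_def by (simp only: mult.assoc)
qed

lemma base_in_params: "base \<in> params"
  using th by (simp add: base_def params_def)

lemma KL_eq_0_iff:
  assumes "\<theta> \<in> params"
  shows "KL \<theta> = 0 \<longleftrightarrow> \<theta> = base"
proof
  assume "KL \<theta> = 0"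
  then have "m2 \<theta> \<le> 0" using moments_le(2)[OF assms] by simp
  then have "wt i * (\<theta> $ i - \<theta>\<^sub>0)\<^sup>2 \<le> 0" for i using m2_ge[of i \<theta>] by linarith
  then have "\<theta> $ i = \<theta>\<^sub>0" for i
    using mult_pos_pos[OF wt_pos[of i], of "(\<theta> $ i - \<theta>\<^sub>0)\<^sup>2"]
    by (metis eq_iff_diff_eq_0 not_less zero_less_power2)
  then show "\<theta> = base" by (simp add: base_def vec_eq_iff)
next
  assume "\<theta> = base"
  then have "mix x \<theta> = tru x" for x
    by (simp add: mix_def tru_def base_def sum_distrib_right[symmetric] sum_wt)
  moreover have "tru x \<noteq> 0" if "x \<le> M" for x using tru_pos[OF that] by simp
  ultimately show "KL \<theta> = 0" by (simp add: KL_def)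
qed

lemma open_params: "open params"
proof -
  have "params = box (\<chi> i. 0) (\<chi> i. 1)" by (auto simp: params_def mem_box_cart)
  then show ?thesis by (metis open_box)
qed

section \<open>Taylor expansion of the model in the displacements\<close>

definition bpoly :: "nat \<Rightarrow> real poly" where
  "bpoly x = smult (real (M choose x)) ([:\<theta>\<^sub>0, 1:] ^ x * [:1 - \<theta>\<^sub>0, -1:] ^ (M - x))"

text \<open>Synthetic division at 0 strips one Taylor term at a time: \<open>tay1\<close> is the
  first coefficient, \<open>tay2\<close> the quotient of the remainder by the squared displacement.
  The value of \<open>tay2\<close> at 0 is thus the second coefficient.\<close>

definition tay1 :: "nat \<Rightarrow> real" where "tay1 x = poly (synthetic_div (bpoly x) 0) 0"
definition tay2 :: "nat \<Rightarrow> real poly" where "tay2 x = synthetic_div (synthetic_div (bpoly x) 0) 0"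

lemma Bernstein_taylor: "Bernstein M x (\<theta>\<^sub>0 + b) = tru x + tay1 x * b + b\<^sup>2 * poly (tay2 x) b"
proof -
  have e: "Bernstein M x (\<theta>\<^sub>0 + c) = poly (bpoly x) c" for c
    by (simp add: bpoly_def Bernstein_def poly_power algebra_simps)
  have sd: "poly p c = poly p 0 + c * poly (synthetic_div p 0) c" for p and c :: real
    using arg_cong[OF synthetic_div_correct[of p 0], of "\<lambda>p. poly p c"] by simp
  have "poly (bpoly x) b = poly (bpoly x) 0 + b * (tay1 x + b * poly (tay2 x) b)"
    unfolding tay1_def tay2_def using sd[of "bpoly x" b] sd[of "synthetic_div (bpoly x) 0" b] by simp
  moreover have "poly (bpoly x) 0 = tru x" using e[of 0] by (simp add: tru_def)
  ultimately show ?thesis unfolding e by (simp add: algebra_simps power2_eq_square)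
qed

lemma mix_expansion:
  "mix x \<theta> - tru x = tay1 x * m1 \<theta> + (\<Sum>i\<in>UNIV. wt i * ((\<theta> $ i - \<theta>\<^sub>0)\<^sup>2 * poly (tay2 x) (\<theta> $ i - \<theta>\<^sub>0)))"
proof -
  have "mix x \<theta> = (\<Sum>i\<in>UNIV. wt i * (tru x + tay1 x * (\<theta> $ i - \<theta>\<^sub>0) + (\<theta> $ i - \<theta>\<^sub>0)\<^sup>2 * poly (tay2 x) (\<theta> $ i - \<theta>\<^sub>0)))"
    unfolding mix_def using Bernstein_taylor[of x "\<theta> $ i - \<theta>\<^sub>0" for i] by simp
  also have "\<dots> = (\<Sum>i\<in>UNIV. wt i) * tru x + tay1 x * m1 \<theta> + (\<Sum>i\<in>UNIV. wt i * ((\<theta> $ i - \<theta>\<^sub>0)\<^sup>2 * poly (tay2 x) (\<theta> $ i - \<theta>\<^sub>0)))"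
    unfolding m1_def sum_distrib_left sum_distrib_right sum.distrib[symmetric]
    by (intro sum.cong refl) (simp add: algebra_simps)
  finally show ?thesis by (simp add: sum_wt)
qed

text \<open>Summing the Taylor formula against \<open>c\<close> gives a polynomial identity in the
  displacement, and coefficients can be compared. The factorial moments serve as \<open>c\<close>
  below: they separate the vectors \<open>tay1\<close> and \<open>poly (tay2 x) 0\<close>.\<close>

lemma taylor_functional:
  assumes "\<And>t. (\<Sum>x\<le>M. c x * Bernstein M x t) = poly [:c\<^sub>0, c\<^sub>1, c\<^sub>2:] (t - \<theta>\<^sub>0)"
  shows "(\<Sum>x\<le>M. c x * tay1 x) = c\<^sub>1" "(\<Sum>x\<le>M. c x * poly (tay2 x) 0) = c\<^sub>2"
proof -
  let ?P = "pCons (\<Sum>x\<le>M. c x * tru x) (pCons (\<Sum>x\<le>M. c x * tay1 x) (\<Sum>x\<le>M. smult (c x) (tay2 x)))"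
  have "poly ?P b = poly [:c\<^sub>0, c\<^sub>1, c\<^sub>2:] b" for b
  proof -
    have "poly ?P b = (\<Sum>x\<le>M. c x * Bernstein M x (\<theta>\<^sub>0 + b))"
      unfolding Bernstein_taylor
      by (simp add: poly_sum sum_distrib_left sum_distrib_right sum.distrib algebra_simps power2_eq_square)
    then show ?thesis using assms[of "\<theta>\<^sub>0 + b"] by simp
  qed
  then have eq: "?P = [:c\<^sub>0, c\<^sub>1, c\<^sub>2:]" by (intro poly_eq_poly_eq_iff[THEN iffD1] ext)
  then show "(\<Sum>x\<le>M. c x * tay1 x) = c\<^sub>1" by simp
  have "(\<Sum>x\<le>M. smult (c x) (tay2 x)) = [:c\<^sub>2:]" using eq by simp
  then have "poly (\<Sum>x\<le>M. smult (c x) (tay2 x)) 0 = c\<^sub>2" by simp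
  then show "(\<Sum>x\<le>M. c x * poly (tay2 x) 0) = c\<^sub>2" by (simp add: poly_sum)
qed

lemma taylor_first: "(\<Sum>x\<le>M. real x * tay1 x) = real M" "(\<Sum>x\<le>M. real x * poly (tay2 x) 0) = 0"
  by (rule taylor_functional[of real "real M * \<theta>\<^sub>0" "real M" 0]; simp add: sum_k_Bernstein algebra_simps)+

lemma taylor_second: "(\<Sum>x\<le>M. real x * (real x - 1) * poly (tay2 x) 0) = real M * (real M - 1)"
  by (rule taylor_functional(2)[of "\<lambda>x. real x * (real x - 1)" "real M * (real M - 1) * \<theta>\<^sub>0\<^sup>2" "real M * (real M - 1) * 2 * \<theta>\<^sub>0"])
     (unfold sum_kk_Bernstein, simp add: algebra_simps power2_eq_square)

text \<open>The shape of \<open>K\<close> in the coordinates of a chart: if the first moment is \<open>E e\<^sub>1\<close> and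
  the displacements are \<open>\<sigma> B\<^sub>i\<close> with \<open>\<sigma>\<^sup>2 = E e\<^sub>2\<close>, then \<open>E\<close> divides \<open>p - q\<close>.\<close>

definition quot :: "nat \<Rightarrow> real \<Rightarrow> real \<Rightarrow> real \<Rightarrow> ('n \<Rightarrow> real) \<Rightarrow> real" where
  "quot x e1 e2 \<sigma> B = tay1 x * e1 + e2 * (\<Sum>i\<in>UNIV. wt i * ((B i)\<^sup>2 * poly (tay2 x) (\<sigma> * B i)))"

lemma mix_tru_quot:
  assumes "m1 \<theta> = E * e1" "\<sigma>\<^sup>2 = E * e2" "\<And>i. \<theta> $ i - \<theta>\<^sub>0 = \<sigma> * B i"
  shows "mix x \<theta> - tru x = E * quot x e1 e2 \<sigma> B"
proof -
  have h: "wt i * ((\<theta> $ i - \<theta>\<^sub>0)\<^sup>2 * poly (tay2 x) (\<theta> $ i - \<theta>\<^sub>0)) = (E * e2) * (wt i * ((B i)\<^sup>2 * poly (tay2 x) (\<sigma> * B i)))" for i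
    unfolding assms(3) power_mult_distrib assms(2) by (simp add: mult_ac)
  show ?thesis
    unfolding mix_expansion quot_def assms(1) h sum_distrib_left[symmetric] by (simp add: algebra_simps)
qed

text \<open>At \<open>\<sigma> = 0\<close> the quotient is \<open>e1\<close> times the vector
  \<open>tay1\<close> plus \<open>e2 * S\<close> times the vector of second Taylor coefficients,
  with \<open>S > 0\<close>. The first factorial moment annihilates the second vector but not the
  first one, and for \<open>M \<ge> 2\<close> the second factorial moment does not annihilate the
  second vector.\<close>

lemma quot_nonzero:
  assumes "\<And>x. x \<le> M \<Longrightarrow> quot x e1 e2 0 B = 0" and "B i \<noteq> 0"
  shows "e1 = 0 \<and> e2 = 0"
proof -
  define S where "S = (\<Sum>i\<in>UNIV. wt i * (B i)\<^sup>2)"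
  have "0 < wt i * (B i)\<^sup>2" using wt_pos assms(2) by simp
  also have "\<dots> \<le> S" unfolding S_def using wt_pos by (intro member_le_sum) (auto simp: less_imp_le)
  finally have "S > 0" .
  have q: "quot x e1 e2 0 B = tay1 x * e1 + e2 * S * poly (tay2 x) 0" for x
    by (simp add: quot_def S_def sum_distrib_left sum_distrib_right mult_ac)
  have gen: "e1 * (\<Sum>x\<le>M. c x * tay1 x) + e2 * S * (\<Sum>x\<le>M. c x * poly (tay2 x) 0) = 0" for c
  proof -
    have "(\<Sum>x\<le>M. c x * quot x e1 e2 0 B) = 0" using assms(1) by simp
    then show ?thesis unfolding q by (simp add: sum_distrib_left distrib_left sum.distrib mult_ac)
  qed
  have Mp: "real M > 0" "real M - 1 > 0" using M2 by auto
  have "e1 * real M = 0" using gen[of real] by (simp add: taylor_first)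
  then have "e1 = 0" using Mp by simp
  then have "e2 * S * (real M * (real M - 1)) = 0"
    using gen[of "\<lambda>x. real x * (real x - 1)"] by (simp only: taylor_second)
  then show ?thesis using Mp \<open>S > 0\<close> \<open>e1 = 0\<close> by auto
qed

subsection \<open>Volume of the sublevel sets\<close>

text \<open>Apply \<open>ln s \<le> s - 1\<close> to \<open>q/p\<close>; what exceeds the chi-square
  term is \<open>q - p\<close>, which sums to 0.\<close>

lemma KL_le_chi_square:
  assumes \<theta>: "\<theta> \<in> params"
  shows "KL \<theta> \<le> (\<Sum>x\<le>M. (mix x \<theta> - tru x)\<^sup>2 / mix x \<theta>)"
proof -
  have "tru x * ln (tru x / mix x \<theta>) \<le> (mix x \<theta> - tru x)\<^sup>2 / mix x \<theta> + (tru x - mix x \<theta>)" if x: "x \<le> M" for x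
  proof -
    note pos = mix_pos[OF \<theta> x] tru_pos[OF x]
    have "tru x * ln (tru x / mix x \<theta>) \<le> tru x * (tru x / mix x \<theta> - 1)"
      using pos by (intro mult_left_mono ln_le_minus_one) auto
    also have "\<dots> = (mix x \<theta> - tru x)\<^sup>2 / mix x \<theta> + (tru x - mix x \<theta>)"
      using pos by (simp add: field_simps power2_eq_square)
    finally show ?thesis .
  qed
  then have "KL \<theta> \<le> (\<Sum>x\<le>M. (mix x \<theta> - tru x)\<^sup>2 / mix x \<theta> + (tru x - mix x \<theta>))"
    unfolding KL_def by (intro sum_mono) auto
  then show ?thesis by (simp add: sum.distrib sum_subtractf sum_tru sum_mix)
qed

lemma KL_upper:
  "\<exists>r>0. \<exists>D>0. \<forall>\<theta>. (\<forall>i. \<bar>\<theta> $ i - \<theta>\<^sub>0\<bar> \<le> r) \<longrightarrow> \<theta> \<in> params \<and> KL \<theta> \<le> D * (\<bar>m1 \<theta>\<bar> + m2 \<theta>)\<^sup>2"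
proof -
  \<comment> \<open>Half the distance of \<open>\<theta>\<^sub>0\<close> to 0 and 1: then all
    parameters lie between \<open>r\<close> and \<open>1 - r\<close>, and every binomial probability
    is at least \<open>r ^ M\<close>.\<close>
  define r where "r = min \<theta>\<^sub>0 (1 - \<theta>\<^sub>0) / 2"
  have r: "r > 0" "r \<le> \<theta>\<^sub>0 / 2" "r \<le> (1 - \<theta>\<^sub>0) / 2" "r \<le> 1" using th by (auto simp: r_def)
  have "\<exists>m>0. \<forall>b. norm b \<le> 1 \<longrightarrow> norm (poly (tay2 x) b) \<le> m" for x
    by (rule poly_bound_exists)
  then obtain m where m: "\<And>x. m x > 0" "\<And>x b. \<bar>b\<bar> \<le> 1 \<Longrightarrow> \<bar>poly (tay2 x) b\<bar> \<le> m x"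
    unfolding real_norm_def by metis
  define A where "A = (\<Sum>x\<le>M. \<bar>tay1 x\<bar> + m x)"
  have A: "\<bar>tay1 x\<bar> + m x \<le> A" if "x \<le> M" for x
    unfolding A_def using that m(1) by (intro member_le_sum) (auto simp: less_imp_le)
  \<comment> \<open>There are \<open>M + 1\<close> chi-square terms, each with numerator at most the
    square of \<open>A * (\<bar>m1 \<theta>\<bar> + m2 \<theta>)\<close> and denominator at least
    \<open>r ^ M\<close>.\<close>
  define D where "D = (real M + 1) * (A\<^sup>2 / r ^ M)"
  have "A > 0" using A[of 0] m(1)[of 0] by linarith
  then have "D > 0" using r(1) by (simp add: D_def)
  have "\<theta> \<in> params \<and> KL \<theta> \<le> D * (\<bar>m1 \<theta>\<bar> + m2 \<theta>)\<^sup>2" if \<theta>: "\<forall>i. \<bar>\<theta> $ i - \<theta>\<^sub>0\<bar> \<le> r" for \<theta>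
  proof
    have bd: "r \<le> \<theta> $ i \<and> \<theta> $ i \<le> 1 - r" for i using \<theta>[rule_format, of i] r by (auto simp: abs_le_iff)
    show pa: "\<theta> \<in> params" unfolding params_def using bd r(1) by (smt (verit) mem_Collect_eq)
    have mixge: "r ^ M \<le> mix x \<theta>" if x: "x \<le> M" for x
    proof -
      have "r ^ M \<le> Bernstein M x (\<theta> $ i)" for i
      proof -
        have "r ^ M = 1 * (r ^ x * r ^ (M - x))" using x by (simp add: power_add[symmetric])
        also have "\<dots> \<le> real (M choose x) * ((\<theta> $ i) ^ x * (1 - \<theta> $ i) ^ (M - x))"
        proof (intro mult_mono power_mono)
          show "1 \<le> real (M choose x)" using zero_less_binomial[OF x] by linarith
        qed (use bd[of i] r(1) in auto)
        finally show ?thesis by (simp add: Bernstein_def mult.assoc)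
      qed
      then have "(\<Sum>i\<in>UNIV. wt i * r ^ M) \<le> mix x \<theta>"
        unfolding mix_def using wt_pos by (intro sum_mono mult_left_mono) (auto simp: less_imp_le)
      then show ?thesis by (simp add: sum_distrib_right[symmetric] sum_wt)
    qed
    let ?s = "\<bar>m1 \<theta>\<bar> + m2 \<theta>"
    have s0: "0 \<le> ?s" using m2_nonneg[of \<theta>] by simp
    have diff: "\<bar>mix x \<theta> - tru x\<bar> \<le> A * ?s" if x: "x \<le> M" for x
    proof -
      have "\<bar>\<Sum>i\<in>UNIV. wt i * ((\<theta> $ i - \<theta>\<^sub>0)\<^sup>2 * poly (tay2 x) (\<theta> $ i - \<theta>\<^sub>0))\<bar>
          \<le> (\<Sum>i\<in>UNIV. \<bar>wt i * ((\<theta> $ i - \<theta>\<^sub>0)\<^sup>2 * poly (tay2 x) (\<theta> $ i - \<theta>\<^sub>0))\<bar>)"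
        by (rule sum_abs)
      also have "\<dots> \<le> (\<Sum>i\<in>UNIV. wt i * ((\<theta> $ i - \<theta>\<^sub>0)\<^sup>2 * m x))"
      proof (rule sum_mono)
        fix i
        have "\<bar>\<theta> $ i - \<theta>\<^sub>0\<bar> \<le> 1" using \<theta>[rule_format, of i] r(4) by linarith
        from m(2)[OF this, of x] show "\<bar>wt i * ((\<theta> $ i - \<theta>\<^sub>0)\<^sup>2 * poly (tay2 x) (\<theta> $ i - \<theta>\<^sub>0))\<bar> \<le> wt i * ((\<theta> $ i - \<theta>\<^sub>0)\<^sup>2 * m x)"
          using wt_pos[of i] by (simp add: abs_mult mult_left_mono)
      qed
      also have "\<dots> = m2 \<theta> * m x" by (simp add: m2_def sum_distrib_right mult.assoc)
      finally have "\<bar>mix x \<theta> - tru x\<bar> \<le> \<bar>tay1 x\<bar> * \<bar>m1 \<theta>\<bar> + m x * m2 \<theta>"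
        unfolding mix_expansion by (simp add: abs_mult mult.commute order_trans[OF abs_triangle_ineq])
      also have "\<dots> \<le> (\<bar>tay1 x\<bar> + m x) * ?s"
        using m(1)[of x] m2_nonneg[of \<theta>] by (simp add: algebra_simps add_increasing2 add_increasing)
      also have "\<dots> \<le> A * ?s" using A[OF x] s0 by (rule mult_right_mono)
      finally show ?thesis .
    qed
    have "(mix x \<theta> - tru x)\<^sup>2 / mix x \<theta> \<le> (A * ?s)\<^sup>2 / r ^ M" if x: "x \<le> M" for x
    proof -
      have "(mix x \<theta> - tru x)\<^sup>2 \<le> (A * ?s)\<^sup>2"
        using power_mono[OF diff[OF x] abs_ge_zero, of 2] by simp
      then show ?thesis using mixge[OF x] r(1) by (intro frac_le) auto
    qed
    then have "(\<Sum>x\<le>M. (mix x \<theta> - tru x)\<^sup>2 / mix x \<theta>) \<le> (\<Sum>x\<le>M. (A * ?s)\<^sup>2 / r ^ M)"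
      by (intro sum_mono) auto
    also have "\<dots> = D * ?s\<^sup>2" by (simp add: D_def power_mult_distrib)
    finally show "KL \<theta> \<le> D * ?s\<^sup>2" using KL_le_chi_square[OF pa] by linarith
  qed
  then show ?thesis using r(1) \<open>D > 0\<close> by blast
qed

text \<open>Linear coordinates of the parameter space in which the last coordinate is the first moment.\<close>

definition lin :: "real ^ 'n \<Rightarrow> real ^ 'n" where
  "lin x = (\<chi> i. if i = z then (x $ z - (\<Sum>j\<in>UNIV - {z}. wt j * x $ j)) / wt z else x $ i)"

definition unlin :: "real ^ 'n \<Rightarrow> real ^ 'n" where
  "unlin b = (\<chi> i. if i = z then (\<Sum>j\<in>UNIV. wt j * b $ j) else b $ i)"

definition coord :: "real ^ 'n \<Rightarrow> real ^ 'n" where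
  "coord x = base + lin x"

lemma lin_unlin: "lin (unlin b) = b"
  using wt_pos[of z] by (simp add: lin_def unlin_def vec_eq_iff sum.remove[of UNIV z])

lemma unlin_lin: "unlin (lin x) = x"
  using wt_pos[of z] by (simp add: lin_def unlin_def vec_eq_iff sum.remove[of UNIV z])

lemma linear_lin: "linear lin"
  unfolding lin_def
  by (rule linearI) (auto simp: vec_eq_iff sum.distrib sum_distrib_left algebra_simps add_divide_distrib diff_divide_distrib)

lemma linear_unlin: "linear unlin"
  unfolding unlin_def
  by (rule linearI) (auto simp: vec_eq_iff sum.distrib sum_distrib_left algebra_simps)

lemma bij_coord: "coord (unlin (\<theta> - base)) = \<theta>" "unlin (coord x - base) = x"
  by (simp_all add: coord_def lin_unlin unlin_lin)

lemma coord_component: "coord x $ i - \<theta>\<^sub>0 = lin x $ i"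
  by (simp add: coord_def base_def)

lemma m1_coord: "m1 (coord x) = x $ z"
  using arg_cong[OF unlin_lin[of x], of "\<lambda>v. v $ z"]
  by (simp add: m1_def coord_component unlin_def)

lemma det_lin: "det (matrix lin) \<noteq> 0"
proof -
  have "inj lin" by (metis injI unlin_lin)
  then show ?thesis using det_nz_iff_inj[OF linear_lin] by blast
qed

lemma coord_has_derivative: "(coord has_derivative lin) (at x within S)"
  unfolding coord_def[abs_def]
  using has_derivative_add[OF has_derivative_const linear_imp_has_derivative[OF linear_lin]] by simp

text \<open>The first moment scales like the square of the displacements, so its side has weight 2.
  With \<open>t = s ^ 4\<close> these are the sides of the sublevel set at \<open>t\<close>.\<close>

definition weighted_box :: "real \<Rightarrow> real \<Rightarrow> (real ^ 'n) set" where
  "weighted_box c s = {x. \<bar>x $ z\<bar> \<le> c * s\<^sup>2 \<and> (\<forall>i. i \<noteq> z \<longrightarrow> \<bar>x $ i\<bar> \<le> c * s)}"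

lemma weighted_box_volume:
  assumes "c > 0" "s > 0"
  shows "coord ` weighted_box c s \<in> sets borel"
    and "emeasure lborel (coord ` weighted_box c s)
       = ennreal (\<bar>det (matrix lin)\<bar> * (2 * c) ^ CARD('n) * s ^ (CARD('n) + 1))"
proof -
  let ?u = "\<chi> i. if i = z then c * s\<^sup>2 else c * s"
  have eq: "weighted_box c s = cbox (- ?u) ?u"
  proof (rule set_eqI)
    fix x
    have "x \<in> cbox (- ?u) ?u \<longleftrightarrow> (\<forall>i. \<bar>x $ i\<bar> \<le> (if i = z then c * s\<^sup>2 else c * s))"
      unfolding mem_box_cart by (intro all_cong1) (simp add: abs_le_iff, linarith)
    also have "\<dots> \<longleftrightarrow> x \<in> weighted_box c s" by (simp add: weighted_box_def if_split all_conj_distrib)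
    finally show "x \<in> weighted_box c s \<longleftrightarrow> x \<in> cbox (- ?u) ?u" ..
  qed
  have "continuous_on (cbox (- ?u) ?u) coord"
    by (intro continuous_at_imp_continuous_on ballI has_derivative_continuous[OF coord_has_derivative])
  then have "compact (coord ` cbox (- ?u) ?u)" by (intro compact_continuous_image compact_cbox)
  then show "coord ` weighted_box c s \<in> sets borel"
    by (simp add: eq compact_imp_closed borel_closed)
  have inj: "inj_on coord (cbox (- ?u) ?u)" by (metis bij_coord(2) inj_onI)
  have off: "(\<Prod>i\<in>UNIV - {z}. ?u $ i - (- ?u) $ i) = (\<Prod>i\<in>UNIV - {z}. 2 * c * s)"
    by (rule prod.cong) auto
  have "(\<Prod>i\<in>UNIV. ?u $ i - (- ?u) $ i) = (?u $ z - (- ?u) $ z) * (\<Prod>i\<in>UNIV - {z}. ?u $ i - (- ?u) $ i)"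
    by (rule prod.remove) auto
  also have "\<dots> = (2 * c * s\<^sup>2) * (\<Prod>i\<in>UNIV - {z}. 2 * c * s)"
    unfolding off by simp
  also have "(\<Prod>i\<in>UNIV - {z}. 2 * c * s) = (2 * c * s) ^ (CARD('n) - 1)"
    by simp
  also have "(2 * c * s\<^sup>2) * (2 * c * s) ^ (CARD('n) - 1) = s * ((2 * c * s) * (2 * c * s) ^ (CARD('n) - 1))"
    by (simp add: power2_eq_square)
  also have "(2 * c * s) * (2 * c * s) ^ (CARD('n) - 1) = (2 * c * s) ^ CARD('n)"
    by (simp add: power_Suc[symmetric] del: power_Suc)
  finally have vol: "(\<Prod>i\<in>UNIV. ?u $ i - (- ?u) $ i) = (2 * c) ^ CARD('n) * s ^ (CARD('n) + 1)"
    by (simp add: power_mult_distrib mult_ac)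
  have "emeasure lborel (coord ` cbox (- ?u) ?u) = (\<integral>\<^sup>+x\<in>cbox (- ?u) ?u. ennreal \<bar>det (matrix lin)\<bar> \<partial>lborel)"
    by (rule emeasure_compact_image(2)[OF compact_cbox coord_has_derivative _ _ inj]) auto
  also have "\<dots> = ennreal \<bar>det (matrix lin)\<bar> * emeasure lborel (cbox (- ?u) ?u)"
    by (simp add: nn_integral_cmult_indicator)
  also have "emeasure lborel (cbox (- ?u) ?u) = ennreal ((2 * c) ^ CARD('n) * s ^ (CARD('n) + 1))"
    unfolding vol[symmetric] using assms by (intro emeasure_lborel_cbox_cart) auto
  finally show "emeasure lborel (coord ` weighted_box c s)
       = ennreal (\<bar>det (matrix lin)\<bar> * (2 * c) ^ CARD('n) * s ^ (CARD('n) + 1))"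
    unfolding eq by (simp add: ennreal_mult'[symmetric] mult.assoc)
qed

definition lam :: real where "lam = (real CARD('n) + 1) / 4"

lemma quarter_powr:
  assumes "t > 0"
  shows "(t powr (1/4)) ^ (CARD('n) + 1) = t powr lam" "(t powr (1/4))\<^sup>2 = sqrt t" "(t powr (1/4)) ^ 4 = t"
proof -
  have p: "(t powr (1/4)) ^ n = t powr (real n / 4)" for n
    using assms by (simp add: powr_realpow[symmetric] powr_powr)
  show "(t powr (1/4)) ^ (CARD('n) + 1) = t powr lam" unfolding p by (simp add: lam_def add.commute)
  show "(t powr (1/4))\<^sup>2 = sqrt t" unfolding p using assms by (simp add: powr_half_sqrt)
  show "(t powr (1/4)) ^ 4 = t" unfolding p using assms by simp
qed

lemma sublevel_upper:
  "\<exists>C. \<forall>t>0. \<exists>B\<in>sets borel. {\<theta>\<in>params. KL \<theta> \<le> t} \<subseteq> B \<and> emeasure lborel B \<le> ennreal (C * t powr lam)"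
proof -
  \<comment> \<open>\<open>c1\<close> has to exceed \<open>c0\<close> for the moment side, and its
    square has to exceed every \<open>c0 / wt i\<close> for the others, because \<open>m2\<close>
    controls \<open>wt i\<close> times a squared displacement. The summand 1 gives
    \<open>c1 \<le> c1\<^sup>2\<close>.\<close>
  define c1 where "c1 = c0 + 1 + (\<Sum>i\<in>UNIV. c0 / wt i)"
  have sum_ge: "c0 / wt i \<le> (\<Sum>i\<in>UNIV. c0 / wt i)" for i
    using c0_pos wt_pos by (intro member_le_sum) (auto simp: less_imp_le)
  have sum0: "0 \<le> (\<Sum>i\<in>UNIV. c0 / wt i)" using c0_pos wt_pos by (intro sum_nonneg) (simp add: less_imp_le)
  have c1: "c1 > 0" "c0 \<le> c1" "c0 / wt i \<le> c1\<^sup>2" for i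
  proof -
    show "c1 > 0" "c0 \<le> c1" using c0_pos sum0 by (simp_all add: c1_def)
    have "c0 / wt i \<le> c1" using sum_ge[of i] c0_pos by (simp add: c1_def)
    also have "c1 \<le> c1\<^sup>2" using c0_pos sum0 by (simp add: c1_def power2_eq_square)
    finally show "c0 / wt i \<le> c1\<^sup>2" .
  qed
  have "\<exists>B\<in>sets borel. {\<theta>\<in>params. KL \<theta> \<le> t} \<subseteq> B \<and>
      emeasure lborel B \<le> ennreal ((\<bar>det (matrix lin)\<bar> * (2 * c1) ^ CARD('n)) * t powr lam)" if t: "t > 0" for t
  proof -
    define s where "s = t powr (1/4)"
    have s: "s > 0" "s\<^sup>2 = sqrt t" using t quarter_powr(2)[OF t] by (simp_all add: s_def)
    have "{\<theta>\<in>params. KL \<theta> \<le> t} \<subseteq> coord ` weighted_box c1 s"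
    proof safe
      fix \<theta> assume \<theta>: "\<theta> \<in> params" "KL \<theta> \<le> t"
      define x where "x = unlin (\<theta> - base)"
      have cx: "coord x = \<theta>" by (simp add: x_def bij_coord)
      have sq: "c0 * sqrt (KL \<theta>) \<le> c0 * s\<^sup>2" using \<theta>(2) c0_pos s(2) by simp
      have "x \<in> weighted_box c1 s" unfolding weighted_box_def
      proof (intro CollectI conjI allI impI)
        have "\<bar>x $ z\<bar> \<le> c0 * s\<^sup>2" using moments_le(1)[OF \<theta>(1)] sq m1_coord[of x] cx by simp
        also have "\<dots> \<le> c1 * s\<^sup>2" using c1(2) by (rule mult_right_mono) simp
        finally show "\<bar>x $ z\<bar> \<le> c1 * s\<^sup>2" .
        fix i assume "i \<noteq> z"
        then have xi: "\<theta> $ i - \<theta>\<^sub>0 = x $ i" using coord_component[of x i] cx by (simp add: lin_def)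
        have "wt i * (x $ i)\<^sup>2 \<le> c0 * s\<^sup>2"
          using m2_ge[of i \<theta>] moments_le(2)[OF \<theta>(1)] sq unfolding xi by linarith
        then have "(x $ i)\<^sup>2 \<le> c0 / wt i * s\<^sup>2" using wt_pos[of i] by (simp add: field_simps)
        also have "\<dots> \<le> c1\<^sup>2 * s\<^sup>2" using c1(3) by (rule mult_right_mono) simp
        finally have "(x $ i)\<^sup>2 \<le> (c1 * s)\<^sup>2" by (simp add: power_mult_distrib)
        then show "\<bar>x $ i\<bar> \<le> c1 * s" using c1(1) s(1) by (simp add: abs_le_square_iff[symmetric])
      qed
      then show "\<theta> \<in> coord ` weighted_box c1 s" using cx by blast
    qed
    moreover have "emeasure lborel (coord ` weighted_box c1 s)
        = ennreal ((\<bar>det (matrix lin)\<bar> * (2 * c1) ^ CARD('n)) * t powr lam)"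
      unfolding weighted_box_volume(2)[OF c1(1) s(1)] by (simp only: s_def quarter_powr(1)[OF t])
    ultimately show ?thesis using weighted_box_volume(1)[OF c1(1) s(1)] by (intro bexI conjI) auto
  qed
  then show ?thesis by blast
qed

lemma sublevel_lower:
  assumes "R > 0"
  shows "\<exists>c>0. \<exists>t\<^sub>0>0. \<forall>t. 0 < t \<and> t < t\<^sub>0 \<longrightarrow>
     (\<exists>B\<in>sets borel. B \<subseteq> {\<theta>\<in>ball base R. KL \<theta> \<le> t} \<and> ennreal (c * t powr lam) \<le> emeasure lborel B)"
proof -
  obtain r D where rD: "r > 0" "D > 0" and
    up: "\<And>\<theta>. \<forall>i. \<bar>\<theta> $ i - \<theta>\<^sub>0\<bar> \<le> r \<Longrightarrow> \<theta> \<in> params \<and> KL \<theta> \<le> D * (\<bar>m1 \<theta>\<bar> + m2 \<theta>)\<^sup>2"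
    using KL_upper by blast
  obtain \<epsilon> where eps: "\<epsilon> > 0" "\<And>u::real^'n. \<forall>i. \<bar>u $ i\<bar> \<le> \<epsilon> \<Longrightarrow> norm u < R"
    using abs_le_box_norm[OF assms] by blast
  \<comment> \<open>The coordinate \<open>z\<close> of \<open>lin x\<close> is a difference of two
    terms of size at most \<open>c * s\<close>, divided by \<open>wt z\<close>.\<close>
  define \<kappa> where "\<kappa> = 2 / wt z"
  have \<kappa>: "\<kappa> \<ge> 1" using wt_pos[of z] wt_le_1[of z] by (simp add: \<kappa>_def field_simps)
  \<comment> \<open>The conditions on \<open>c\<close> keep the displacements where
    \<open>up\<close> applies and inside the ball of radius \<open>R\<close>, and make the bound of
    \<open>up\<close> at most \<open>s ^ 4 = t\<close>.\<close>
  define c where "c = min 1 (min (min r \<epsilon> / \<kappa>) (1 / ((1 + \<kappa>\<^sup>2) * sqrt D)))"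
  have \<kappa>2: "1 + \<kappa>\<^sup>2 > 0" by (simp add: add_pos_nonneg)
  have c: "c > 0" "c \<le> 1" "\<kappa> * c \<le> r" "\<kappa> * c \<le> \<epsilon>" "c * (1 + \<kappa>\<^sup>2) * sqrt D \<le> 1"
  proof -
    show "c > 0" "c \<le> 1" using rD eps(1) \<kappa> \<kappa>2 by (auto simp: c_def)
    have "c \<le> min r \<epsilon> / \<kappa>" by (simp add: c_def)
    then have "c * \<kappa> \<le> min r \<epsilon>" using \<kappa> by (simp add: pos_le_divide_eq)
    then show "\<kappa> * c \<le> r" "\<kappa> * c \<le> \<epsilon>" by (simp_all add: mult.commute)
    have "c \<le> 1 / ((1 + \<kappa>\<^sup>2) * sqrt D)" by (simp add: c_def)
    then show "c * (1 + \<kappa>\<^sup>2) * sqrt D \<le> 1"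
      using rD(2) \<kappa>2 by (simp add: pos_le_divide_eq mult.assoc)
  qed
  have "\<exists>B\<in>sets borel. B \<subseteq> {\<theta>\<in>ball base R. KL \<theta> \<le> t} \<and>
      ennreal ((\<bar>det (matrix lin)\<bar> * (2 * c) ^ CARD('n)) * t powr lam) \<le> emeasure lborel B"
    if t: "0 < t" "t < 1" for t
  proof -
    define s where "s = t powr (1/4)"
    have s: "s > 0" "s \<le> 1" "s ^ 4 = t"
      using t quarter_powr(3)[OF t(1)] powr_le1[of "1/4" t] by (auto simp: s_def)
    have "coord ` weighted_box c s \<subseteq> {\<theta>\<in>ball base R. KL \<theta> \<le> t}"
    proof safe
      fix x assume x: "x \<in> weighted_box c s"
      then have xz: "\<bar>x $ z\<bar> \<le> c * s\<^sup>2" and xi: "\<And>i. i \<noteq> z \<Longrightarrow> \<bar>x $ i\<bar> \<le> c * s"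
        by (auto simp: weighted_box_def)
      have cs: "c * s \<ge> 0" using c(1) s(1) by simp
      have "s\<^sup>2 \<le> s" using s by (simp add: power2_eq_square)
      then have xz': "\<bar>x $ z\<bar> \<le> c * s" using xz c(1) by (meson mult_left_mono less_imp_le order_trans)
      have b: "\<bar>lin x $ i\<bar> \<le> \<kappa> * (c * s)" for i
      proof (cases "i = z")
        case True
        have "\<bar>\<Sum>j\<in>UNIV - {z}. wt j * x $ j\<bar> \<le> (\<Sum>j\<in>UNIV - {z}. \<bar>wt j * x $ j\<bar>)" by (rule sum_abs)
        also have "\<dots> \<le> (\<Sum>j\<in>UNIV - {z}. wt j * (c * s))"
          using xi wt_pos by (intro sum_mono) (auto simp: abs_mult abs_of_pos less_imp_le intro!: mult_left_mono)
        also have "\<dots> \<le> (\<Sum>j\<in>UNIV. wt j * (c * s))"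
          using wt_pos cs by (intro sum_mono2) (auto simp: less_imp_le)
        also have "\<dots> = c * s" by (simp add: sum_distrib_right[symmetric] sum_wt)
        finally have "\<bar>x $ z - (\<Sum>j\<in>UNIV - {z}. wt j * x $ j)\<bar> \<le> 2 * (c * s)" using xz' by linarith
        then have "\<bar>x $ z - (\<Sum>j\<in>UNIV - {z}. wt j * x $ j)\<bar> / wt z \<le> 2 * (c * s) / wt z"
          using wt_pos[of z] by (intro divide_right_mono) auto
        then show ?thesis using True wt_pos[of z] by (simp add: lin_def \<kappa>_def)
      next
        case False
        have "\<bar>x $ i\<bar> \<le> 1 * (c * s)" using xi[OF False] by simp
        also have "\<dots> \<le> \<kappa> * (c * s)" using \<kappa> cs by (rule mult_right_mono)
        finally show ?thesis using False by (simp add: lin_def)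
      qed
      have "\<kappa> * (c * s) \<le> \<kappa> * c" using \<kappa> c(1) s by (simp add: mult_left_le)
      then have b': "\<bar>lin x $ i\<bar> \<le> r" "\<bar>lin x $ i\<bar> \<le> \<epsilon>" for i using b[of i] c(3,4) by linarith+
      have "norm (lin x) < R" using eps(2) b'(2) by blast
      then show "coord x \<in> ball base R" by (simp add: coord_def dist_norm)
      have K: "KL (coord x) \<le> D * (\<bar>m1 (coord x)\<bar> + m2 (coord x))\<^sup>2"
        using up[of "coord x"] b'(1) by (simp add: coord_component)
      have "m2 (coord x) \<le> (\<Sum>i\<in>UNIV. wt i * (\<kappa> * (c * s))\<^sup>2)"
        unfolding m2_def coord_component
      proof (intro sum_mono mult_left_mono)
        fix i show "(lin x $ i)\<^sup>2 \<le> (\<kappa> * (c * s))\<^sup>2"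
          using power_mono[OF b[of i] abs_ge_zero, of 2] by simp
      qed (use wt_pos in \<open>simp add: less_imp_le\<close>)
      also have "\<dots> = \<kappa>\<^sup>2 * c\<^sup>2 * s\<^sup>2" by (simp add: sum_distrib_right[symmetric] sum_wt power_mult_distrib)
      also have "\<dots> \<le> \<kappa>\<^sup>2 * c * s\<^sup>2"
        using c(1,2) by (intro mult_right_mono mult_left_mono) (auto simp: power2_eq_square)
      finally have "m2 (coord x) \<le> \<kappa>\<^sup>2 * c * s\<^sup>2" .
      then have "\<bar>m1 (coord x)\<bar> + m2 (coord x) \<le> c * (1 + \<kappa>\<^sup>2) * s\<^sup>2"
        using xz unfolding m1_coord by (simp add: algebra_simps)
      then have "(\<bar>m1 (coord x)\<bar> + m2 (coord x))\<^sup>2 \<le> (c * (1 + \<kappa>\<^sup>2) * s\<^sup>2)\<^sup>2"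
        using m2_nonneg[of "coord x"] by (intro power_mono) auto
      then have "D * (\<bar>m1 (coord x)\<bar> + m2 (coord x))\<^sup>2 \<le> D * (c * (1 + \<kappa>\<^sup>2) * s\<^sup>2)\<^sup>2"
        using rD(2) by (intro mult_left_mono) auto
      also have "\<dots> = (c * (1 + \<kappa>\<^sup>2) * sqrt D)\<^sup>2 * s ^ 4"
        using rD(2) by (simp add: power_mult_distrib power_mult[symmetric] mult_ac)
      also have "\<dots> \<le> 1 * s ^ 4"
        using c rD(2) \<kappa>2 s(1) by (intro mult_right_mono power_le_one) auto
      finally show "KL (coord x) \<le> t" using K s(3) by simp
    qed
    moreover have "emeasure lborel (coord ` weighted_box c s)
        = ennreal ((\<bar>det (matrix lin)\<bar> * (2 * c) ^ CARD('n)) * t powr lam)"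
      unfolding weighted_box_volume(2)[OF c(1) s(1)] by (simp only: s_def quarter_powr(1)[OF t(1)])
    ultimately show ?thesis using weighted_box_volume(1)[OF c(1) s(1)] by (intro bexI conjI) auto
  qed
  note main = this
  have "\<bar>det (matrix lin)\<bar> * (2 * c) ^ CARD('n) > 0"
    using det_lin c(1) by (intro mult_pos_pos zero_less_power) auto
  then show ?thesis using main
    by (intro exI[of _ "\<bar>det (matrix lin)\<bar> * (2 * c) ^ CARD('n)"] exI[of _ "1::real"] conjI allI impI)
      (simp_all only: zero_less_one conj_absorb)
qed

end

section \<open>A resolution by two blow-ups\<close>

lemma real_analytic_at_if:
  "(b \<Longrightarrow> real_analytic_at f x) \<Longrightarrow> (\<not> b \<Longrightarrow> real_analytic_at g x) \<Longrightarrow> real_analytic_at (\<lambda>u. if b then f u else g u) x"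
  by (cases b) simp_all

subsection \<open>Determinants of monomial substitutions\<close>

text \<open>The elementary blow-up substitution, for the center where coordinate \<open>c\<close>
  and all coordinates in \<open>S\<close> vanish. Every chart below is one of these or a composition
  of two.\<close>

definition star :: "'n \<Rightarrow> 'n set \<Rightarrow> real ^ 'n \<Rightarrow> real ^ 'n" where
  "star c S u = (\<chi> j. if j \<in> S then u $ c * u $ j else u $ j)"

definition dstar :: "'n \<Rightarrow> 'n set \<Rightarrow> real ^ 'n \<Rightarrow> real ^ 'n \<Rightarrow> real ^ 'n" where
  "dstar c S u v = (\<chi> j. if j \<in> S then v $ c * u $ j + u $ c * v $ j else v $ j)"

lemma star_has_derivative:
  fixes u :: "real ^ 'n::finite"
  shows "(star c S has_derivative dstar c S u) (at u)"
proof -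
  have nth: "((\<lambda>u. u $ j) has_derivative (\<lambda>v. v $ j)) (at u)" for j
    by (rule bounded_linear_imp_has_derivative[OF bounded_linear_vec_nth])
  have comp: "((\<lambda>u. star c S u $ j) has_derivative (\<lambda>v. dstar c S u v $ j)) (at u)" for j
    using has_derivative_mult[OF nth[of c] nth[of j]] nth[of j]
    by (cases "j \<in> S") (simp_all add: star_def dstar_def add.commute)
  show ?thesis
    by (subst has_derivative_componentwise_within) (auto simp: Basis_vec_def inner_axis comp)
qed

text \<open>Off the diagonal only column \<open>c\<close> can be nonzero. A permutation with nonzero
  product would send any moved index to \<open>c\<close>, but row \<open>c\<close> forces it to fix
  \<open>c\<close>; so only the identity contributes.\<close>

lemma det_dstar:
  fixes u :: "real ^ 'n::finite"
  assumes "c \<notin> S"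
  shows "det (matrix (dstar c S u)) = (u $ c) ^ card S"
proof -
  define A where "A = matrix (dstar c S u)"
  have A: "A $ j $ k = (if j \<in> S then (if k = c then u $ j else 0) + (if k = j then u $ c else 0)
      else if k = j then 1 else 0)" for j k
    by (simp add: A_def matrix_def dstar_def axis_def)
  have zero: "(\<Prod>j\<in>UNIV. A $ j $ p j) = 0" if p: "p permutes UNIV" "p \<noteq> id" for p
  proof -
    obtain j where j: "p j \<noteq> j" using p(2) by (auto simp: fun_eq_iff)
    have "\<exists>j. A $ j $ p j = 0"
    proof (rule ccontr)
      assume "\<not> ?thesis"
      then have nz: "A $ i $ p i \<noteq> 0" for i by blast
      have "p j = c" using nz[of j] j by (auto simp: A split: if_splits)
      moreover have "p c = c" using nz[of c] assms by (auto simp: A split: if_splits)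
      ultimately show False using j permutes_inj[OF p(1)] by (metis injD)
    qed
    then show ?thesis by (auto intro: prod_zero)
  qed
  have "det A = (\<Sum>p\<in>{id}. of_int (sign p) * (\<Prod>j\<in>UNIV. A $ j $ p j))"
    unfolding det_def using zero by (intro sum.mono_neutral_right) (auto simp: permutes_id finite_permutations)
  also have "\<dots> = (\<Prod>j\<in>UNIV. if j \<in> S then u $ c else 1)"
    using assms by (auto simp: A sign_id intro!: prod.cong)
  also have "\<dots> = (u $ c) ^ card S" by (subst prod.If_cases) auto
  finally show ?thesis by (simp add: A_def)
qed

lemma det_matrix_comp:
  fixes f g :: "real ^ 'n::finite \<Rightarrow> real ^ 'n"
  assumes "linear f" "linear g"
  shows "det (matrix (f \<circ> g)) = det (matrix f) * det (matrix g)"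
  by (simp add: matrix_compose[OF assms(2,1)] det_mul)

subsection \<open>The resolving manifold\<close>

text \<open>A point of the manifold is coded by its image \<open>x\<close> and the rank one projector of a point of the
  projective space in which the graph of \<open>x \<mapsto> [F x]\<close> lies.\<close>

type_synonym 'n pt_index = "'n + (('n \<times> 'n) \<times> ('n \<times> 'n))"

definition mk :: "real ^ 'n::finite \<Rightarrow> ('n \<times> 'n \<Rightarrow> 'n \<times> 'n \<Rightarrow> real) \<Rightarrow> nat \<Rightarrow> real" where
  "mk x Pm = (\<lambda>k. case (from_nat k :: 'n pt_index) of Inl i \<Rightarrow> x $ i | Inr (m, m') \<Rightarrow> Pm m m')"

definition crd :: "(nat \<Rightarrow> real) \<Rightarrow> real ^ 'n::finite" where
  "crd p = (\<chi> i. p (to_nat (Inl i :: 'n pt_index)))"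

definition prj :: "(nat \<Rightarrow> real) \<Rightarrow> 'n::finite \<times> 'n \<Rightarrow> 'n \<times> 'n \<Rightarrow> real" where
  "prj p m m' = p (to_nat (Inr (m, m') :: 'n pt_index))"

lemma crd_mk [simp]: "crd (mk x Pm) = x"
  by (simp add: crd_def mk_def vec_eq_iff)

lemma prj_mk [simp]: "prj (mk x Pm) = Pm"
  by (simp add: prj_def mk_def fun_eq_iff)

lemma continuous_on_crd: "continuous_on S (crd :: _ \<Rightarrow> real ^ 'n::finite)"
  unfolding crd_def by (intro continuous_on_vec_lambda continuous_on_subset[OF continuous_on_product_coordinates]) auto

lemma continuous_on_prj: "continuous_on S (\<lambda>p. prj p m m')"
  unfolding prj_def by (intro continuous_on_subset[OF continuous_on_product_coordinates]) auto

lemma continuous_on_mk: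
  fixes f :: "'a::topological_space \<Rightarrow> real ^ 'n::finite"
  assumes "continuous_on S f" "\<And>m m'. continuous_on S (\<lambda>u. Pm u m m')"
  shows "continuous_on S (\<lambda>u. mk (f u) (Pm u))"
proof (rule continuous_on_coordinatewise_then_product)
  fix k
  show "continuous_on S (\<lambda>u. mk (f u) (Pm u) k)"
    unfolding mk_def using assms by (cases "from_nat k :: 'n pt_index") (auto intro!: continuous_intros)
qed

text \<open>The orthogonal projector onto the line spanned by \<open>f\<close>. It does not change
  when \<open>f\<close> is rescaled and is analytic where \<open>f\<close> is nonzero, so points of
  projective space get coordinates without a choice of representative.\<close>

definition pm :: "('n::finite \<times> 'n \<Rightarrow> real) \<Rightarrow> 'n \<times> 'n \<Rightarrow> 'n \<times> 'n \<Rightarrow> real" where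
  "pm f m m' = f m * f m' / (\<Sum>m\<in>UNIV. (f m)\<^sup>2)"

lemma pm_scale:
  assumes "k \<noteq> 0" "\<And>m. g m = k * f m"
  shows "pm g = pm f"
proof -
  have "(\<Sum>m\<in>UNIV. (g m)\<^sup>2) = k\<^sup>2 * (\<Sum>m\<in>UNIV. (f m)\<^sup>2)"
    by (simp add: assms(2) power_mult_distrib sum_distrib_left)
  then show ?thesis using assms(1) by (auto simp: pm_def fun_eq_iff assms(2) power2_eq_square)
qed

lemma sum_sq_pos:
  fixes f :: "'a::finite \<Rightarrow> real"
  assumes "f m \<noteq> 0"
  shows "0 < (\<Sum>m\<in>UNIV. (f m)\<^sup>2)"
proof -
  have "0 < (f m)\<^sup>2" using assms by simp
  also have "\<dots> \<le> (\<Sum>m\<in>UNIV. (f m)\<^sup>2)" by (rule member_le_sum) auto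
  finally show ?thesis .
qed

locale weighted_blowup = fixes z :: "'n::finite"
begin

text \<open>The two centers: the origin, with homogeneous coordinates \<open>x\<close>, and then the ideal
  generated by \<open>x\<^sub>z\<close> and the \<open>x\<^sub>i\<^sup>2\<close>; \<open>F\<close> lists the products of their generators.\<close>

definition N :: "real ^ 'n \<Rightarrow> 'n \<Rightarrow> real" where
  "N x j = (if j = z then x $ z else (x $ j)\<^sup>2)"

definition F :: "real ^ 'n \<Rightarrow> 'n \<times> 'n \<Rightarrow> real" where
  "F x m = N x (fst m) * x $ snd m"

text \<open>The products \<open>x_z\<^sup>2\<close>, \<open>x_z x_i\<close> and
  \<open>x_i\<^sup>3\<close>, for \<open>i \<noteq> z\<close>, are the vertices of the Newton
  polyhedron of the product ideal; their charts cover the manifold.\<close>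

definition vert :: "('n \<times> 'n) set" where
  "vert = {(a, b). a = z \<or> a = b}"

text \<open>In the chart \<open>c\<close> the point \<open>x = sc \<cdot> wv\<close> has the ratios \<open>F x m / F x c = R m\<close>.\<close>

definition sc :: "'n \<times> 'n \<Rightarrow> real ^ 'n \<Rightarrow> real" where
  "sc c u = (case c of (a, b) \<Rightarrow> if a = z \<and> b \<noteq> z then u $ z * u $ b else u $ b)"

text \<open>\<open>wv\<close> and \<open>nv\<close> are homogeneous coordinates for the two centers,
  normalised to 1 at \<open>b\<close> and at \<open>a\<close>. For \<open>c\<close> in
  \<open>vert\<close> all these ratios are polynomials in the chart coordinates.\<close>

definition wv :: "'n \<times> 'n \<Rightarrow> real ^ 'n \<Rightarrow> real ^ 'n" where
  "wv c u = (case c of (a, b) \<Rightarrow> \<chi> j. if j = b then 1 else if j \<noteq> z then u $ j else if a = z then u $ z else u $ b * u $ z)"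

definition nv :: "'n \<times> 'n \<Rightarrow> real ^ 'n \<Rightarrow> 'n \<Rightarrow> real" where
  "nv c u j = (case c of (a, b) \<Rightarrow> if j = a then 1 else if j = z then u $ z else
      (if a = z then u $ b else 1) * (if j = b then 1 else (u $ j)\<^sup>2))"

text \<open>Written out, with \<open>j\<close> different from \<open>i\<close> and \<open>z\<close>:
  chart \<open>(z, z)\<close> is \<open>x_z = u_z\<close>, \<open>x_i = u_z u_i\<close>; chart
  \<open>(i, i)\<close> is \<open>x_i = u_i\<close>, \<open>x_z = u_i\<^sup>2 u_z\<close>,
  \<open>x_j = u_i u_j\<close>; chart \<open>(z, i)\<close> is \<open>x_i = u_z u_i\<close>,
  \<open>x_z = u_z\<^sup>2 u_i\<close>, \<open>x_j = u_z u_i u_j\<close>.\<close>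

definition psi :: "'n \<times> 'n \<Rightarrow> real ^ 'n \<Rightarrow> real ^ 'n" where
  "psi c u = sc c u *\<^sub>R wv c u"

definition R :: "'n \<times> 'n \<Rightarrow> real ^ 'n \<Rightarrow> 'n \<times> 'n \<Rightarrow> real" where
  "R c u m = nv c u (fst m) * wv c u $ snd m"

definition Psi :: "'n \<times> 'n \<Rightarrow> real ^ 'n \<Rightarrow> nat \<Rightarrow> real" where
  "Psi c u = mk (psi c u) (pm (R c u))"

definition graph :: "real ^ 'n \<Rightarrow> nat \<Rightarrow> real" where
  "graph x = mk x (pm (F x))"

text \<open>Each chart coordinate is either a ratio of generators, read off from
  \<open>\<rho>\<close>, or a coordinate of the image point; no division by a coordinate that
  vanishes on the divisor occurs.\<close>

definition inv_chart :: "'n \<times> 'n \<Rightarrow> real ^ 'n \<Rightarrow> ('n \<times> 'n \<Rightarrow> real) \<Rightarrow> real ^ 'n" where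
  "inv_chart c x \<rho> = (case c of (a, b) \<Rightarrow> \<chi> j.
     if j = z then (if b = z then x $ z else if a = z then \<rho> (z, z) else \<rho> (z, b))
     else if j = b then (if a = z then \<rho> (b, b) else x $ b) else \<rho> (a, j))"

definition phi :: "'n \<times> 'n \<Rightarrow> (nat \<Rightarrow> real) \<Rightarrow> real ^ 'n" where
  "phi c p = inv_chart c (crd p) (\<lambda>m. prj p m c / prj p c c)"

lemma vert_cases:
  assumes "c \<in> vert"
  obtains "c = (z, z)" | i where "i \<noteq> z" "c = (i, i)" | i where "i \<noteq> z" "c = (z, i)"
  using assms by (auto simp: vert_def)

lemma R_self: "R c u c = 1"
  by (cases c) (simp add: R_def nv_def wv_def)

lemma prj_Psi_self: "prj (Psi c u) m c / prj (Psi c u) c c = R c u m" "prj (Psi c u) c c > 0"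
  using sum_sq_pos[of "R c u" c] by (simp_all add: Psi_def pm_def R_self)

lemma crd_Psi: "crd (Psi c u) = psi c u"
  by (simp add: Psi_def)

lemma phi_Psi:
  assumes "c \<in> vert"
  shows "phi c (Psi c u) = u"
  using assms unfolding phi_def crd_Psi prj_Psi_self
  by (cases rule: vert_cases) (auto simp: inv_chart_def psi_def sc_def wv_def nv_def R_def vec_eq_iff)

lemma F_psi:
  assumes "c \<in> vert"
  shows "F (psi c u) m = F (psi c u) c * R c u m"
proof -
  obtain j k where m: "m = (j, k)" by (cases m)
  obtain a b where c: "c = (a, b)" by (cases c)
  have "N (psi c u) j = N (psi c u) a * nv c u j"
    using assms unfolding c
    by (cases rule: vert_cases)
       (auto simp: N_def psi_def sc_def wv_def nv_def power2_eq_square)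
  moreover have "psi c u $ k = psi c u $ b * wv c u $ k"
    unfolding c by (simp add: psi_def wv_def)
  ultimately show ?thesis by (simp add: F_def R_def m c)
qed

lemma graph_eq_Psi:
  assumes "c \<in> vert" "F x c \<noteq> 0"
  shows "Psi c (phi c (graph x)) = graph x"
proof -
  have "F x c * F x c / (\<Sum>m\<in>UNIV. (F x m)\<^sup>2) \<noteq> 0" using assms(2) sum_sq_pos[of "F x" c] by simp
  then have ph: "phi c (graph x) = inv_chart c x (\<lambda>m. F x m / F x c)"
    using assms(2) sum_sq_pos[of "F x" c] by (simp add: phi_def graph_def pm_def)
  have "psi c (phi c (graph x)) = x"
    using assms unfolding ph
    by (cases rule: vert_cases)
       (auto simp: inv_chart_def psi_def sc_def wv_def F_def N_def vec_eq_iff power2_eq_square)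
  note x = this
  have "F x m = F x c * R c (phi c (graph x)) m" for m
    using F_psi[OF assms(1), of "phi c (graph x)" m] by (simp only: x)
  then have "pm (F x) = pm (R c (phi c (graph x)))" by (rule pm_scale[OF assms(2)])
  then show ?thesis by (simp only: Psi_def x) (simp only: graph_def)
qed

lemma Psi_eq_graph:
  assumes "c \<in> vert" "psi c u \<noteq> 0"
  shows "Psi c u = graph (psi c u)" "F (psi c u) c \<noteq> 0"
proof -
  have "sc c u \<noteq> 0" using assms(2) by (auto simp: psi_def)
  with assms(1) show *: "F (psi c u) c \<noteq> 0"
    by (cases rule: vert_cases) (auto simp: F_def N_def psi_def sc_def wv_def)
  show "Psi c u = graph (psi c u)"
    unfolding Psi_def graph_def by (simp only: pm_scale[OF * F_psi[OF assms(1)]])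
qed

lemma vertex_nonzero:
  assumes "x \<noteq> 0"
  shows "\<exists>c\<in>vert. F x c \<noteq> 0"
proof (cases "x $ z = 0")
  case True
  then obtain i where "x $ i \<noteq> 0" "i \<noteq> z" using assms by (auto simp: vec_eq_iff)
  then show ?thesis by (intro bexI[of _ "(i, i)"]) (auto simp: F_def N_def vert_def)
next
  case False
  then show ?thesis by (intro bexI[of _ "(z, z)"]) (auto simp: F_def N_def vert_def)
qed

definition pts :: "(nat \<Rightarrow> real) set" where
  "pts = (\<Union>c\<in>vert. range (Psi c))"

lemma graph_in_pts: "x \<noteq> 0 \<Longrightarrow> graph x \<in> pts"
  using vertex_nonzero[of x] graph_eq_Psi[of _ x] unfolding pts_def by (metis UN_I rangeI)

lemma pts_eq_graph: "p \<in> pts \<Longrightarrow> crd p \<noteq> (0 :: real ^ 'n) \<Longrightarrow> p = graph (crd p)"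
proof -
  assume "p \<in> pts" and nz: "crd p \<noteq> (0 :: real ^ 'n)"
  then obtain c u where c: "c \<in> vert" "p = Psi c u" by (auto simp: pts_def)
  have e: "crd p = psi c u" unfolding c(2) by (rule crd_Psi)
  have ne: "psi c u \<noteq> 0" using nz e by simp
  show "p = graph (crd p)" unfolding e unfolding c(2) by (rule Psi_eq_graph(1)[OF c(1) ne])
qed

lemma real_analytic_wv: "real_analytic_at (\<lambda>u. wv c u $ j) u"
  by (cases c) (auto simp: wv_def intro!: real_analytic_at_if real_analytic_intros)

lemma real_analytic_sc: "real_analytic_at (sc c) u"
  by (cases c) (auto simp: sc_def[abs_def] intro!: real_analytic_at_if real_analytic_intros)

lemma real_analytic_psi: "real_analytic_at (\<lambda>u. psi c u $ j) u"
  using real_analytic_at_mult[OF real_analytic_sc[of c u] real_analytic_wv[of c j u]] by (simp add: psi_def)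

lemma real_analytic_R: "real_analytic_at (\<lambda>u. R c u m) u"
proof -
  have "real_analytic_at (\<lambda>u. nv c u j) u" for j
    by (cases c) (auto simp: nv_def intro!: real_analytic_at_if real_analytic_intros)
  then show ?thesis unfolding R_def by (intro real_analytic_at_mult real_analytic_wv)
qed

lemma real_analytic_F:
  assumes "\<And>i. real_analytic_at (\<lambda>y. f y $ i) y"
  shows "real_analytic_at (\<lambda>y. F (f y) m) y"
  unfolding F_def N_def using assms
  by (intro real_analytic_at_if real_analytic_at_mult real_analytic_at_power)

lemma real_analytic_pm:
  assumes "\<And>m. real_analytic_at (\<lambda>u. f u m) u" "f u n \<noteq> 0"
  shows "real_analytic_at (\<lambda>u. pm (f u) m m') u"
proof -
  have "(\<Sum>m\<in>UNIV. (f u m)\<^sup>2) \<noteq> 0" using sum_sq_pos[of "f u" n] assms(2) by simp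
  then show ?thesis unfolding pm_def
    by (intro real_analytic_at_divide real_analytic_at_mult real_analytic_at_sum real_analytic_at_power assms(1))
qed

lemma real_analytic_inv_chart:
  assumes "\<And>j. real_analytic_at (\<lambda>u. f u $ j) u" "\<And>m. real_analytic_at (\<lambda>u. \<rho> u m) u"
  shows "real_analytic_at (\<lambda>u. inv_chart c (f u) (\<rho> u) $ j) u"
  using assms by (cases c) (auto simp: inv_chart_def intro!: real_analytic_at_if)

lemma real_analytic_phi_Psi:
  assumes "prj (Psi c u) c' c' \<noteq> 0"
  shows "real_analytic_at (\<lambda>u. phi c' (Psi c u) $ j) u"
proof -
  have pm: "real_analytic_at (\<lambda>u. prj (Psi c u) m m') u" for m m' :: "'n \<times> 'n"
    unfolding Psi_def prj_mk using R_self[of c u]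
    by (intro real_analytic_pm[of _ _ c] real_analytic_R) simp
  show ?thesis unfolding phi_def crd_Psi
    using assms by (intro real_analytic_inv_chart real_analytic_psi real_analytic_at_divide pm)
qed

lemma real_analytic_phi_graph:
  assumes f: "\<And>i. real_analytic_at (\<lambda>y. f y $ i) y" and nz: "prj (graph (f y)) c c \<noteq> 0"
  shows "real_analytic_at (\<lambda>y. phi c (graph (f y)) $ j) y"
proof -
  have "F (f y) c \<noteq> 0" using nz by (auto simp: graph_def pm_def)
  then have pm: "real_analytic_at (\<lambda>y. prj (graph (f y)) m m') y" for m m' :: "'n \<times> 'n"
    unfolding graph_def prj_mk by (intro real_analytic_pm[of _ _ c] real_analytic_F f)
  have cg: "crd (graph x) = x" for x by (simp add: graph_def)
  show ?thesis unfolding phi_def cg using nz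
    by (intro real_analytic_inv_chart real_analytic_at_divide f pm)
qed

lemma real_analytic_at_imp_continuous_on:
  assumes "\<And>u. u \<in> S \<Longrightarrow> real_analytic_at f u"
  shows "continuous_on S f"
  by (intro continuous_at_imp_continuous_on ballI differentiable_imp_continuous_within
      real_analytic_at_differentiable assms)

lemma continuous_on_psi: "continuous_on S (psi c)"
proof -
  have "continuous_on S (\<lambda>u. \<chi> j. psi c u $ j)"
    by (rule continuous_on_vec_lambda[OF real_analytic_at_imp_continuous_on[OF real_analytic_psi]])
  then show ?thesis by (simp add: vec_lambda_eta)
qed

lemma continuous_on_Psi: "continuous_on S (Psi c)"
proof -
  have "real_analytic_at (\<lambda>u. pm (R c u) m m') u" for m m' u
    using R_self[of c u] by (intro real_analytic_pm[of _ _ c] real_analytic_R) simp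
  then show ?thesis unfolding Psi_def[abs_def]
    by (intro continuous_on_mk continuous_on_psi real_analytic_at_imp_continuous_on)
qed

lemma continuous_on_if_const:
  "(b \<Longrightarrow> continuous_on S f) \<Longrightarrow> (\<not> b \<Longrightarrow> continuous_on S g) \<Longrightarrow> continuous_on S (\<lambda>u. if b then f u else g u)"
  by (cases b) simp_all

lemma continuous_on_phi:
  assumes "\<And>p. p \<in> S \<Longrightarrow> prj p c c \<noteq> 0"
  shows "continuous_on S (phi c)"
proof -
  have cr: "continuous_on S (\<lambda>p. crd p $ i)" for i :: 'n
    by (intro continuous_intros continuous_on_crd)
  have rho: "continuous_on S (\<lambda>p. prj p m c / prj p c c)" for m :: "'n \<times> 'n"
    using assms by (intro continuous_intros continuous_on_prj) auto
  obtain a b where c: "c = (a, b)" by (cases c)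
  show ?thesis unfolding phi_def[abs_def] inv_chart_def
    unfolding c prod.case by (intro continuous_on_vec_lambda continuous_on_if_const cr rho[unfolded c])
qed

text \<open>Adding \<open>1 / n\<close> to every coordinate of \<open>u\<close> leaves all
  coordinate hyperplanes for large \<open>n\<close>, so continuity carries an identity onto
  them.\<close>

lemma equal_by_density:
  fixes f g :: "real ^ 'n \<Rightarrow> 'b::t2_space"
  assumes "open O'" "continuous_on O' f" "continuous_on O' g"
    and eq: "\<And>u. u \<in> O' \<Longrightarrow> (\<And>i. u $ i \<noteq> 0) \<Longrightarrow> f u = g u" and u: "u \<in> O'"
  shows "f u = g u"
proof -
  define s where "s n = u + (\<chi> i. 1 / real (Suc n))" for n
  have lim: "s \<longlonglongrightarrow> u"
  proof (rule vec_tendstoI)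
    fix i
    have "(\<lambda>n. u $ i + 1 / real (Suc n)) \<longlonglongrightarrow> u $ i + 0"
      by (intro tendsto_add tendsto_const LIMSEQ_Suc lim_1_over_n)
    then show "(\<lambda>n. s n $ i) \<longlonglongrightarrow> u $ i" by (simp add: s_def)
  qed
  have nz: "\<forall>\<^sub>F n in sequentially. \<forall>i. s n $ i \<noteq> 0"
  proof (rule eventually_all_finite)
    fix i
    show "\<forall>\<^sub>F n in sequentially. s n $ i \<noteq> 0"
    proof (cases "u $ i = 0")
      case False
      have "(\<lambda>n. s n $ i) \<longlonglongrightarrow> u $ i" using lim by (rule tendsto_vec_nth)
      then show ?thesis using False by (rule tendsto_imp_eventually_ne)
    qed (auto simp: s_def)
  qed
  have "\<forall>\<^sub>F n in sequentially. s n \<in> O'" using lim assms(1) u by (rule topological_tendstoD)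
  with nz have ev: "\<forall>\<^sub>F n in sequentially. f (s n) = g (s n)"
    by eventually_elim (use eq in blast)
  have cf: "isCont f u" "isCont g u" using assms u continuous_on_eq_continuous_at by blast+
  have "(\<lambda>n. f (s n)) \<longlonglongrightarrow> f u" by (rule isCont_tendsto_compose[OF cf(1) lim])
  then have "(\<lambda>n. g (s n)) \<longlonglongrightarrow> f u" using ev by (rule Lim_transform_eventually)
  then show ?thesis using isCont_tendsto_compose[OF cf(2) lim] by (rule LIMSEQ_unique)
qed

text \<open>Where all chart coordinates are nonzero, \<open>p\<close> lies on the graph and
  \<open>graph_eq_Psi\<close> applies; density extends this to the divisor. One argument thus covers
  every pair of charts.\<close>

lemma Psi_phi:
  assumes p: "p \<in> pts" and c': "c' \<in> vert" and nz: "prj p c' c' \<noteq> 0"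
  shows "Psi c' (phi c' p) = p"
proof -
  obtain c u where c: "c \<in> vert" and pu: "p = Psi c u" using p by (auto simp: pts_def)
  let ?O = "{u. prj (Psi c u) c' c' \<noteq> 0}"
  have "continuous_on UNIV (\<lambda>u. prj (Psi c u) c' c')"
    by (rule continuous_on_compose2[OF continuous_on_prj[of UNIV] continuous_on_Psi]) simp
  then have op: "open ?O" by (simp add: open_Collect_neq continuous_on_const)
  have con: "continuous_on ?O (\<lambda>u. Psi c' (phi c' (Psi c u)))"
    by (rule continuous_on_compose2[OF continuous_on_Psi[of UNIV]])
       (auto intro!: continuous_on_compose2[OF continuous_on_phi[of "{p. prj p c' c' \<noteq> 0}"] continuous_on_Psi])
  have gen: "Psi c' (phi c' (Psi c u)) = Psi c u" if "u \<in> ?O" "\<And>i. u $ i \<noteq> 0" for u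
  proof -
    have "sc c u \<noteq> 0" using that(2) by (cases c) (auto simp: sc_def)
    moreover have "wv c u $ snd c = 1" by (cases c) (simp add: wv_def)
    ultimately have "psi c u $ snd c \<noteq> 0" by (simp add: psi_def)
    then have "psi c u \<noteq> 0" by auto
    then have g: "Psi c u = graph (psi c u)" by (rule Psi_eq_graph(1)[OF c])
    then have "F (psi c u) c' \<noteq> 0" using that(1) by (auto simp: graph_def pm_def)
    then show ?thesis unfolding g by (rule graph_eq_Psi[OF c'])
  qed
  have "u \<in> ?O" using nz pu by simp
  show ?thesis unfolding pu
    by (rule equal_by_density[OF op con continuous_on_Psi gen \<open>u \<in> ?O\<close>])
qed

text \<open>In the chart with the largest \<open>prj p c c\<close> all ratios are at most \<open>1\<close> in absolute value.\<close>

lemma bounded_chart: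
  assumes p: "p \<in> pts"
  obtains c u where "c \<in> vert" "p = Psi c u" "\<And>j. \<bar>u $ j\<bar> \<le> 1 \<or> u $ j = psi c u $ j"
proof -
  have fin: "finite vert" "vert \<noteq> {}" by (auto simp: vert_def)
  have "Max ((\<lambda>c. prj p c c) ` vert) \<in> (\<lambda>c. prj p c c) ` vert"
    using fin by (intro Max_in) auto
  then obtain c where c: "c \<in> vert" and cm: "Max ((\<lambda>c. prj p c c) ` vert) = prj p c c" by (rule imageE)
  have mx: "prj p c' c' \<le> prj p c c" if "c' \<in> vert" for c'
    unfolding cm[symmetric] using fin(1) that by (intro Max_ge) auto
  obtain c1 u1 where "c1 \<in> vert" "p = Psi c1 u1" using p by (auto simp: pts_def)
  then have "prj p c c > 0" using prj_Psi_self(2)[of c1 u1] mx[of c1] by simp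
  then have pu: "p = Psi c (phi c p)" using Psi_phi[OF p c] by simp
  define u where "u = phi c p"
  have S: "(\<Sum>m\<in>UNIV. (R c u m)\<^sup>2) > 0" using sum_sq_pos[of "R c u" c] by (simp add: R_self)
  have Rle: "\<bar>R c u c'\<bar> \<le> 1" if "c' \<in> vert" for c'
  proof -
    have "prj (Psi c u) c' c' \<le> prj (Psi c u) c c" using mx[OF that] pu by (simp add: u_def)
    then have "(R c u c')\<^sup>2 \<le> 1\<^sup>2" using S by (simp add: Psi_def pm_def R_self divide_le_cancel power2_eq_square)
    then show ?thesis by (metis abs_le_square_iff abs_1)
  qed
  \<comment> \<open>The only chart coordinates that are not ratios, \<open>z\<close> in chart
    \<open>(z, z)\<close> and \<open>i\<close> in chart \<open>(i, i)\<close>, are coordinates of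
    the image, which a compact set of images will bound.\<close>
  have "\<bar>u $ j\<bar> \<le> 1 \<or> u $ j = psi c u $ j" for j
    using c
  proof (cases rule: vert_cases)
    case 1
    then show ?thesis using Rle[of "(z, j)"] 
      by (auto simp: vert_def R_def nv_def wv_def psi_def sc_def)
  next
    case (2 i)
    consider "j = i" | "j = z" | "j \<noteq> i" "j \<noteq> z" by blast
    then show ?thesis
    proof cases
      case 3
      \<comment> \<open>The ratio of the generators \<open>(j, j)\<close> and \<open>(i, i)\<close>
        is the cube of this coordinate.\<close>
      then have "\<bar>u $ j\<bar> ^ 3 \<le> 1"
        using Rle[of "(j, j)"] 2 by (simp add: vert_def R_def nv_def wv_def power3_eq_cube power2_eq_square abs_mult)
      then show ?thesis by (meson not_le one_less_power zero_less_numeral)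
    qed (use 2 Rle[of "(z, i)"] in \<open>auto simp: vert_def R_def nv_def wv_def psi_def sc_def\<close>)
  next
    case (3 i)
    consider "j = i" | "j = z" | "j \<noteq> i" "j \<noteq> z" by blast
    then show ?thesis
      using 3 Rle[of "(z, z)"] Rle[of "(i, i)"] Rle[of "(z, j)"]
      by cases (auto simp: vert_def R_def nv_def wv_def)
  qed
  then show thesis using that c pu by (simp add: u_def)
qed

end

section \<open>Analyticity of the logarithm and of its second-order remainder\<close>

lemma real_analytic_at_ln:
  assumes "real_analytic_at f x" "f x > 0"
  shows "real_analytic_at (\<lambda>u. ln (f u)) x"
proof (rule real_analytic_at_powser_compose[OF assms])
  fix t assume t: "\<bar>t\<bar> < f x"
  have *: "\<bar>t / f x\<bar> < 1" using t assms(2) by simp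
  \<comment> \<open>The term of the logarithm series at \<open>n = 0\<close> is a division by zero,
    hence 0, which leaves this place for the constant.\<close>
  have "(\<lambda>n. (if n = 0 then ln (f x) else 0) + - ((- (t / f x)) ^ n) / real n) sums (ln (f x) + ln (1 + t / f x))"
    by (intro sums_add sums_single ln_series'[OF *])
  moreover have "ln (f x) + ln (1 + t / f x) = ln (f x + t)"
  proof -
    have "1 + t / f x > 0" using * by linarith
    then have "ln (f x) + ln (1 + t / f x) = ln (f x * (1 + t / f x))" using assms(2) by (simp add: ln_mult)
    also have "f x * (1 + t / f x) = f x + t" using assms(2) by (simp add: field_simps)
    finally show ?thesis .
  qed
  moreover have "((if n = 0 then ln (f x) else 0) + - ((- (1 / f x)) ^ n) / real n) * t ^ n
      = (if n = 0 then ln (f x) else 0) + - ((- (t / f x)) ^ n) / real n" for n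
  proof (cases "n = 0")
    case False
    have "(- (1 / f x)) ^ n * t ^ n = (- (t / f x)) ^ n" by (simp add: power_mult_distrib[symmetric])
    then show ?thesis using False by simp
  qed simp
  ultimately show "(\<lambda>n. ((if n = 0 then ln (f x) else 0) + - ((- (1 / f x)) ^ n) / real n) * t ^ n) sums ln (f x + t)"
    by (simp only:)
qed

text \<open>The function \<open>G\<close> of the overview; the value 1/2 is the leading Taylor
  coefficient and fills the removable singularity.\<close>

definition log_rem :: "real \<Rightarrow> real" where
  "log_rem r = (if r = 0 then 1/2 else (r - ln (1 + r)) / r\<^sup>2)"

lemma log_rem_mult: "r - ln (1 + r) = r\<^sup>2 * log_rem r"
  by (simp add: log_rem_def)

lemma log_rem_pos:
  assumes "r > -1"
  shows "log_rem r > 0"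
proof (cases "r = 0")
  case False
  have "ln (1 + r) \<noteq> r"
  proof
    assume "ln (1 + r) = r"
    then have "ln (1 + r) = (1 + r) - 1" by simp
    then have "1 + r = 1" using assms ln_eq_minus_one[of "1 + r"] by simp
    then show False using False by simp
  qed
  moreover have "ln (1 + r) \<le> r" using ln_le_minus_one[of "1 + r"] assms by simp
  ultimately show ?thesis using False by (simp add: log_rem_def)
qed (simp add: log_rem_def)

lemma real_analytic_at_log_rem:
  assumes f: "real_analytic_at f x" and gt: "f x > -1"
  shows "real_analytic_at (\<lambda>u. log_rem (f u)) x"
proof (cases "f x = 0")
  case True
  show ?thesis
  proof (rule real_analytic_at_powser_compose[OF f, of 1 "\<lambda>n. (-1) ^ n / real (n + 2)"])
    fix t :: real assume t: "\<bar>t\<bar> < 1"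
    \<comment> \<open>The first two terms of the series, 0 and \<open>t\<close>, are dropped; the
      later division by \<open>t\<^sup>2\<close> accounts for the shift by two.\<close>
    have "(\<lambda>n. - ((- t) ^ (n + 2)) / real (n + 2)) sums (ln (1 + t) - (\<Sum>n<2. - ((- t) ^ n) / real n))"
      by (rule sums_split_initial_segment[OF ln_series'[OF t]])
    then have "(\<lambda>n. - ((- t) ^ (n + 2)) / real (n + 2)) sums (ln (1 + t) - t)"
      by (simp add: numeral_2_eq_2)
    from sums_minus[OF this] have *: "(\<lambda>n. (- t) ^ (n + 2) / real (n + 2)) sums (t - ln (1 + t))"
      by simp
    have "(\<lambda>n. (- t) ^ n / real (n + 2)) sums log_rem t"
    proof (cases "t = 0")
      case True
      have "(\<lambda>n. (- t) ^ n / real (n + 2)) sums (\<Sum>n\<in>{0}. (- t) ^ n / real (n + 2))"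
        by (rule sums_finite) (auto simp: True)
      then show ?thesis using True by (simp add: log_rem_def)
    next
      case False
      have "(- t) ^ (n + 2) / real (n + 2) / t\<^sup>2 = (- t) ^ n / real (n + 2)" for n
        using False by (simp add: power_add power2_eq_square)
      then show ?thesis using sums_divide[OF *, of "t\<^sup>2"] False by (simp only: log_rem_def if_False)
    qed
    moreover have "(- t) ^ n / real (n + 2) = (-1) ^ n / real (n + 2) * t ^ n" for n
      by (subst power_minus) simp
    ultimately have "(\<lambda>n. (-1) ^ n / real (n + 2) * t ^ n) sums log_rem t" by (simp only:)
    then show "(\<lambda>n. (-1) ^ n / real (n + 2) * t ^ n) sums log_rem (f x + t)" using True by simp
  qed simp
next
  case False
  have an: "real_analytic_at (\<lambda>u. (f u - ln (1 + f u)) / (f u)\<^sup>2) x"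
    using f gt False
    by (intro real_analytic_at_divide real_analytic_at_diff real_analytic_at_ln real_analytic_at_power
        real_analytic_at_add real_analytic_at_const) auto
  obtain e where e: "e > 0" "\<And>u. dist u x < e \<Longrightarrow> f u \<noteq> 0"
  proof -
    have "isCont f x" using real_analytic_at_differentiable[OF f] differentiable_imp_continuous_within by blast
    then show thesis using False that continuous_at_avoid[of x f 0] by (metis dist_commute)
  qed
  show ?thesis
    by (rule real_analytic_at_transform[OF an open_ball, of x e]) (use e in \<open>auto simp: log_rem_def dist_commute\<close>)
qed

lemma mono_pow_one: "mono_pow (\<lambda>j. if j = b then p else 0) u = (u $ b) ^ p"
  unfolding mono_pow_def by (subst prod.remove[of _ b]) auto

lemma mono_pow_two:
  assumes "a \<noteq> b"
  shows "mono_pow (\<lambda>j. if j = b then p else if j = a then q else 0) u = (u $ b) ^ p * (u $ a) ^ q"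
proof -
  have "(\<lambda>j. if j = b then p else if j = a then q else 0) = (\<lambda>i. (if i = b then p else 0) + (if i = a then q else 0))"
    using assms by auto
  then show ?thesis by (simp only: mono_pow_add mono_pow_one)
qed

text \<open>Around a point \<open>s\<close> only the coordinates vanishing at \<open>s\<close> are
  local equations of the divisor; the powers of the others form a factor that does not vanish at
  \<open>u = 0\<close>.\<close>

lemma mono_pow_shift:
  "mono_pow e (u + s) = mono_pow (\<lambda>j. if s $ j = 0 then e j else 0) u
     * (\<Prod>j\<in>UNIV. if s $ j = 0 then 1 else (u $ j + s $ j) ^ e j)"
  unfolding mono_pow_def prod.distrib[symmetric] by (intro prod.cong) auto

section \<open>Exponents and Jacobians in the charts\<close>

context weighted_blowup begin

text \<open>Exponents of the monomial \<open>E\<close>: it is \<open>u_z\<close>,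
  \<open>u_i\<^sup>2\<close> and \<open>u_i u_z\<^sup>2\<close> in the three kinds of charts, and
  generates the pulled back second ideal.\<close>

definition ek :: "'n \<times> 'n \<Rightarrow> 'n \<Rightarrow> nat" where
  "ek c j = (case c of (a, b) \<Rightarrow> if j = b then (if a = b \<and> b \<noteq> z then 2 else 1) else if j = a then 2 else 0)"

text \<open>Exponents of the Jacobian. Against the exponents \<open>2 * ek\<close> of the
  divergence, the quotients \<open>(h + 1) / k\<close> are \<open>n / 2\<close> and
  \<open>(n + 1) / 4\<close> with \<open>n = CARD('n)\<close>, in accordance with the volume
  exponent.\<close>

definition dk :: "'n \<times> 'n \<Rightarrow> 'n \<Rightarrow> nat" where
  "dk c j = (case c of (a, b) \<Rightarrow> if j = b then (if a = b \<and> b \<noteq> z then CARD('n) else CARD('n) - 1)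
      else if j = a then CARD('n) else 0)"

text \<open>\<open>e1\<close> and \<open>e2\<close> are the first moment and the squared scale
  \<open>sc\<close> after division by \<open>E\<close>. One of them is the constant 1 in each chart,
  because the ideal has become principal.\<close>

definition e1 :: "'n \<times> 'n \<Rightarrow> real ^ 'n \<Rightarrow> real" where
  "e1 c u = (if fst c = z then 1 else u $ z)"

definition e2 :: "'n \<times> 'n \<Rightarrow> real ^ 'n \<Rightarrow> real" where
  "e2 c u = (if fst c = z then u $ snd c else 1)"

lemma mono_pow_pair:
  "mono_pow (\<lambda>j. if j = b then p else if j = a then q else 0) u = (if a = b then (u $ b) ^ p else (u $ b) ^ p * (u $ a) ^ q)"
proof (cases "a = b")
  case True
  then have "(\<lambda>j. if j = b then p else if j = a then q else 0) = (\<lambda>j. if j = b then p else 0)" by auto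
  then show ?thesis using True by (simp add: mono_pow_one)
qed (simp add: mono_pow_two)

lemma mono_ek: "mono_pow (ek (a, b)) u =
   (if a = b then (u $ b) ^ (if b \<noteq> z then 2 else 1) else u $ b * (u $ a)\<^sup>2)"
  unfolding ek_def prod.case mono_pow_pair by simp

lemma psi_z: "c \<in> vert \<Longrightarrow> psi c u $ z = mono_pow (ek c) u * e1 c u"
  by (cases rule: vert_cases) (auto simp: mono_ek e1_def psi_def sc_def wv_def power2_eq_square)

lemma sc_sq: "c \<in> vert \<Longrightarrow> (sc c u)\<^sup>2 = mono_pow (ek c) u * e2 c u"
  by (cases rule: vert_cases) (auto simp: mono_ek e2_def sc_def power2_eq_square)

lemma e12_nonzero: "e1 c u \<noteq> 0 \<or> e2 c u \<noteq> 0"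
  by (simp add: e1_def e2_def)

lemma wv_one: "wv c u $ snd c = 1"
  by (cases c) (simp add: wv_def)

lemma linear_dstar: "linear (dstar c S u :: real ^ 'n \<Rightarrow> _)"
  using star_has_derivative[of c S u] has_derivative_linear by blast

text \<open>\<open>psi\<close> is the blow-up of the origin in the chart \<open>snd c\<close>,
  preceded for \<open>(i, i)\<close> and \<open>(z, i)\<close> by the substitution blowing up
  \<open>u_z = u_i = 0\<close>. The determinants of the \<open>star\<close> maps multiply.\<close>

lemma psi_has_derivative:
  assumes c: "c \<in> vert"
  shows "\<exists>D. (psi c has_derivative D) (at u) \<and> linear D \<and> det (matrix D) = mono_pow (dk c) u"
proof -
  have n1: "CARD('n) \<ge> 1" by (simp add: Suc_leI)
  have comp: "((star a S \<circ> star b S') has_derivative (dstar a S (star b S' u) \<circ> dstar b S' u)) (at u)" for a b :: 'n and S S'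
    by (rule diff_chain_at[OF star_has_derivative star_has_derivative])
  from c show ?thesis
  proof (cases rule: vert_cases)
    case 1
    have "psi c = star z (- {z})"
      by (rule ext) (auto simp: 1 psi_def sc_def wv_def star_def vec_eq_iff)
    moreover have "det (matrix (dstar z (- {z}) u)) = mono_pow (dk c) u"
      unfolding 1 dk_def prod.case mono_pow_pair by (subst det_dstar) (auto simp: card_Diff_singleton Compl_eq_Diff_UNIV)
    ultimately show ?thesis using star_has_derivative[of z "- {z}" u] linear_dstar by metis
  next
    case (2 i)
    have "psi c = star i (- {i}) \<circ> star i {z}"
      using 2 by (intro ext) (auto simp: psi_def sc_def wv_def star_def vec_eq_iff)
    moreover have "det (matrix (dstar i (- {i}) (star i {z} u) \<circ> dstar i {z} u)) = mono_pow (dk c) u"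
    proof -
      have "det (matrix (dstar i (- {i}) (star i {z} u) \<circ> dstar i {z} u)) = (u $ i) ^ (CARD('n) - 1) * u $ i"
        using 2 by (subst det_matrix_comp[OF linear_dstar linear_dstar], subst (1 2) det_dstar)
          (auto simp: card_Diff_singleton Compl_eq_Diff_UNIV star_def)
      also have "\<dots> = (u $ i) ^ CARD('n)" using n1 by (metis Suc_diff_1 le_eq_less_or_eq less_le_trans mult.commute power_Suc zero_less_one)
      finally show ?thesis unfolding 2 dk_def prod.case mono_pow_pair using 2 by simp
    qed
    ultimately show ?thesis using comp linear_compose[OF linear_dstar linear_dstar] by metis
  next
    case (3 i)
    have "psi c = star i (- {i}) \<circ> star z {i}"
      using 3 by (intro ext) (auto simp: psi_def sc_def wv_def star_def vec_eq_iff)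
    moreover have "det (matrix (dstar i (- {i}) (star z {i} u) \<circ> dstar z {i} u)) = mono_pow (dk c) u"
    proof -
      have "det (matrix (dstar i (- {i}) (star z {i} u) \<circ> dstar z {i} u)) = (u $ z * u $ i) ^ (CARD('n) - 1) * u $ z"
        using 3 by (subst det_matrix_comp[OF linear_dstar linear_dstar], subst (1 2) det_dstar)
          (auto simp: card_Diff_singleton Compl_eq_Diff_UNIV star_def)
      also have "\<dots> = (u $ i) ^ (CARD('n) - 1) * (u $ z * (u $ z) ^ (CARD('n) - 1))"
        by (simp add: power_mult_distrib)
      also have "u $ z * (u $ z) ^ (CARD('n) - 1) = (u $ z) ^ CARD('n)"
        using n1 by (metis Suc_diff_1 le_eq_less_or_eq less_le_trans power_Suc zero_less_one)
      also have "(u $ i) ^ (CARD('n) - 1) * (u $ z) ^ CARD('n) = mono_pow (dk c) u" unfolding 3(2) dk_def prod.case mono_pow_pair using 3(1) by simp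
      finally show ?thesis .
    qed
    ultimately show ?thesis using comp linear_compose[OF linear_dstar linear_dstar] by metis
  qed
qed

end

sublocale mixture_model \<subseteq> weighted_blowup z .

section \<open>The divergence in the charts\<close>

context mixture_model begin

text \<open>With \<open>p = q (1 + r)\<close>, minus the logarithm of \<open>1 + r\<close> is
  \<open>r\<^sup>2 * log_rem r - r\<close>, and the terms \<open>q r\<close> sum to 0.\<close>

lemma KL_log_rem:
  assumes "\<theta> \<in> params"
  shows "KL \<theta> = (\<Sum>x\<le>M. (mix x \<theta> - tru x)\<^sup>2 / tru x * log_rem ((mix x \<theta> - tru x) / tru x))"
proof -
  have "tru x * ln (tru x / mix x \<theta>) = (mix x \<theta> - tru x)\<^sup>2 / tru x * log_rem ((mix x \<theta> - tru x) / tru x) + (tru x - mix x \<theta>)"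
    if x: "x \<le> M" for x
  proof -
    note pos = tru_pos[OF x] mix_pos[OF assms x]
    let ?r = "(mix x \<theta> - tru x) / tru x"
    have "1 + ?r = mix x \<theta> / tru x" using pos by (simp add: field_simps)
    then have "ln (tru x / mix x \<theta>) = - ln (1 + ?r)" using pos by (simp add: ln_div)
    also have "\<dots> = ?r\<^sup>2 * log_rem ?r - ?r" using log_rem_mult[of ?r] by simp
    finally have L: "ln (tru x / mix x \<theta>) = ?r\<^sup>2 * log_rem ?r - ?r" .
    have "tru x * ln (tru x / mix x \<theta>) = tru x * ?r\<^sup>2 * log_rem ?r - tru x * ?r"
      unfolding L by (simp only: right_diff_distrib mult.assoc)
    moreover have "tru x * ?r\<^sup>2 = (mix x \<theta> - tru x)\<^sup>2 / tru x" "tru x * ?r = mix x \<theta> - tru x"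
      using pos by (simp_all add: power2_eq_square)
    ultimately show ?thesis by simp
  qed
  then have "KL \<theta> = (\<Sum>x\<le>M. (mix x \<theta> - tru x)\<^sup>2 / tru x * log_rem ((mix x \<theta> - tru x) / tru x) + (tru x - mix x \<theta>))"
    unfolding KL_def by (intro sum.cong) auto
  then show ?thesis by (simp add: sum.distrib sum_subtractf sum_tru sum_mix)
qed

text \<open>The difference \<open>p - q\<close> divided by \<open>E\<close>. As a polynomial in
  \<open>u\<close> it makes sense on the divisor too, and \<open>unit\<close> is then the divergence
  divided by the square of \<open>E\<close>.\<close>

definition cquot :: "'n \<times> 'n \<Rightarrow> nat \<Rightarrow> real ^ 'n \<Rightarrow> real" where
  "cquot c x u = quot x (e1 c u) (e2 c u) (sc c u) (\<lambda>i. lin (wv c u) $ i)"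

definition unit :: "'n \<times> 'n \<Rightarrow> real ^ 'n \<Rightarrow> real" where
  "unit c u = (\<Sum>x\<le>M. (cquot c x u)\<^sup>2 / tru x * log_rem (mono_pow (ek c) u * cquot c x u / tru x))"

lemma mix_cquot:
  assumes "c \<in> vert"
  shows "mix x (coord (psi c u)) - tru x = mono_pow (ek c) u * cquot c x u"
  unfolding cquot_def
proof (rule mix_tru_quot)
  show "m1 (coord (psi c u)) = mono_pow (ek c) u * e1 c u"
    unfolding m1_coord by (rule psi_z[OF assms])
  show "(sc c u)\<^sup>2 = mono_pow (ek c) u * e2 c u" by (rule sc_sq[OF assms])
  show "coord (psi c u) $ i - \<theta>\<^sub>0 = sc c u * lin (wv c u) $ i" for i
    unfolding coord_component psi_def by (simp add: linear_scale[OF linear_lin])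
qed

lemma KL_unit:
  assumes "c \<in> vert" "coord (psi c u) \<in> params"
  shows "KL (coord (psi c u)) = (mono_pow (ek c) u)\<^sup>2 * unit c u"
  unfolding KL_log_rem[OF assms(2)] mix_cquot[OF assms(1)] unit_def
  by (simp add: sum_distrib_left power_mult_distrib mult_ac)

lemma unit_arg_gt:
  assumes "c \<in> vert" "coord (psi c u) \<in> params" "x \<le> M"
  shows "mono_pow (ek c) u * cquot c x u / tru x > -1"
  using mix_pos[OF assms(2,3)] tru_pos[OF assms(3)] mix_cquot[OF assms(1), of x u]
  by (simp add: field_simps)

lemma real_analytic_lin:
  assumes "\<And>i. real_analytic_at (\<lambda>y. f y $ i) y"
  shows "real_analytic_at (\<lambda>y. lin (f y) $ i) y"
  unfolding lin_def vec_lambda_beta divide_inverse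
  by (intro real_analytic_at_if real_analytic_at_mult real_analytic_at_diff real_analytic_at_sum
      real_analytic_at_const assms)

lemma real_analytic_mono_pow: "real_analytic_at (mono_pow e) u"
  unfolding mono_pow_def[abs_def] by (intro real_analytic_intros)

lemma real_analytic_unit:
  assumes "c \<in> vert" "coord (psi c u) \<in> params"
  shows "real_analytic_at (unit c) u"
proof -
  have "real_analytic_at (e1 c) u" "real_analytic_at (e2 c) u"
    unfolding e1_def[abs_def] e2_def[abs_def] by (intro real_analytic_at_if real_analytic_intros)+
  then have q: "real_analytic_at (cquot c x) u" for x
    unfolding cquot_def[abs_def] quot_def
    by (intro real_analytic_at_add real_analytic_at_mult real_analytic_at_sum real_analytic_at_const
        real_analytic_at_power real_analytic_at_poly real_analytic_lin real_analytic_wv real_analytic_sc)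
  show ?thesis
    unfolding unit_def[abs_def] divide_inverse
    using unit_arg_gt[OF assms]
    by (intro real_analytic_at_sum real_analytic_at_mult real_analytic_at_power real_analytic_at_const q
        real_analytic_at_log_rem real_analytic_mono_pow) (simp add: divide_inverse)
qed

text \<open>On the fibre \<open>sc\<close> vanishes, since \<open>wv\<close> has an entry 1, and
  \<open>lin (wv c u)\<close> is nonzero by injectivity of \<open>lin\<close>. So
  \<open>quot_nonzero\<close> yields a nonzero \<open>cquot\<close>, and all summands of
  \<open>unit\<close> are nonnegative by positivity of \<open>log_rem\<close>.\<close>

lemma unit_nonzero:
  assumes "c \<in> vert" "psi c u = 0"
  shows "unit c u \<noteq> 0"
proof -
  have par: "coord (psi c u) \<in> params"
    using assms(2) base_in_params linear_0[OF linear_lin] by (simp add: coord_def)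
  have "sc c u = 0" using assms(2) wv_one[of c u] by (auto simp: psi_def)
  moreover have "\<exists>i. lin (wv c u) $ i \<noteq> 0"
  proof (rule ccontr)
    assume "\<not> ?thesis"
    then have "lin (wv c u) = 0" by (simp add: vec_eq_iff)
    then have "wv c u = 0" using unlin_lin[of "wv c u"] linear_0[OF linear_unlin] by simp
    then show False using wv_one[of c u] by simp
  qed
  ultimately obtain x where x: "x \<le> M" "cquot c x u \<noteq> 0"
    using quot_nonzero[of "e1 c u" "e2 c u" "\<lambda>i. lin (wv c u) $ i"] e12_nonzero[of c u]
    unfolding cquot_def by metis
  let ?t = "\<lambda>x. (cquot c x u)\<^sup>2 / tru x * log_rem (mono_pow (ek c) u * cquot c x u / tru x)"
  have nn: "0 \<le> ?t y" if "y \<le> M" for y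
    using tru_pos[OF that] log_rem_pos[OF unit_arg_gt[OF assms(1) par that]] by simp
  have "0 < ?t x"
    using tru_pos[OF x(1)] log_rem_pos[OF unit_arg_gt[OF assms(1) par x(1)]] x(2) by simp
  also have "\<dots> \<le> unit c u"
    unfolding unit_def using x(1) nn by (intro member_le_sum) auto
  finally show ?thesis by simp
qed

end

lemma second_countable_euclid: "second_countable (euclidean :: 'a::second_countable_topology topology)"
proof -
  obtain B :: "'a set set" where B: "countable B" "topological_basis B" using ex_countable_basis by blast
  show ?thesis unfolding second_countable_def
  proof (intro exI[of _ B] conjI ballI allI impI)
    show "openin euclidean V" if "V \<in> B" for V using topological_basis_open[OF B(2) that] by simp
    fix U :: "'a set" and x assume "openin euclidean U \<and> x \<in> U"
    then show "\<exists>V\<in>B. x \<in> V \<and> V \<subseteq> U" using topological_basisE[OF B(2), of U x] by (metis open_openin)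
  qed (rule B(1))
qed

section \<open>The manifold over a neighbourhood, its atlas and its projection\<close>

context mixture_model begin

definition gmap :: "(nat \<Rightarrow> real) \<Rightarrow> real ^ 'n" where "gmap p = coord (crd p)"

definition XW :: "(real ^ 'n) set \<Rightarrow> (nat \<Rightarrow> real) set" where
  "XW W = {p \<in> pts. gmap p \<in> W}"

definition VW :: "(real ^ 'n) set \<Rightarrow> 'n \<times> 'n \<Rightarrow> (nat \<Rightarrow> real) set" where
  "VW W c = {p \<in> XW W. prj p c c \<noteq> 0}"

definition cmap :: "'n \<times> 'n \<Rightarrow> real ^ 'n \<Rightarrow> (nat \<Rightarrow> real) \<Rightarrow> real ^ 'n" where
  "cmap c s p = phi c p - s"

text \<open>All translates of the charts are in the atlas, so that every point has a centered one.\<close>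

definition atlas :: "(real ^ 'n) set \<Rightarrow> (nat \<Rightarrow> real, 'n) chart set" where
  "atlas W = {(VW W c, cmap c s) |c s. c \<in> vert}"

lemma atlasI: "c \<in> vert \<Longrightarrow> (VW W c, cmap c s) \<in> atlas W"
  unfolding atlas_def by blast

lemma continuous_on_coord: "continuous_on S coord"
  by (intro continuous_at_imp_continuous_on ballI has_derivative_continuous[OF coord_has_derivative])

lemma continuous_on_gmap: "continuous_on S gmap"
  unfolding gmap_def[abs_def] by (rule continuous_on_compose2[OF continuous_on_coord[of UNIV] continuous_on_crd]) simp

lemma gmap_Psi: "gmap (Psi c u) = coord (psi c u)"
  by (simp add: gmap_def crd_Psi)

lemma continuous_on_coord_psi: "continuous_on S (\<lambda>u. coord (psi c (u + s)))"
  by (rule continuous_on_compose2[OF continuous_on_coord[of UNIV]])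
     (auto intro!: continuous_on_compose2[OF continuous_on_psi[of UNIV]] continuous_intros)

lemma cmap_image:
  assumes "c \<in> vert"
  shows "cmap c s ` VW W c = {u. coord (psi c (u + s)) \<in> W}"
proof safe
  fix p assume p: "p \<in> VW W c"
  then have "Psi c (phi c p) = p" using assms by (intro Psi_phi) (auto simp: VW_def XW_def)
  then have "coord (psi c (phi c p)) = gmap p" using gmap_Psi[of c "phi c p"] by simp
  then show "coord (psi c (cmap c s p + s)) \<in> W" using p by (simp add: cmap_def VW_def XW_def)
next
  fix u assume u: "coord (psi c (u + s)) \<in> W"
  have "Psi c (u + s) \<in> VW W c"
    using u assms prj_Psi_self(2)[of c "u + s"] by (auto simp: VW_def XW_def gmap_Psi pts_def)
  moreover have "cmap c s (Psi c (u + s)) = u" by (simp add: cmap_def phi_Psi[OF assms])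
  ultimately show "u \<in> cmap c s ` VW W c" by (metis image_eqI)
qed

lemma Psi_cmap:
  assumes "c \<in> vert" "p \<in> VW W c"
  shows "Psi c (cmap c s p + s) = p"
  using assms by (simp add: cmap_def Psi_phi VW_def XW_def)

lemma inj_on_cmap: "c \<in> vert \<Longrightarrow> inj_on (cmap c s) (VW W c)"
  by (metis Psi_cmap inj_onI)

lemma Psi_in_VW:
  assumes "c \<in> vert" "coord (psi c (u + s)) \<in> W"
  shows "Psi c (u + s) \<in> VW W c" "cmap c s (Psi c (u + s)) = u"
  using assms prj_Psi_self(2)[of c "u + s"]
  by (auto simp: VW_def XW_def gmap_Psi pts_def cmap_def phi_Psi)

lemma inv_into_cmap:
  assumes "c \<in> vert" "u \<in> cmap c s ` VW W c"
  shows "inv_into (VW W c) (cmap c s) u = Psi c (u + s)"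
proof -
  have "coord (psi c (u + s)) \<in> W" using assms cmap_image by blast
  from Psi_in_VW[OF assms(1) this] inj_on_cmap[OF assms(1)] show ?thesis
    by (metis inv_into_f_f)
qed

lemma is_chart_cmap:
  assumes W: "open W" and c: "c \<in> vert"
  shows "is_chart (top_of_set (XW W)) (VW W c, cmap c s)"
proof -
  let ?V = "VW W c" and ?\<phi> = "cmap c s"
  have op: "open {p. prj p c c \<noteq> 0}"
    by (intro open_Collect_neq continuous_on_prj continuous_on_const)
  have hom: "homeomorphism ?V (?\<phi> ` ?V) ?\<phi> (\<lambda>u. Psi c (u + s))"
  proof (rule homeomorphismI)
    show "continuous_on ?V ?\<phi>"
      unfolding cmap_def[abs_def] by (intro continuous_intros continuous_on_phi) (simp add: VW_def)
    show "continuous_on (?\<phi> ` ?V) (\<lambda>u. Psi c (u + s))"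
      by (rule continuous_on_compose2[OF continuous_on_Psi[of UNIV]]) (auto intro!: continuous_intros)
    show "(\<lambda>u. Psi c (u + s)) ` ?\<phi> ` ?V \<subseteq> ?V" using Psi_cmap[OF c] by auto
    show "Psi c (?\<phi> p + s) = p" if "p \<in> ?V" for p by (rule Psi_cmap[OF c that])
    show "?\<phi> (Psi c (u + s)) = u" if "u \<in> ?\<phi> ` ?V" for u
      using that Psi_in_VW(2)[OF c] unfolding cmap_image[OF c] by blast
  qed simp
  have "homeomorphic_maps (top_of_set ?V) (top_of_set (?\<phi> ` ?V)) ?\<phi> (\<lambda>u. Psi c (u + s))"
    using hom by (auto simp: homeomorphism_def homeomorphic_maps_def continuous_map_iff_continuous2)
  then have hmap: "homeomorphic_map (top_of_set ?V) (top_of_set (?\<phi> ` ?V)) ?\<phi>"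
    unfolding homeomorphic_map_maps by blast
  have "openin (top_of_set (XW W)) ?V"
    unfolding openin_open VW_def using op by (intro exI[of _ "{p. prj p c c \<noteq> 0}"]) auto
  moreover have "open (?\<phi> ` ?V)"
    unfolding cmap_image[OF c] using open_vimage[OF W continuous_on_coord_psi[of UNIV c s]] by (simp add: vimage_def)
  moreover have "subtopology (top_of_set (XW W)) ?V = top_of_set ?V"
    by (simp add: subtopology_subtopology VW_def Collect_conj_eq Int_absorb1 inf.absorb2 subset_iff)
  ultimately show ?thesis using hmap by (simp add: is_chart_def)
qed

text \<open>The transition is a translate of \<open>phi c' \<circ> Psi c\<close>, whose components
  are quotients with denominators that do not vanish on the overlap.\<close>

lemma chart_transition:
  assumes W: "open W" and c: "c \<in> vert" and c': "c' \<in> vert"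
  shows "analytic_transition (VW W c, cmap c s) (VW W c', cmap c' s')"
proof -
  let ?S = "cmap c s ` (VW W c \<inter> VW W c')"
  have op: "open ?S"
    by (rule is_chartD(5)[OF is_chart_cmap[OF W c] is_chartD(1)[OF is_chart_cmap[OF W c']]])
  have "real_analytic_at (\<lambda>u. (cmap c' s' \<circ> inv_into (VW W c) (cmap c s)) u $ j) u" if u: "u \<in> ?S" for u j
  proof (rule real_analytic_at_transform[OF _ op u])
    obtain p where p: "p \<in> VW W c" "p \<in> VW W c'" "u = cmap c s p" using u by auto
    have "Psi c (u + s) = p" using Psi_cmap[OF c p(1)] p(3) by simp
    then have "prj (Psi c (u + s)) c' c' \<noteq> 0" using p(2) by (simp add: VW_def)
    then show "real_analytic_at (\<lambda>u. phi c' (Psi c (u + s)) $ j - s' $ j) u"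
      by (intro real_analytic_at_diff real_analytic_at_const real_analytic_at_shift real_analytic_phi_Psi)
    fix y assume "y \<in> ?S"
    then have "y \<in> cmap c s ` VW W c" by blast
    then show "phi c' (Psi c (y + s)) $ j - s' $ j = (cmap c' s' \<circ> inv_into (VW W c) (cmap c s)) y $ j"
      using inv_into_cmap[OF c] by (simp add: cmap_def)
  qed
  then show ?thesis by (simp add: analytic_transition_def analytic_map_on_def real_analytic_on_def)
qed

lemma atlas_cover: "(\<Union>C\<in>atlas W. fst C) = XW W"
proof
  show "(\<Union>C\<in>atlas W. fst C) \<subseteq> XW W" by (auto simp: atlas_def VW_def)
  show "XW W \<subseteq> (\<Union>C\<in>atlas W. fst C)"
  proof
    fix p assume p: "p \<in> XW W"
    then obtain c u where c: "c \<in> vert" "p = Psi c u" by (auto simp: XW_def pts_def)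
    then have "p \<in> VW W c" using p prj_Psi_self(2)[of c u] by (simp add: VW_def)
    moreover have "(VW W c, cmap c 0) \<in> atlas W" by (rule atlasI[OF c(1)])
    ultimately show "p \<in> (\<Union>C\<in>atlas W. fst C)" by (intro UN_I[of "(VW W c, cmap c 0)"]) auto
  qed
qed

lemma blowup_manifold:
  assumes W: "open W"
  shows "analytic_manifold (top_of_set (XW W)) (atlas W)"
  unfolding analytic_manifold_def
proof (intro conjI ballI)
  show "Hausdorff_space (top_of_set (XW W))" by (simp add: Hausdorff_space_subtopology)
  show "second_countable (top_of_set (XW W))" by (rule second_countable_subtopology) (rule second_countable_euclid)
  show "(\<Union>C\<in>atlas W. fst C) = topspace (top_of_set (XW W))" by (simp add: atlas_cover)
  show "is_chart (top_of_set (XW W)) C" if "C \<in> atlas W" for C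
    using that is_chart_cmap[OF W] by (auto simp: atlas_def)
  show "analytic_transition C C'" if "C \<in> atlas W" "C' \<in> atlas W" for C C'
    using that chart_transition[OF W] by (auto simp: atlas_def)
qed

lemma gmap_eq_base_iff: "gmap p = base \<longleftrightarrow> crd p = (0 :: real ^ 'n)"
  using bij_coord(2)[of "crd p"] linear_0[OF linear_lin] linear_0[OF linear_unlin]
  by (auto simp: gmap_def coord_def)

text \<open>By \<open>bounded_chart\<close>, the preimage of a compact set is a finite union of
  continuous images of compact parts of one fixed box.\<close>

lemma blowup_proper:
  assumes W: "open W"
  shows "proper_map (top_of_set (XW W)) (top_of_set W) gmap"
proof (rule compact_imp_proper_map)
  show "k_space (top_of_set W)"
    by (intro metrizable_imp_k_space metrizable_space_subtopology metrizable_space_euclidean)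
  show "kc_space (top_of_set W)"
    by (intro Hausdorff_imp_kc_space Hausdorff_space_subtopology) simp
  show "gmap \<in> topspace (top_of_set (XW W)) \<rightarrow> topspace (top_of_set W)"
    by (auto simp: XW_def)
  show "continuous_map (top_of_set (XW W)) (top_of_set W) gmap \<or> kc_space (top_of_set (XW W))"
    by (intro disjI1) (auto simp: continuous_on_gmap XW_def)
  fix K assume "compactin (top_of_set W) K"
  then have K: "compact K" "K \<subseteq> W" by (auto simp: compactin_subtopology)
  have "continuous_on K (\<lambda>\<theta>. unlin (\<theta> - base))"
    by (rule continuous_on_compose2[OF linear_continuous_on[OF linear_conv_bounded_linear[THEN iffD1, OF linear_unlin], of UNIV]])
       (auto intro!: continuous_intros)
  then have "bounded ((\<lambda>\<theta>. unlin (\<theta> - base)) ` K)"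
    using K(1) compact_continuous_image compact_imp_bounded by blast
  then obtain B0 where B0: "\<And>\<theta>. \<theta> \<in> K \<Longrightarrow> norm (unlin (\<theta> - base)) \<le> B0"
    unfolding bounded_iff by blast
  \<comment> \<open>1 bounds the chart coordinates that are ratios, \<open>B0\<close> those that are
    coordinates of the image.\<close>
  define B where "B = max 1 B0"
  define box where "box = cbox (\<chi> i. - B) (\<chi> i. B :: real ^ 'n)"
  have eq: "{p \<in> topspace (top_of_set (XW W)). gmap p \<in> K} = (\<Union>c\<in>vert. Psi c ` (box \<inter> {u. coord (psi c (u + 0)) \<in> K}))"
  proof (intro equalityI subsetI)
    fix p assume "p \<in> {p \<in> topspace (top_of_set (XW W)). gmap p \<in> K}"
    then have p: "p \<in> pts" "gmap p \<in> K" by (auto simp: XW_def)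
    obtain c u where c: "c \<in> vert" and pu: "p = Psi c u" and u: "\<And>j. \<bar>u $ j\<bar> \<le> 1 \<or> u $ j = psi c u $ j"
      using bounded_chart[OF p(1)] by metis
    have g: "coord (psi c u) \<in> K" using p(2) by (simp add: pu gmap_Psi)
    then have "norm (psi c u) \<le> B0" using B0[OF g] by (simp add: bij_coord)
    then have "\<bar>psi c u $ j\<bar> \<le> B0" for j using component_le_norm_cart[of "psi c u" j] by linarith
    then have "\<bar>u $ j\<bar> \<le> B" for j using u[of j] by (metis B_def le_max_iff_disj)
    then have "u \<in> box" by (auto simp: box_def mem_box_cart abs_le_iff minus_le_iff)
    then show "p \<in> (\<Union>c\<in>vert. Psi c ` (box \<inter> {u. coord (psi c (u + 0)) \<in> K}))" using c g pu by auto
  next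
    fix p assume "p \<in> (\<Union>c\<in>vert. Psi c ` (box \<inter> {u. coord (psi c (u + 0)) \<in> K}))"
    then show "p \<in> {p \<in> topspace (top_of_set (XW W)). gmap p \<in> K}"
      using K(2) by (auto simp: XW_def gmap_Psi pts_def)
  qed
  have "compact (Psi c ` (box \<inter> {u. coord (psi c (u + 0)) \<in> K}))" for c
  proof (rule compact_continuous_image[OF continuous_on_Psi])
    have "closed ((\<lambda>u. coord (psi c (u + 0))) -` K)"
      using compact_imp_closed[OF K(1)] continuous_on_coord_psi[of UNIV c 0] by (rule closed_vimage)
    then show "compact (box \<inter> {u. coord (psi c (u + 0)) \<in> K})"
      unfolding box_def by (intro compact_Int_closed compact_cbox) (simp add: vimage_def)
  qed
  then have "compact {p \<in> topspace (top_of_set (XW W)). gmap p \<in> K}"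
    unfolding eq by (intro compact_UN) simp_all
  then show "compactin (top_of_set (XW W)) {p \<in> topspace (top_of_set (XW W)). gmap p \<in> K}"
    by (auto simp: compactin_subtopology)
qed

text \<open>The chart is translated so that \<open>Q\<close> gets coordinate 0. The powers of
  coordinates that do not vanish at \<open>Q\<close> are moved into the units \<open>a\<close> and
  \<open>b\<close>.\<close>

lemma blowup_normal_crossing:
  assumes W: "open W" "W \<subseteq> params" and K: "\<And>\<theta>. \<theta> \<in> params \<Longrightarrow> K \<theta> = KL \<theta>"
    and Q: "Q \<in> XW W" "gmap Q = base"
  shows "\<exists>k h. normal_crossing K (top_of_set (XW W)) (atlas W) gmap Q k h"
proof -
  obtain c u0 where c: "c \<in> vert" "Q = Psi c u0" using Q(1) by (auto simp: XW_def pts_def)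
  have QV: "Q \<in> VW W c" using Q(1) c prj_Psi_self(2)[of c u0] by (simp add: VW_def)
  define s where "s = phi c Q"
  have Qs: "Psi c s = Q" unfolding s_def using QV c(1) by (intro Psi_phi) (auto simp: VW_def XW_def)
  have psi0: "psi c s = 0" using Q(2) unfolding gmap_eq_base_iff Qs[symmetric] crd_Psi .
  let ?V = "VW W c" and ?\<phi> = "cmap c s"
  let ?O = "?\<phi> ` ?V"
  have chart: "is_chart (top_of_set (XW W)) (?V, ?\<phi>)" by (rule is_chart_cmap[OF W(1) c(1)])
  have opO: "open ?O" by (rule is_chartD(3)[OF chart])
  have tr: "analytic_transition (?V, ?\<phi>) C' \<and> analytic_transition C' (?V, ?\<phi>)" if C': "C' \<in> atlas W" for C'
  proof -
    obtain c' s' where "c' \<in> vert" "C' = (VW W c', cmap c' s')" using C' unfolding atlas_def by blast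
    then show ?thesis using chart_transition[OF W(1) c(1)] chart_transition[OF W(1) _ c(1)] by simp
  qed
  have Q0: "?\<phi> Q = 0" by (simp add: cmap_def s_def)
  have loc: "local_coordinates (top_of_set (XW W)) (atlas W) Q (?V, ?\<phi>)"
    unfolding local_coordinates_def fst_conv snd_conv
    using chart QV tr Q0 by blast
  have inW: "coord (psi c (u + s)) \<in> W" if "u \<in> ?O" for u using that cmap_image[OF c(1)] by blast
  have ginv: "gmap (inv_into ?V ?\<phi> u) = coord (psi c (u + s))" if "u \<in> ?O" for u
    using inv_into_cmap[OF c(1) that] by (simp add: gmap_Psi)
  \<comment> \<open>After translation \<open>u_j\<close> is a local equation of the divisor only if
    \<open>s_j = 0\<close>; for the other coordinates the exponent becomes 0 and the power goes into
    \<open>rest\<close>.\<close>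
  define k where "k j = (if s $ j = 0 then 2 * ek c j else 0)" for j
  define h where "h j = (if s $ j = 0 then dk c j else 0)" for j
  define rest where "rest e u = (\<Prod>j\<in>UNIV. if s $ j = 0 then 1 else (u $ j + s $ j) ^ e j)" for e :: "'n \<Rightarrow> nat" and u
  have rest_an: "real_analytic_at (rest e) u" for e u
    unfolding rest_def[abs_def] by (intro real_analytic_at_prod real_analytic_at_if real_analytic_intros)
  have rest0: "rest e 0 \<noteq> 0" for e by (simp add: rest_def)
  define a where "a u = unit c (u + s) * rest (\<lambda>j. 2 * ek c j) u" for u
  define b where "b u = det (matrix lin) * rest (dk c) u" for u
  have "real_analytic_on a ?O"
    unfolding real_analytic_on_def a_def
    using inW W(2) by (intro ballI real_analytic_at_mult rest_an real_analytic_at_shift real_analytic_unit c(1)) auto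
  moreover have "real_analytic_on b ?O"
    unfolding real_analytic_on_def b_def by (intro ballI real_analytic_at_mult rest_an real_analytic_at_const)
  moreover have "a 0 \<noteq> 0" using unit_nonzero[OF c(1), of "0 + s"] psi0 rest0 by (simp add: a_def)
  moreover have "b 0 \<noteq> 0" using det_lin rest0 by (simp add: b_def)
  moreover have "K (gmap (inv_into ?V ?\<phi> u)) = a u * (\<Prod>i\<in>UNIV. (u $ i) ^ k i)" if u: "u \<in> ?O" for u
  proof -
    have par: "coord (psi c (u + s)) \<in> params" using inW[OF u] W(2) by blast
    have "K (gmap (inv_into ?V ?\<phi> u)) = (mono_pow (ek c) (u + s))\<^sup>2 * unit c (u + s)"
      unfolding ginv[OF u] K[OF par] by (rule KL_unit[OF c(1) par])
    also have "(mono_pow (ek c) (u + s))\<^sup>2 = mono_pow (\<lambda>j. 2 * ek c j) (u + s)"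
      by (simp add: mono_pow_def prod_power_distrib power_mult[symmetric] mult.commute)
    also have "\<dots> = mono_pow k u * rest (\<lambda>j. 2 * ek c j) u"
      unfolding mono_pow_shift[of _ u s] k_def rest_def ..
    finally show ?thesis by (simp add: a_def mono_pow_def mult_ac)
  qed
  moreover have "\<bar>det (jacobian (gmap \<circ> inv_into ?V ?\<phi>) (at u))\<bar> = \<bar>b u * (\<Prod>i\<in>UNIV. (u $ i) ^ h i)\<bar>" if u: "u \<in> ?O" for u
  proof -
    obtain D where D: "(psi c has_derivative D) (at (u + s))" "linear D" "det (matrix D) = mono_pow (dk c) (u + s)"
      using psi_has_derivative[OF c(1)] by blast
    have "((\<lambda>u. u + s) has_derivative (\<lambda>v. v)) (at u)" by (auto intro!: derivative_eq_intros)
    from diff_chain_at[OF diff_chain_at[OF this D(1)] coord_has_derivative]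
    have "((coord \<circ> (psi c \<circ> (\<lambda>u. u + s))) has_derivative (lin \<circ> (D \<circ> (\<lambda>v. v)))) (at u)" .
    then have "((gmap \<circ> inv_into ?V ?\<phi>) has_derivative (lin \<circ> (D \<circ> (\<lambda>v. v)))) (at u)"
      by (rule has_derivative_transform_within_open[OF _ opO u]) (simp add: ginv)
    then have "frechet_derivative (gmap \<circ> inv_into ?V ?\<phi>) (at u) = lin \<circ> D"
      using frechet_derivative_at by (fastforce simp: o_def)
    then have "det (jacobian (gmap \<circ> inv_into ?V ?\<phi>) (at u)) = det (matrix lin) * mono_pow (dk c) (u + s)"
      unfolding jacobian_def by (simp only: det_matrix_comp[OF linear_lin D(2)] D(3))
    also have "\<dots> = b u * mono_pow h u"
      unfolding mono_pow_shift[of _ u s] b_def rest_def h_def by simp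
    finally show ?thesis by (simp add: mono_pow_def)
  qed
  ultimately show ?thesis unfolding normal_crossing_def using loc by blast
qed

text \<open>Away from the fibre the inverse of \<open>gmap\<close> is explicit: the graph map in the
  linear coordinates. It is analytic into chart \<open>c\<close> because the generator
  \<open>c\<close> does not vanish there.\<close>

lemma resolution_exists:
  assumes W: "open W" "W \<subseteq> params" and K: "\<And>\<theta>. \<theta> \<in> params \<Longrightarrow> K \<theta> = KL \<theta>"
  shows "\<exists>k h. resolution K W (top_of_set (XW W)) (atlas W) gmap k h"
proof -
  let ?X = "top_of_set (XW W)"
  let ?U0 = "zero_fibre K ?X gmap"
  have Kz: "K \<theta> = 0 \<longleftrightarrow> \<theta> = base" if "\<theta> \<in> W" for \<theta>
    using K[OF subsetD[OF W(2) that]] KL_eq_0_iff[OF subsetD[OF W(2) that]] by (simp only:)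
  have U0: "?U0 = {p \<in> XW W. gmap p = base}"
    using Kz by (auto simp: zero_fibre_def XW_def)
  define U' where "U' = XW W - ?U0"
  have U'_iff: "p \<in> U' \<longleftrightarrow> p \<in> pts \<and> gmap p \<in> W \<and> gmap p \<noteq> base" for p
    unfolding U'_def U0 by (auto simp: XW_def)
  have gr: "p = graph (crd p)" "gmap p \<in> W" "gmap p \<noteq> base" if "p \<in> U'" for p
    using that pts_eq_graph[of p] gmap_eq_base_iff[of p] by (simp_all add: U'_iff)
  have gr_in: "graph (unlin (\<theta> - base)) \<in> U'" "gmap (graph (unlin (\<theta> - base))) = \<theta>" if "\<theta> \<in> W" "\<theta> \<noteq> base" for \<theta>
  proof -
    show g: "gmap (graph (unlin (\<theta> - base))) = \<theta>" by (simp add: gmap_def graph_def bij_coord)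
    have "unlin (\<theta> - base) \<noteq> 0"
    proof
      assume "unlin (\<theta> - base) = 0"
      then have "\<theta> = coord 0" using bij_coord(1)[of \<theta>] by simp
      then show False using that(2) linear_0[OF linear_lin] by (simp add: coord_def)
    qed
    then show "graph (unlin (\<theta> - base)) \<in> U'"
      using graph_in_pts g that unfolding U'_iff by simp
  qed
  have inj: "inj_on gmap U'"
  proof (rule inj_onI)
    fix p p' assume p: "p \<in> U'" "p' \<in> U'" "gmap p = gmap p'"
    then have "crd p = (crd p' :: real ^ 'n)" using bij_coord(2) unfolding gmap_def by metis
    then show "p = p'" using gr(1)[OF p(1)] gr(1)[OF p(2)] by metis
  qed
  have bij: "bij_betw gmap U' {\<theta> \<in> W. K \<theta> \<noteq> 0}"
    unfolding bij_betw_def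
  proof (intro conjI inj equalityI subsetI)
    show "\<theta> \<in> {\<theta> \<in> W. K \<theta> \<noteq> 0}" if "\<theta> \<in> gmap ` U'" for \<theta> using that gr(2,3) Kz by auto
    show "\<theta> \<in> gmap ` U'" if "\<theta> \<in> {\<theta> \<in> W. K \<theta> \<noteq> 0}" for \<theta> using that gr_in[of \<theta>] Kz by (metis (mono_tags, lifting) image_eqI mem_Collect_eq)
  qed
  have inv: "inv_into U' gmap \<theta> = graph (unlin (\<theta> - base))" if "\<theta> \<in> W" "\<theta> \<noteq> base" for \<theta>
    by (intro inv_into_f_eq[OF inj] gr_in that)
  have an: "analytic_map_on (cmap c s \<circ> inv_into U' gmap) (gmap ` (VW W c - ?U0))" if c: "c \<in> vert" for c s
    unfolding analytic_map_on_def real_analytic_on_def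
  proof (intro allI ballI)
    fix j \<theta> assume "\<theta> \<in> gmap ` (VW W c - ?U0)"
    then obtain p where p: "p \<in> VW W c" "p \<in> U'" "\<theta> = gmap p" by (auto simp: U'_def VW_def)
    have \<theta>: "\<theta> \<in> W - {base}" using gr(2,3)[OF p(2)] p(3) by simp
    have "graph (unlin (\<theta> - base)) = p" using inv[of \<theta>] \<theta> p(2,3) inj by simp
    then have nz: "prj (graph (unlin (\<theta> - base))) c c \<noteq> 0" using p(1) by (simp add: VW_def)
    show "real_analytic_at (\<lambda>x. (cmap c s \<circ> inv_into U' gmap) x $ j) \<theta>"
    proof (rule real_analytic_at_transform[of "\<lambda>\<theta>. phi c (graph (unlin (\<theta> - base))) $ j - s $ j" _ "W - {base}"])
      have "real_analytic_at (\<lambda>\<theta>. unlin (\<theta> - base) $ i) \<theta>" for i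
        unfolding unlin_def vec_lambda_beta vector_minus_component
        by (intro real_analytic_at_if real_analytic_intros)
      then show "real_analytic_at (\<lambda>\<theta>. phi c (graph (unlin (\<theta> - base))) $ j - s $ j) \<theta>"
        by (intro real_analytic_at_diff real_analytic_at_const real_analytic_phi_graph[of "\<lambda>\<theta>. unlin (\<theta> - base)"] nz)
      show "open (W - {base})" using W(1) by (simp add: open_Diff)
      show "phi c (graph (unlin (y - base))) $ j - s $ j = (cmap c s \<circ> inv_into U' gmap) y $ j" if "y \<in> W - {base}" for y
        using inv[of y] that by (simp add: cmap_def)
    qed (rule \<theta>)
  qed
  have an2: "analytic_map_on (gmap \<circ> inv_into (VW W c) (cmap c s)) (cmap c s ` VW W c)" if c: "c \<in> vert" for c s
    unfolding analytic_map_on_def real_analytic_on_def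
  proof (intro allI ballI)
    fix j u assume u: "u \<in> cmap c s ` VW W c"
    show "real_analytic_at (\<lambda>x. (gmap \<circ> inv_into (VW W c) (cmap c s)) x $ j) u"
    proof (rule real_analytic_at_transform[OF _ is_chartD(3)[OF is_chart_cmap[OF W(1) c]] u])
      show "real_analytic_at (\<lambda>u. base $ j + lin (psi c (u + s)) $ j) u"
        by (intro real_analytic_at_add real_analytic_at_const real_analytic_lin
            real_analytic_at_shift real_analytic_psi)
      show "base $ j + lin (psi c (y + s)) $ j = (gmap \<circ> inv_into (VW W c) (cmap c s)) y $ j"
        if "y \<in> cmap c s ` VW W c" for y
        using inv_into_cmap[OF c that] by (simp add: gmap_Psi coord_def)
    qed
  qed
  have "\<forall>Q\<in>?U0. \<exists>k h. normal_crossing K ?X (atlas W) gmap Q k h"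
    using blowup_normal_crossing[OF W K] unfolding U0 by blast
  then obtain k h where kh: "\<And>Q. Q \<in> ?U0 \<Longrightarrow> normal_crossing K ?X (atlas W) gmap Q (k Q) (h Q)"
    by metis
  have "resolution K W ?X (atlas W) gmap k h"
    unfolding resolution_def Let_def
  proof (intro conjI)
    show "analytic_manifold ?X (atlas W)" by (rule blowup_manifold[OF W(1)])
    show "continuous_map ?X (top_of_set W) gmap" by (auto simp: continuous_on_gmap XW_def)
    show "proper_map ?X (top_of_set W) gmap" by (rule blowup_proper[OF W(1)])
    show "\<forall>(V, \<phi>)\<in>atlas W. analytic_map_on (gmap \<circ> inv_into V \<phi>) (\<phi> ` V)"
      using an2 by (auto simp: atlas_def)
    show "bij_betw gmap (topspace ?X - ?U0) {\<theta> \<in> W. K \<theta> \<noteq> 0}" using bij by (simp add: U'_def)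
    show "\<forall>(V, \<phi>)\<in>atlas W. analytic_map_on (\<phi> \<circ> inv_into (topspace ?X - ?U0) gmap) (gmap ` (V - ?U0))"
      using an by (auto simp: atlas_def U'_def)
    show "\<forall>Q\<in>?U0. normal_crossing K ?X (atlas W) gmap Q (k Q) (h Q)" using kh by blast
  qed
  then show ?thesis by blast
qed

section \<open>Uniqueness and existence of the threshold\<close>

theorem rlct_at_base:
  assumes K: "\<And>\<theta>. \<theta> \<in> params \<Longrightarrow> K \<theta> = KL \<theta>"
  shows "rlct params K base = ereal lam"
proof -
  obtain C where upper: "\<forall>t>0. \<exists>B\<in>sets borel. {\<theta>\<in>params. KL \<theta> \<le> t} \<subseteq> B \<and> emeasure lborel B \<le> ennreal (C * t powr lam)"
    using sublevel_upper by blast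
  have lam: "lam > 0" by (simp add: lam_def)
  have thr: "resolution_threshold (zero_fibre K X g) k h = ereal lam"
    if "open W" "base \<in> W" "W \<subseteq> params" "resolution K W X A g k h"
    for W and X :: "(nat \<Rightarrow> real) topology" and A g k h
  proof (rule resolution_threshold_eq[OF that(4,1,2,3)])
    show "0 \<le> K \<theta>" "K \<theta> = 0 \<longleftrightarrow> \<theta> = base" if "\<theta> \<in> params" for \<theta>
      using that K KL_nonneg KL_eq_0_iff by auto
    have eq: "{\<theta>\<in>params. K \<theta> \<le> t} = {\<theta>\<in>params. KL \<theta> \<le> t}" for t using K by auto
    show "\<exists>B\<in>sets borel. {\<theta>\<in>params. K \<theta> \<le> t} \<subseteq> B \<and> emeasure lborel B \<le> ennreal (C * t powr lam)" if "t > 0" for t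
      unfolding eq using upper that by blast
    obtain r0 where r0: "r0 > 0" "ball base r0 \<subseteq> params"
      using open_params base_in_params open_contains_ball by blast
    fix r :: real assume "r > 0"
    \<comment> \<open>\<open>K\<close> is known to agree with \<open>KL\<close> only on
      \<open>params\<close>, so the ball is shrunk into \<open>params\<close>.\<close>
    then have "min r r0 > 0" using r0 by simp
    from sublevel_lower[OF this] obtain c t0 where ct: "c > 0" "t0 > 0" and
      B: "\<And>t. 0 < t \<Longrightarrow> t < t0 \<Longrightarrow> \<exists>B\<in>sets borel. B \<subseteq> {\<theta>\<in>ball base (min r r0). KL \<theta> \<le> t} \<and> ennreal (c * t powr lam) \<le> emeasure lborel B"
      by blast
    have sub: "{\<theta>\<in>ball base (min r r0). KL \<theta> \<le> t} \<subseteq> {\<theta>\<in>ball base r. K \<theta> \<le> t}" for t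
      using K r0(2) by auto
    have "\<exists>B\<in>sets borel. B \<subseteq> {\<theta>\<in>ball base r. K \<theta> \<le> t} \<and> ennreal (c * t powr lam) \<le> emeasure lborel B"
      if t: "0 < t" "t < t0" for t
      using B[OF t] sub[of t] by (meson subset_trans)
    then show "\<exists>c>0. \<exists>t\<^sub>0>0. \<forall>t. 0 < t \<and> t < t\<^sub>0 \<longrightarrow>
       (\<exists>B\<in>sets borel. B \<subseteq> {\<theta>\<in>ball base r. K \<theta> \<le> t} \<and> ennreal (c * t powr lam) \<le> emeasure lborel B)"
      using ct by blast
  qed (rule lam)
  show ?thesis unfolding rlct_def
  proof (rule the_equality)
    show "is_rlct params K base (ereal lam)"
      unfolding is_rlct_def
    proof (intro allI impI)
      fix N' assume N': "open N' \<and> base \<in> N'"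
      let ?W = "N' \<inter> params"
      have W: "open ?W" "base \<in> ?W" "?W \<subseteq> params" using N' open_params base_in_params by auto
      obtain k h where res: "resolution K ?W (top_of_set (XW ?W)) (atlas ?W) gmap k h"
        using resolution_exists[OF W(1,3) K] by blast
      show "\<exists>W (X :: (nat \<Rightarrow> real) topology) A g k h. open W \<and> base \<in> W \<and> W \<subseteq> N' \<inter> params \<and> resolution K W X A g k h \<and>
           ereal lam = resolution_threshold (zero_fibre K X g) k h"
        using W res thr[OF W res] by (intro exI conjI) (auto simp: thr[OF W res])
    qed
    \<comment> \<open>Any candidate is the threshold of some resolution, and one neighbourhood,
      \<open>UNIV\<close>, is enough to produce it.\<close>
    fix l assume "is_rlct params K base l"
    then obtain W and X :: "(nat \<Rightarrow> real) topology" and A g k h where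
      "open W" "base \<in> W" "W \<subseteq> UNIV \<inter> params" "resolution K W X A g k h"
      "l = resolution_threshold (zero_fibre K X g) k h"
      unfolding is_rlct_def using open_UNIV by (metis UNIV_I)
    then show "l = ereal lam" using thr by simp
  qed
qed

end

theorem mainTheorem4:
  fixes M H :: nat and T :: "'n::finite \<Rightarrow> real" and z :: 'n and \<theta>\<^sub>0 :: real
  assumes "M \<ge> 2"
    and "H \<ge> 2" and "CARD('n) = H"
    and "\<And>i. i \<noteq> z \<Longrightarrow> 0 < T i \<and> T i < 1"
    and "(\<Sum>i\<in>UNIV - {z}. T i) < 1"
    and "0 < \<theta>\<^sub>0" and "\<theta>\<^sub>0 < 1"
  shows "learning_coefficient (binomial_pmf M \<theta>\<^sub>0) (binomial_mixture M T z)
           {\<theta> :: real ^ 'n. \<forall>i. 0 < \<theta> $ i \<and> \<theta> $ i < 1}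
         = ereal ((real H + 1) / 4)"
proof -
  interpret mixture_model M T z \<theta>\<^sub>0
    using assms by unfold_locales auto
  let ?K = "KL_fun (binomial_pmf M \<theta>\<^sub>0) (binomial_mixture M T z)"
  have "realization_params (binomial_pmf M \<theta>\<^sub>0) (binomial_mixture M T z) params = {base}"
    using KL_fun_eq KL_eq_0_iff base_in_params by (auto simp: realization_params_def)
  then have "learning_coefficient (binomial_pmf M \<theta>\<^sub>0) (binomial_mixture M T z) params = rlct params ?K base"
    by (simp add: learning_coefficient_def)
  also have "\<dots> = ereal lam" by (rule rlct_at_base[OF KL_fun_eq])
  finally show ?thesis using assms(3) by (simp add: params_def lam_def)
qed

end
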